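(* Let $\mathcal{O}$ be an o-minimal structure that contains the collection of semi-algebraic sets. Let $\gamma>0$ and assume that $G:\mathbb{R}^N\to\mathbb{R}$ is $C^2$ and definable in $\mathcal{O}$. Let $u$ be a bounded solution to $$u''(t)+\gamma u'(t)+\nabla G(u(t))=0,\quad t\in\mathbb{R}_+.$$ Then we have the following result. (i) $u'$ and $u''$ belong to $L^1((0,\infty);\mathbb{R}^N)$ and in particular $u$ converges to a single limit $u_\infty$ in $\operatorname{crit}G$. (ii) When $u$ converges to $u_\infty$ we denote by $\varphi$ the desingularizing function of $G$ at $u_\infty$. One has the following estimate $$\|u(t)-u_\infty\|\le c\,\nu(t),$$ where $c$ is a constant and $\nu$ is a solution of the worst-case gradient system $$\nu'(t)+(\varphi^{-1})'(\nu(t))=0,\quad\nu(0)>0.$$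
   Context: $\operatorname{crit}G=\{\nabla G=0\}$; a critical point is trivial if it lies in the interior of $\operatorname{crit}G$. Desingularizing function: for a differentiable $G:\mathbb{R}^N\to\mathbb{R}$ and $\bar u\in\mathbb{R}^N$, a function $\varphi\in C([0,r_0);\mathbb{R}_+)$ ($r_0>0$) is a desingularizing function of $G$ at $\bar u$ if $\varphi(0)=0$, $\varphi$ is $C^1$ on $(0,r_0)$, concave, with $\varphi'>0$ on $(0,r_0)$, and for some $\eta>0$: $|G(u)-G(\bar u)|<r_0$ for all $u$ in the open ball $B(\bar u,\eta)$, and $\|\nabla(\varphi\circ|G(\cdot)-G(\bar u)|)(u)\|\ge1$ for each $u\in B(\bar u,\eta)$ with $G(u)\ne G(\bar u)$. A $C^1$ definable function admits a desingularizing function at every point (Kurdyka-Łojasiewicz inequality). Convention: if the critical point is trivial, $\varphi$ is chosen so that $\varphi'(s)\ge\beta/\sqrt s$ for small $s>0$ and some $\beta>0$ (at nontrivial critical points of $C^2$ definable functions this holds automatically). O-minimal structure on $(\mathbb{R},+,\cdot)$: a sequence $\mathcal{O}=\{\mathcal{O}_n\}_{n\in\mathbb{N}}$, each $\mathcal{O}_n$ a Boolean algebra of subsets of $\mathbb{R}^n$, such that for each $n$: (i) $A\in\mathcal{O}_n$ implies $A\times\mathbb{R},\ \mathbb{R}\times A\in\mathcal{O}_{n+1}$; (ii) if $\Pi:\mathbb{R}^{n+1}\to\mathbb{R}^n$ is the canonical projection and $A\in\mathcal{O}_{n+1}$, then $\Pi(A)\in\mathcal{O}_n$; (iii) $\mathcal{O}_n$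 contains every set $\{x\in\mathbb{R}^n;p(x)=0\}$ with $p$ a real polynomial; (iv) the elements of $\mathcal{O}_1$ are exactly the finite unions of intervals and points. A function is definable in $\mathcal{O}$ if its graph belongs to $\mathcal{O}$. Semi-algebraic sets are finite unions of sets $\{p=0,\ p_i<0\ \forall i\in I\}$ with $I$ finite and $p,p_i$ real polynomials.
   Formalization: In (ii), desingularizing functions are not unique and the estimate fails for some (G=x²/2, γ=1, φ=√(2s)); it is proved that one exists and that each admissible φ₀ has a constant κ≥1 such that φ=κφ₀ satisfies the estimate for every solution ν, with c depending on ν. *)

theory Defs
  imports "HOL-Analysis.Analysis"
begin

subsection \<open>O-minimal structures\<close>

text \<open>The sets \<open>\<real>\<^sup>n\<close> for varying \<open>n\<close> are represented by the real lists of length \<open>n\<close>.\<close>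

definition rspace :: "nat \<Rightarrow> real list set" where
  "rspace n = {xs. length xs = n}"

text \<open>Polynomial functions in \<open>n\<close> real variables; the list counterpart of
  \<open>real_polynomial_function\<close>.\<close>

inductive polyfun_list :: "nat \<Rightarrow> (real list \<Rightarrow> real) \<Rightarrow> bool" for n :: nat where
  const: "polyfun_list n (\<lambda>xs. c)"
| var: "i < n \<Longrightarrow> polyfun_list n (\<lambda>xs. xs ! i)"
| add: "polyfun_list n p \<Longrightarrow> polyfun_list n q \<Longrightarrow> polyfun_list n (\<lambda>xs. p xs + q xs)"
| mult: "polyfun_list n p \<Longrightarrow> polyfun_list n q \<Longrightarrow> polyfun_list n (\<lambda>xs. p xs * q xs)"

text \<open>The projection \<open>\<real>\<^sup>n\<^sup>+\<^sup>1 \<rightarrow> \<real>\<^sup>n\<close> drops the last coordinate. In the description of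
  \<open>\<O>\<^sub>1\<close>, \<open>is_interval\<close> covers all bounded and unbounded intervals and the single points.\<close>

definition o_minimal :: "(nat \<Rightarrow> real list set set) \<Rightarrow> bool" where
  "o_minimal \<O> \<longleftrightarrow>
     (\<forall>n. algebra (rspace n) (\<O> n)) \<and>
     (\<forall>n. \<forall>A\<in>\<O> n. {xs @ [y] | xs y. xs \<in> A} \<in> \<O> (Suc n) \<and> {y # xs | y xs. xs \<in> A} \<in> \<O> (Suc n)) \<and>
     (\<forall>n. \<forall>A\<in>\<O> (Suc n). butlast ` A \<in> \<O> n) \<and>
     (\<forall>n p. polyfun_list n p \<longrightarrow> {xs \<in> rspace n. p xs = 0} \<in> \<O> n) \<and>
     \<O> 1 = {(\<lambda>x. [x]) ` \<Union>F | F. finite F \<and> (\<forall>I\<in>F. is_interval I)}"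

definition semialgebraic :: "nat \<Rightarrow> real list set \<Rightarrow> bool" where
  "semialgebraic n A \<longleftrightarrow>
     (\<exists>F. finite F \<and> A = \<Union>F \<and>
       (\<forall>B\<in>F. \<exists>p Q. polyfun_list n p \<and> finite Q \<and> (\<forall>q\<in>Q. polyfun_list n q) \<and>
          B = {xs \<in> rspace n. p xs = 0 \<and> (\<forall>q\<in>Q. q xs < 0)}))"

text \<open>The linear order on the index type only serves to list the coordinates.\<close>

definition coords :: "real ^ 'n::{finite,linorder} \<Rightarrow> real list" where
  "coords x = map (\<lambda>i. x $ i) (sorted_list_of_set UNIV)"

definition definable_fun :: "(nat \<Rightarrow> real list set set) \<Rightarrow> (real ^ 'n::{finite,linorder} \<Rightarrow> real) \<Rightarrow> bool" where
  "definable_fun \<O> G \<longleftrightarrow> range (\<lambda>x. coords x @ [G x]) \<in> \<O> (Suc CARD('n))"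

subsection \<open>Gradients and critical points\<close>

definition grad :: "('a::real_inner \<Rightarrow> real) \<Rightarrow> 'a \<Rightarrow> 'a" where
  "grad G x = (THE D. GDERIV G x :> D)"

definition C2 :: "('a::real_inner \<Rightarrow> real) \<Rightarrow> bool" where
  "C2 G \<longleftrightarrow> (\<exists>g H. (\<forall>x. GDERIV G x :> g x) \<and>
                   (\<forall>x. (g has_derivative blinfun_apply (H x)) (at x)) \<and> continuous_on UNIV H)"

text \<open>Only meant for differentiable functions: \<open>grad\<close> is unspecified elsewhere.\<close>

definition crit :: "('a::real_inner \<Rightarrow> real) \<Rightarrow> 'a set" where
  "crit G = {x. grad G x = 0}"

subsection \<open>Desingularizing functions\<close>

text \<open>The composition \<open>\<phi> \<circ> \<bar>G - G a\<bar>\<close> below is automatically differentiable at the points in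
  question when \<open>G\<close> is differentiable.\<close>

definition desingularizing ::
  "('a::real_inner \<Rightarrow> real) \<Rightarrow> 'a \<Rightarrow> real \<Rightarrow> (real \<Rightarrow> real) \<Rightarrow> bool" where
  "desingularizing G a r \<phi> \<longleftrightarrow>
     0 < r \<and> continuous_on {0..<r} \<phi> \<and> \<phi> ` {0..<r} \<subseteq> {0..} \<and> \<phi> 0 = 0 \<and>
     \<phi> C1_differentiable_on {0<..<r} \<and> concave_on {0..<r} \<phi> \<and>
     (\<forall>s\<in>{0<..<r}. deriv \<phi> s > 0) \<and>
     (\<exists>\<eta>>0. (\<forall>x\<in>ball a \<eta>. \<bar>G x - G a\<bar> < r) \<and>
            (\<forall>x\<in>ball a \<eta>. G x \<noteq> G a \<longrightarrow> 1 \<le> norm (grad (\<lambda>y. \<phi> \<bar>G y - G a\<bar>) x)))"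

text \<open>The convention at trivial critical points, where \<open>G\<close> is locally constant and the
  gradient inequality does not restrict \<open>\<phi>\<close> at all.\<close>

definition admissible_desingularizing ::
  "('a::real_inner \<Rightarrow> real) \<Rightarrow> 'a \<Rightarrow> real \<Rightarrow> (real \<Rightarrow> real) \<Rightarrow> bool" where
  "admissible_desingularizing G a r \<phi> \<longleftrightarrow>
     desingularizing G a r \<phi> \<and>
     (a \<in> interior (crit G) \<longrightarrow> (\<exists>\<beta>>0. \<forall>\<^sub>F s in at_right 0. deriv \<phi> s \<ge> \<beta> / sqrt s))"

text \<open>Global solutions of \<open>\<nu>' + (\<phi>\<inverse>)'(\<nu>) = 0\<close>, \<open>\<nu>(0) > 0\<close>. The inverse of \<open>\<phi>\<close> lives on the interval
  \<open>\<phi> ` {0..<r}\<close>; its derivative is one-sided at the end point 0.\<close>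

definition worst_case_solution :: "real \<Rightarrow> (real \<Rightarrow> real) \<Rightarrow> (real \<Rightarrow> real) \<Rightarrow> bool" where
  "worst_case_solution r \<phi> \<nu> \<longleftrightarrow>
     \<nu> 0 > 0 \<and>
     (\<forall>t\<ge>0. \<nu> t \<in> \<phi> ` {0..<r} \<and>
        (\<exists>d. (inv_into {0..<r} \<phi> has_real_derivative d) (at (\<nu> t) within \<phi> ` {0..<r}) \<and>
             (\<nu> has_real_derivative - d) (at t within {0..})))"

end

theory Submission
  imports Defs
begin

text \<open>
  Kurdyka-Lojasiewicz inequality: near a nontrivial critical point \<open>a\<close>, let \<open>\<psi> s\<close> be the least norm of
  \<open>\<nabla>G\<close> on the part of the level \<open>\<bar>G - G a\<bar> = s\<close> in a small ball, attained along a definable curve \<open>x\<close>.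
  The coordinates of \<open>x\<close> are eventually monotone and continuous, so \<open>x\<close> has finite length; since \<open>G\<close>
  changes at rate \<open>1\<close> along \<open>x\<close>, the function \<open>1/\<psi>\<close> is dominated by the length element, hence it is
  integrable, and its primitive is desingularizing. Monotonicity is proved with no cell decomposition:
  the side behaviour of a definable function is eventually of one of nine types, and strict local
  extrema of any real function are countable in number.

  Every desingularizing \<open>\<phi>\<close> satisfies \<open>\<phi>' \<ge> \<beta>/\<psi>\<close>, and \<open>\<psi> s = O(\<surd>s)\<close>, \<open>\<psi> (2 s) \<le> 4 \<psi> s\<close>. The energy
  \<open>E = \<bar>u'\<bar>\<^sup>2/2 + G u + \<mu> \<langle>\<nabla>G u, u'\<rangle>\<close> dissipates at least \<open>\<alpha> D\<close> with \<open>D = \<bar>u'\<bar>\<^sup>2 + \<bar>\<nabla>G u\<bar>\<^sup>2\<close>, and these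
  properties give \<open>D \<ge> c \<psi> (E - G a)\<^sup>2\<close> near a cluster point \<open>a\<close> of \<open>u\<close>. So \<open>\<surd>D\<close> is dominated by the
  decay of \<open>\<phi> (E - G a)\<close>, which yields finite length, and \<open>\<phi> (E - G a)\<close> is a subsolution of the
  worst-case system for a multiple of \<open>\<phi>\<close>.
\<close>

subsection \<open>Definable predicates and maps\<close>

text \<open>The rate is claimed for every admissible \<phi>, and such a \<phi> may be irregular:
  concavity gives no upper bound of \<open>deriv \<phi> (s / 2)\<close> by
  \<open>deriv \<phi> s\<close>. Yet the levels of the energy and of \<open>G (u t)\<close> differ
  by the kinetic and cross terms and have to be compared. Hence \<phi> is traded for the profile
  \<psi>: since its minimum is attained, testing the inequality for \<phi> at a minimizer bounds
  \<phi>' below by a multiple of 1/\<psi>, and the comparison is done with \<psi>, whose regularity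
  comes from definability. The bound of \<psi> by a square root is where the Lipschitz gradient
  enters; it covers the times when the energy gap is not explained by \<open>G (u t)\<close>. If
  \<open>G\<close> is constant near \<open>a\<close> there are no levels, \<psi> is taken to be the
  square root, and the convention on \<phi>' supplies \<beta>. The domination by the length element
  also yields \<psi> > 0, so small levels near \<open>a\<close> carry no critical points. A multiple
  of \<phi> appears because the energy is only known to lose
  \<open>c / (deriv \<phi> s)\<^sup>2\<close> with a possibly small \<open>c\<close>; enlarging
  \<phi> absorbs it.\<close>

lemma polyfun_list_compose:
  assumes "polyfun_list k p" and "\<And>i. i < k \<Longrightarrow> polyfun_list n (q i)"
  shows "polyfun_list n (\<lambda>xs. p (map (\<lambda>i. q i xs) [0..<k]))"
  using assms(1)
proof induction
  case (var i)
  then show ?case using assms(2)[of i] by simp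
qed (intro polyfun_list.intros; assumption)+

lemma polyfun_list_minus:
  assumes "polyfun_list n p" "polyfun_list n q"
  shows "polyfun_list n (\<lambda>xs. p xs - q xs)"
proof -
  have "polyfun_list n (\<lambda>xs. p xs + (\<lambda>xs. -1) xs * q xs)"
    by (intro polyfun_list.intros assms)
  then show ?thesis by simp
qed

text \<open>The axioms speak of the zero set of one polynomial; a system of equations is encoded as
  the vanishing of the sum of the squares.\<close>

lemma polyfun_list_sum_squares:
  assumes "\<And>j. j < (m::nat) \<Longrightarrow> polyfun_list n (q j)"
  shows "polyfun_list n (\<lambda>xs. \<Sum>j<m. (q j xs)\<^sup>2)"
  using assms
proof (induction m)
  case 0
  then show ?case using polyfun_list.const[of n 0] by simp
next
  case (Suc m)
  then have "polyfun_list n (\<lambda>xs. (\<Sum>j<m. (q j xs)\<^sup>2) + q m xs * q m xs)"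
    by (intro polyfun_list.intros) auto
  then show ?case by (simp add: power2_eq_square)
qed

text \<open>A type of this class stands for some R^n. A formula with free variables is then a
  predicate on a product type, and its definability follows by introduction rules along its syntax,
  with no list indices. The encoding is onto \<open>rspace\<close> so that negation corresponds to
  the complement.\<close>

class coordinatized =
  fixes enc :: "'a \<Rightarrow> real list"
    and coord_dim :: "'a itself \<Rightarrow> nat"
  assumes bij_enc: "bij_betw enc UNIV (rspace (coord_dim TYPE('a)))"
begin

lemma inj_enc: "inj enc"
  using bij_enc by (simp add: bij_betw_def)

lemma enc_eq_iff [simp]: "enc x = enc y \<longleftrightarrow> x = y"
  using inj_enc by (simp add: inj_eq)

lemma range_enc: "range enc = rspace (coord_dim TYPE('a))"
  using bij_enc by (simp add: bij_betw_def)

lemma length_enc [simp]: "length (enc x) = coord_dim TYPE('a)"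
  using range_enc by (auto simp: rspace_def)

lemma enc_surj: "length xs = coord_dim TYPE('a) \<Longrightarrow> \<exists>x. xs = enc x"
  using range_enc by (auto simp: rspace_def)

end

instantiation real :: coordinatized
begin
definition enc_real :: "real \<Rightarrow> real list" where "enc_real x = [x]"
definition coord_dim_real :: "real itself \<Rightarrow> nat" where "coord_dim_real _ = 1"
instance
proof
  show "bij_betw (enc :: real \<Rightarrow> _) UNIV (rspace (coord_dim TYPE(real)))"
  proof -
    have "xs \<in> range (enc :: real \<Rightarrow> _)" if "length xs = 1" for xs
      using that by (cases xs) (auto simp: enc_real_def)
    then show ?thesis
      by (auto simp: bij_betw_def inj_def rspace_def enc_real_def coord_dim_real_def)
  qed
qed
end

instantiation prod :: (coordinatized, coordinatized) coordinatized
begin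
definition enc_prod :: "'a \<times> 'b \<Rightarrow> real list" where "enc_prod p = enc (fst p) @ enc (snd p)"
definition coord_dim_prod :: "('a \<times> 'b) itself \<Rightarrow> nat"
  where "coord_dim_prod _ = coord_dim TYPE('a) + coord_dim TYPE('b)"
instance
proof
  show "bij_betw (enc :: 'a \<times> 'b \<Rightarrow> _) UNIV (rspace (coord_dim TYPE('a \<times> 'b)))"
    unfolding bij_betw_def
  proof
    show "inj (enc :: 'a \<times> 'b \<Rightarrow> _)"
      by (auto simp: inj_def enc_prod_def)
    have "\<exists>p::'a \<times> 'b. xs = enc p" if len: "length xs = coord_dim TYPE('a) + coord_dim TYPE('b)" for xs
    proof -
      obtain x :: 'a where "take (coord_dim TYPE('a)) xs = enc x"
        using enc_surj[of "take (coord_dim TYPE('a)) xs", where 'a='a] by (auto simp: len)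
      moreover obtain y :: 'b where "drop (coord_dim TYPE('a)) xs = enc y"
        using enc_surj[of "drop (coord_dim TYPE('a)) xs", where 'a='b] by (auto simp: len)
      ultimately have "xs = enc (x, y)"
        by (metis append_take_drop_id enc_prod_def fst_conv snd_conv)
      then show ?thesis ..
    qed
    moreover have "length (enc p) = coord_dim TYPE('a) + coord_dim TYPE('b)" for p :: "'a \<times> 'b"
      by (simp add: enc_prod_def)
    ultimately show "range (enc :: 'a \<times> 'b \<Rightarrow> _) = rspace (coord_dim TYPE('a \<times> 'b))"
      unfolding rspace_def coord_dim_prod_def by blast
  qed
qed
end

text \<open>One-dimensional coordinate spaces: \<^class>\<open>coordinatized\<close> cannot be instantiated for
  \<^typ>\<open>real ^ 'n\<close> alone, only for \<open>'a ^ 'n\<close> with \<open>'a\<close> in a class.\<close>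

class coordinate_line = coordinatized +
  assumes coord_dim_1: "coord_dim TYPE('a) = 1"

instance real :: coordinate_line
  by standard (simp add: coord_dim_real_def)

lemma enc_line: "enc (x :: 'a::coordinate_line) = [hd (enc x)]"
  using length_enc[of x] by (cases "enc x") (auto simp: coord_dim_1)

instantiation vec :: (coordinate_line, "{finite,linorder}") coordinatized
begin
definition enc_vec :: "('a, 'b) vec \<Rightarrow> real list"
  where "enc_vec x = map (\<lambda>i. hd (enc (x $ i))) (sorted_list_of_set UNIV)"
definition coord_dim_vec :: "(('a, 'b) vec) itself \<Rightarrow> nat" where "coord_dim_vec _ = CARD('b)"
instance
proof
  let ?e = "enc :: ('a, 'b) vec \<Rightarrow> _"
  let ?L = "sorted_list_of_set (UNIV :: 'b set)"
  have "x = y" if "?e x = ?e y" for x y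
  proof -
    have "hd (enc (x $ i)) = hd (enc (y $ i))" for i
      using that by (simp add: enc_vec_def)
    then have "enc (x $ i) = enc (y $ i)" for i
      by (metis enc_line)
    then show ?thesis by (simp add: vec_eq_iff)
  qed
  moreover have "xs \<in> range ?e" if "length xs = CARD('b)" for xs
  proof -
    have len: "length ?L = CARD('b)" by simp
    have surj: "\<exists>z::'a. enc z = [t]" for t
      using enc_surj[of "[t]", where 'a='a] by (auto simp: coord_dim_1)
    define idx where "idx i = (SOME k. k < CARD('b) \<and> ?L ! k = i)" for i
    have idx: "idx (?L ! k) = k" if "k < CARD('b)" for k
    proof -
      have "distinct ?L" by simp
      then have "\<And>l. l < CARD('b) \<Longrightarrow> ?L ! l = ?L ! k \<longleftrightarrow> l = k"
        using that len by (simp add: nth_eq_iff_index_eq)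
      then show ?thesis unfolding idx_def using that by (intro some_equality) auto
    qed
    define x :: "('a, 'b) vec" where "x = (\<chi> i. SOME z. enc z = [xs ! idx i])"
    have "enc (x $ i) = [xs ! idx i]" for i
      unfolding x_def using someI_ex[OF surj[of "xs ! idx i"]] by simp
    then have "?e x = xs"
      using that len idx by (intro nth_equalityI) (auto simp: enc_vec_def)
    then show ?thesis by blast
  qed
  ultimately show "bij_betw ?e UNIV (rspace (coord_dim TYPE(('a, 'b) vec)))"
    by (auto simp: bij_betw_def inj_def rspace_def coord_dim_vec_def enc_vec_def)
qed
end

lemma enc_real_vec: "enc (x :: real ^ 'n::{finite,linorder}) = coords x"
  by (simp add: enc_vec_def coords_def enc_real_def)

section \<open>Polynomial maps in coordinates\<close>

definition polymap :: "('a::coordinatized \<Rightarrow> 'b::coordinatized) \<Rightarrow> bool" where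
  "polymap f \<longleftrightarrow> (\<forall>j<coord_dim TYPE('b). \<exists>p. polyfun_list (coord_dim TYPE('a)) p \<and>
     (\<forall>x. enc (f x) ! j = p (enc x)))"

lemma polymap_id: "polymap (\<lambda>x::'a::coordinatized. x)"
  unfolding polymap_def
proof (intro allI impI)
  fix j assume "j < coord_dim TYPE('a)"
  then show "\<exists>p. polyfun_list (coord_dim TYPE('a)) p \<and> (\<forall>x::'a. enc x ! j = p (enc x))"
    by (intro exI[of _ "\<lambda>xs. xs ! j"] conjI polyfun_list.var) auto
qed

lemma polymap_const: "polymap (\<lambda>x::'a::coordinatized. c)"
  unfolding polymap_def
proof (intro allI impI)
  fix j
  show "\<exists>p. polyfun_list (coord_dim TYPE('a)) p \<and> (\<forall>x::'a. enc c ! j = p (enc x))"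
    by (intro exI[of _ "\<lambda>xs. enc c ! j"] conjI polyfun_list.const) auto
qed

lemma polymap_fst: "polymap (fst :: 'a::coordinatized \<times> 'b::coordinatized \<Rightarrow> 'a)"
  unfolding polymap_def
proof (intro allI impI)
  fix j assume "j < coord_dim TYPE('a)"
  then show "\<exists>p. polyfun_list (coord_dim TYPE('a \<times> 'b)) p \<and> (\<forall>x::'a \<times> 'b. enc (fst x) ! j = p (enc x))"
    by (intro exI[of _ "\<lambda>xs. xs ! j"] conjI polyfun_list.var)
      (auto simp: enc_prod_def coord_dim_prod_def nth_append)
qed

lemma polymap_snd: "polymap (snd :: 'a::coordinatized \<times> 'b::coordinatized \<Rightarrow> 'b)"
  unfolding polymap_def
proof (intro allI impI)
  fix j assume "j < coord_dim TYPE('b)"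
  then show "\<exists>p. polyfun_list (coord_dim TYPE('a \<times> 'b)) p \<and> (\<forall>x::'a \<times> 'b. enc (snd x) ! j = p (enc x))"
    by (intro exI[of _ "\<lambda>xs. xs ! (coord_dim TYPE('a) + j)"] conjI polyfun_list.var)
      (auto simp: enc_prod_def coord_dim_prod_def nth_append)
qed

lemma polymap_Pair:
  fixes f :: "'a::coordinatized \<Rightarrow> 'b::coordinatized" and g :: "'a \<Rightarrow> 'c::coordinatized"
  assumes "polymap f" "polymap g"
  shows "polymap (\<lambda>x. (f x, g x))"
  unfolding polymap_def
proof (intro allI impI)
  fix j assume j: "j < coord_dim TYPE('b \<times> 'c)"
  show "\<exists>p. polyfun_list (coord_dim TYPE('a)) p \<and> (\<forall>x. enc (f x, g x) ! j = p (enc x))"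
  proof (cases "j < coord_dim TYPE('b)")
    case True
    then show ?thesis using assms(1) by (simp add: polymap_def enc_prod_def nth_append)
  next
    case False
    then have "j - coord_dim TYPE('b) < coord_dim TYPE('c)"
      using j by (simp add: coord_dim_prod_def)
    then show ?thesis using assms(2) False by (simp add: polymap_def enc_prod_def nth_append)
  qed
qed

lemma polymap_comp:
  fixes f :: "'a::coordinatized \<Rightarrow> 'b::coordinatized" and g :: "'b \<Rightarrow> 'c::coordinatized"
  assumes "polymap g" "polymap f"
  shows "polymap (\<lambda>x. g (f x))"
  unfolding polymap_def
proof (intro allI impI)
  fix j assume "j < coord_dim TYPE('c)"
  then obtain p where p: "polyfun_list (coord_dim TYPE('b)) p" "\<And>y. enc (g y) ! j = p (enc y)"
    using assms(1) unfolding polymap_def by blast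
  obtain q where q: "\<And>i. i < coord_dim TYPE('b) \<Longrightarrow> polyfun_list (coord_dim TYPE('a)) (q i)"
    "\<And>i x. i < coord_dim TYPE('b) \<Longrightarrow> enc (f x) ! i = q i (enc x)"
    using assms(2) unfolding polymap_def by metis
  have "enc (f x) = map (\<lambda>i. q i (enc x)) [0..<coord_dim TYPE('b)]" for x
    using q(2) by (intro nth_equalityI) auto
  then show "\<exists>p. polyfun_list (coord_dim TYPE('a)) p \<and> (\<forall>x. enc (g (f x)) ! j = p (enc x))"
    using polyfun_list_compose[OF p(1) q(1)] p(2) by fastforce
qed

lemma polymap_real:
  fixes f :: "'a::coordinatized \<Rightarrow> real"
  shows "polymap f \<longleftrightarrow> (\<exists>p. polyfun_list (coord_dim TYPE('a)) p \<and> (\<forall>x. f x = p (enc x)))"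
  by (auto simp: polymap_def enc_real_def coord_dim_real_def)

lemma polymap_vec_nth:
  "polymap (\<lambda>x :: real ^ 'n::{finite,linorder}. x $ i)"
proof -
  have "i \<in> set (sorted_list_of_set UNIV)" by simp
  then obtain k where k: "k < CARD('n)" "sorted_list_of_set UNIV ! k = i"
    by (metis in_set_conv_nth length_sorted_list_of_set)
  then show ?thesis unfolding polymap_real
    by (intro exI[of _ "\<lambda>xs. xs ! k"] conjI polyfun_list.var)
      (auto simp: coord_dim_vec_def enc_vec_def enc_real_def)
qed

lemma polymap_add: "polymap (\<lambda>p :: real \<times> real. fst p + snd p)"
  unfolding polymap_real
  by (intro exI[of _ "\<lambda>xs. xs ! 0 + xs ! 1"] conjI polyfun_list.add polyfun_list.var)
    (auto simp: enc_prod_def enc_real_def coord_dim_prod_def coord_dim_real_def)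

lemma polymap_mult: "polymap (\<lambda>p :: real \<times> real. fst p * snd p)"
  unfolding polymap_real
  by (intro exI[of _ "\<lambda>xs. xs ! 0 * xs ! 1"] conjI polyfun_list.mult polyfun_list.var)
    (auto simp: enc_prod_def enc_real_def coord_dim_prod_def coord_dim_real_def)

section \<open>Products, projections and logical operations on definable sets\<close>

locale o_minimal_structure =
  fixes \<O> :: "nat \<Rightarrow> real list set set"
  assumes o_minimal: "o_minimal \<O>"
begin

lemma alg: "algebra (rspace n) (\<O> n)"
  and append_right: "A \<in> \<O> n \<Longrightarrow> {xs @ [y] | xs y. xs \<in> A} \<in> \<O> (Suc n)"
  and append_left: "A \<in> \<O> n \<Longrightarrow> {y # xs | y xs. xs \<in> A} \<in> \<O> (Suc n)"
  and butlast_image: "A \<in> \<O> (Suc n) \<Longrightarrow> butlast ` A \<in> \<O> n"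
  and zero_set: "polyfun_list n p \<Longrightarrow> {xs \<in> rspace n. p xs = 0} \<in> \<O> n"
  and unary_sets: "\<O> 1 = {(\<lambda>x. [x]) ` \<Union>F | F. finite F \<and> (\<forall>I\<in>F. is_interval I)}"
proof -
  note om = o_minimal[unfolded o_minimal_def]
  show "algebra (rspace n) (\<O> n)" using om by (elim conjE) (erule spec)
  note ext = conjunct1[OF conjunct2[OF om], rule_format, of A n]
  show "A \<in> \<O> n \<Longrightarrow> {xs @ [y] | xs y. xs \<in> A} \<in> \<O> (Suc n)"
    by (rule conjunct1[OF ext])
  show "A \<in> \<O> n \<Longrightarrow> {y # xs | y xs. xs \<in> A} \<in> \<O> (Suc n)"
    by (rule conjunct2[OF ext])
  show "A \<in> \<O> (Suc n) \<Longrightarrow> butlast ` A \<in> \<O> n"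
    using conjunct1[OF conjunct2[OF conjunct2[OF om]], rule_format, of A n] .
  show "polyfun_list n p \<Longrightarrow> {xs \<in> rspace n. p xs = 0} \<in> \<O> n"
    using conjunct1[OF conjunct2[OF conjunct2[OF conjunct2[OF om]]], rule_format, of n p] .
  show "\<O> 1 = {(\<lambda>x. [x]) ` \<Union>F | F. finite F \<and> (\<forall>I\<in>F. is_interval I)}"
    using om by blast
qed

lemma subset_rspace: "A \<in> \<O> n \<Longrightarrow> A \<subseteq> rspace n"
  using alg[of n] by (simp add: algebra_iff_Un subset_eq Pow_def)

lemma append_space_right:
  assumes "A \<in> \<O> n"
  shows "{zs \<in> rspace (n + m). take n zs \<in> A} \<in> \<O> (n + m)"
proof (induction m)
  case 0
  have "{zs \<in> rspace n. take n zs \<in> A} = A"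
    using subset_rspace[OF assms] by (auto simp: rspace_def)
  then show ?case using assms by simp
next
  case (Suc m)
  have "zs \<in> {xs @ [y] | xs y. xs \<in> {zs \<in> rspace (n + m). take n zs \<in> A}}"
    if "length zs = Suc (n + m)" "take n zs \<in> A" for zs
  proof -
    have "zs = butlast zs @ [last zs]" using that(1) by (cases zs rule: rev_cases) auto
    moreover have "butlast zs \<in> {zs \<in> rspace (n + m). take n zs \<in> A}"
      using that by (simp add: rspace_def take_butlast)
    ultimately show ?thesis by blast
  qed
  then have "{zs \<in> rspace (n + Suc m). take n zs \<in> A} =
      {xs @ [y] | xs y. xs \<in> {zs \<in> rspace (n + m). take n zs \<in> A}}"
    by (auto simp: rspace_def)
  then show ?case using append_right[OF Suc] by simp
qed

lemma append_space_left:
  assumes "A \<in> \<O> n"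
  shows "{zs \<in> rspace (m + n). drop m zs \<in> A} \<in> \<O> (m + n)"
proof (induction m)
  case 0
  have "{zs \<in> rspace n. zs \<in> A} = A" using subset_rspace[OF assms] by auto
  then show ?case using assms by simp
next
  case (Suc m)
  have "{zs \<in> rspace (Suc m + n). drop (Suc m) zs \<in> A} =
      {y # xs | y xs. xs \<in> {zs \<in> rspace (m + n). drop m zs \<in> A}}"
    by (auto simp: rspace_def length_Suc_conv)
  then show ?case using append_left[OF Suc] by simp
qed

text \<open>Iterates the one-coordinate projection, so that quantification over a type of any
  dimension stays definable.\<close>

lemma take_image:
  assumes "A \<in> \<O> (n + m)"
  shows "take n ` A \<in> \<O> n"
  using assms
proof (induction m arbitrary: A)
  case 0
  then have "take n ` A = A"
    using subset_rspace[of A n] by (force simp: rspace_def image_iff)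
  then show ?case using 0 by simp
next
  case (Suc m)
  have "take n (butlast xs) = take n xs" if "xs \<in> A" for xs
    using subset_rspace[OF Suc.prems] that by (auto simp: rspace_def take_butlast)
  then have "take n ` butlast ` A = take n ` A"
    by (force simp: image_image)
  then show ?case
    using Suc.IH[OF butlast_image[of A "n + m"]] Suc.prems by simp
qed

definition definable :: "('a::coordinatized \<Rightarrow> bool) \<Rightarrow> bool" where
  "definable P \<longleftrightarrow> enc ` Collect P \<in> \<O> (coord_dim TYPE('a))"

definition definable_map :: "('a::coordinatized \<Rightarrow> 'b::coordinatized) \<Rightarrow> bool" where
  "definable_map f \<longleftrightarrow> definable (\<lambda>p. snd p = f (fst p))"

named_theorems definable_intros

lemma definable_not [definable_intros]:
  fixes P :: "'a::coordinatized \<Rightarrow> bool"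
  assumes "definable P"
  shows "definable (\<lambda>x. \<not> P x)"
proof -
  interpret algebra "rspace (coord_dim TYPE('a))" "\<O> (coord_dim TYPE('a))" by (rule alg)
  have "enc ` {x. \<not> P x} = rspace (coord_dim TYPE('a)) - enc ` Collect P"
    using range_enc[where 'a='a] by (auto simp: set_eq_iff image_iff)
  then show ?thesis using assms by (auto simp: definable_def)
qed

lemma definable_conj [definable_intros]:
  fixes P :: "'a::coordinatized \<Rightarrow> bool"
  assumes "definable P" "definable Q"
  shows "definable (\<lambda>x. P x \<and> Q x)"
proof -
  interpret algebra "rspace (coord_dim TYPE('a))" "\<O> (coord_dim TYPE('a))" by (rule alg)
  have "enc ` {x. P x \<and> Q x} = enc ` Collect P \<inter> enc ` Collect Q"
    by auto
  then show ?thesis using assms by (auto simp: definable_def)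
qed

lemma definable_disj [definable_intros]: "definable P \<Longrightarrow> definable Q \<Longrightarrow> definable (\<lambda>x. P x \<or> Q x)"
  using definable_not[OF definable_conj[OF definable_not definable_not], of P Q] by simp

lemma definable_imp [definable_intros]: "definable P \<Longrightarrow> definable Q \<Longrightarrow> definable (\<lambda>x. P x \<longrightarrow> Q x)"
  unfolding imp_conv_disj by (intro definable_disj definable_not)

lemma definable_const [definable_intros]: "definable (\<lambda>x::'a::coordinatized. b)"
proof -
  interpret algebra "rspace (coord_dim TYPE('a))" "\<O> (coord_dim TYPE('a))" by (rule alg)
  show ?thesis by (cases b) (auto simp: definable_def range_enc)
qed

text \<open>For quantifiers over the coordinates of a vector, whose index type is no coordinate
  space, so that \<open>definable_all\<close> does not apply.\<close>

lemma definable_Ball_finite [definable_intros]: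
  fixes P :: "'i \<Rightarrow> 'a::coordinatized \<Rightarrow> bool"
  assumes "finite I" "\<And>i. i \<in> I \<Longrightarrow> definable (P i)"
  shows "definable (\<lambda>x. \<forall>i\<in>I. P i x)"
  using assms
proof (induction I)
  case (insert i I)
  then have "definable (\<lambda>x. P i x \<and> (\<forall>i\<in>I. P i x))"
    by (intro definable_conj) auto
  then show ?case by simp
qed (simp add: definable_const)

lemma definable_ex [definable_intros]:
  fixes P :: "'a::coordinatized \<Rightarrow> 'b::coordinatized \<Rightarrow> bool"
  assumes "definable (\<lambda>p. P (fst p) (snd p))"
  shows "definable (\<lambda>x. \<exists>y. P x y)"
proof -
  have "enc ` {x. \<exists>y. P x y} = take (coord_dim TYPE('a)) ` enc ` {p. P (fst p) (snd p)}"
    by (force simp: enc_prod_def image_iff)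
  then show ?thesis
    using take_image[of "enc ` {p. P (fst p) (snd p)}" "coord_dim TYPE('a)" "coord_dim TYPE('b)"] assms
    by (simp add: definable_def coord_dim_prod_def)
qed

lemma definable_all [definable_intros]:
  fixes P :: "'a::coordinatized \<Rightarrow> 'b::coordinatized \<Rightarrow> bool"
  assumes "definable (\<lambda>p. P (fst p) (snd p))"
  shows "definable (\<lambda>x. \<forall>y. P x y)"
  using definable_not[OF definable_ex[OF definable_not[OF assms]]] by simp

lemma definable_fst:
  fixes P :: "'a::coordinatized \<Rightarrow> bool"
  assumes "definable P"
  shows "definable (\<lambda>p::'a::coordinatized \<times> 'b::coordinatized. P (fst p))"
proof -
  let ?d = "coord_dim TYPE('a) + coord_dim TYPE('b)"
  have "take (coord_dim TYPE('a)) (enc p) \<in> enc ` Collect P \<longleftrightarrow> P (fst p)" for p :: "'a \<times> 'b"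
    by (auto simp: enc_prod_def)
  moreover have "\<exists>p::'a \<times> 'b. zs = enc p" if "zs \<in> rspace ?d" for zs
    using that by (intro enc_surj) (simp add: rspace_def coord_dim_prod_def)
  moreover have "enc (p::'a \<times> 'b) \<in> rspace ?d" for p
    by (simp add: rspace_def enc_prod_def)
  ultimately have "enc ` {p::'a \<times> 'b. P (fst p)} =
      {zs \<in> rspace ?d. take (coord_dim TYPE('a)) zs \<in> enc ` Collect P}"
    by blast
  then show ?thesis
    using append_space_right[of "enc ` Collect P"] assms by (simp add: definable_def coord_dim_prod_def)
qed

lemma definable_snd:
  fixes P :: "'b::coordinatized \<Rightarrow> bool"
  assumes "definable P"
  shows "definable (\<lambda>p::'a::coordinatized \<times> 'b::coordinatized. P (snd p))"
proof -
  let ?d = "coord_dim TYPE('a) + coord_dim TYPE('b)"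
  have "drop (coord_dim TYPE('a)) (enc p) \<in> enc ` Collect P \<longleftrightarrow> P (snd p)" for p :: "'a \<times> 'b"
    by (auto simp: enc_prod_def)
  moreover have "\<exists>p::'a \<times> 'b. zs = enc p" if "zs \<in> rspace ?d" for zs
    using that by (intro enc_surj) (simp add: rspace_def coord_dim_prod_def)
  moreover have "enc (p::'a \<times> 'b) \<in> rspace ?d" for p
    by (simp add: rspace_def enc_prod_def)
  ultimately have "enc ` {p::'a \<times> 'b. P (snd p)} =
      {zs \<in> rspace ?d. drop (coord_dim TYPE('a)) zs \<in> enc ` Collect P}"
    by blast
  then show ?thesis
    using append_space_left[of "enc ` Collect P"] assms by (simp add: definable_def coord_dim_prod_def)
qed

section \<open>Definable maps and the relations between them\<close>

lemma definable_map_polymap: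
  fixes f :: "'a::coordinatized \<Rightarrow> 'b::coordinatized"
  assumes "polymap f"
  shows "definable_map f"
proof -
  let ?a = "coord_dim TYPE('a)" and ?b = "coord_dim TYPE('b)"
  obtain p where p: "\<And>j. j < ?b \<Longrightarrow> polyfun_list ?a (p j)"
    "\<And>j x. j < ?b \<Longrightarrow> enc (f x) ! j = p j (enc x)"
    using assms unfolding polymap_def by metis
  \<comment> \<open>The zero set of \<open>Q\<close> is the graph of \<open>f\<close>: the first
    \<open>?a\<close> entries are the argument, the next \<open>?b\<close> the value.\<close>
  define Q where "Q xs = (\<Sum>j<?b. (xs ! (?a + j) - p j (map (\<lambda>i. xs ! i) [0..<?a]))\<^sup>2)" for xs
  have "polyfun_list (?a + ?b) Q"
    unfolding Q_def
    by (intro polyfun_list_sum_squares polyfun_list_minus polyfun_list_compose p polyfun_list.var) auto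
  then have Z: "{xs \<in> rspace (?a + ?b). Q xs = 0} \<in> \<O> (?a + ?b)"
    by (rule zero_set)
  have Q: "Q (enc q) = 0 \<longleftrightarrow> snd q = f (fst q)" for q :: "'a \<times> 'b"
  proof -
    have "map (\<lambda>i. enc q ! i) [0..<?a] = enc (fst q)"
      by (intro nth_equalityI) (auto simp: enc_prod_def nth_append)
    moreover have "enc q ! (?a + j) = enc (snd q) ! j" for j
      by (simp add: enc_prod_def nth_append)
    ultimately have "Q (enc q) = (\<Sum>j<?b. (enc (snd q) ! j - enc (f (fst q)) ! j)\<^sup>2)"
      unfolding Q_def using p(2) by (intro sum.cong) simp_all
    then have "Q (enc q) = 0 \<longleftrightarrow> (\<forall>j<?b. enc (snd q) ! j = enc (f (fst q)) ! j)"
      by (auto simp: sum_nonneg_eq_0_iff)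
    also have "\<dots> \<longleftrightarrow> enc (snd q) = enc (f (fst q))"
      by (auto simp: list_eq_iff_nth_eq)
    finally show ?thesis by simp
  qed
  have "{xs \<in> rspace (?a + ?b). Q xs = 0} = enc ` {q :: 'a \<times> 'b. Q (enc q) = 0}"
    using range_enc[where 'a="'a \<times> 'b"] by (auto simp: coord_dim_prod_def)
  then show ?thesis
    using Z Q unfolding definable_map_def definable_def by (simp add: coord_dim_prod_def)
qed

text \<open>Substitution is a quantifier over the graph: some \<open>y\<close> with
  \<open>y = f x\<close> satisfies \<open>P\<close>.\<close>

lemma definable_comp:
  fixes f :: "'a::coordinatized \<Rightarrow> 'b::coordinatized"
  assumes "definable P" "definable_map f"
  shows "definable (\<lambda>x. P (f x))"
proof -
  have "definable (\<lambda>x. \<exists>y. y = f x \<and> P y)"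
    using assms(2) unfolding definable_map_def
    by (intro definable_intros definable_snd assms(1))
  then show ?thesis by simp
qed

lemma definable_map_ident [definable_intros]: "definable_map (\<lambda>x. x)"
  and definable_map_const [definable_intros]: "definable_map (\<lambda>x. c)"
  by (intro definable_map_polymap polymap_id polymap_const)+

lemma definable_map_Pair [definable_intros]:
  fixes f :: "'a::coordinatized \<Rightarrow> 'b::coordinatized" and g :: "'a \<Rightarrow> 'c::coordinatized"
  assumes "definable_map f" "definable_map g"
  shows "definable_map (\<lambda>x. (f x, g x))"
proof -
  have 1: "definable_map (\<lambda>p::'a \<times> 'b \<times> 'c. (fst p, fst (snd p)))"
    and 2: "definable_map (\<lambda>p::'a \<times> 'b \<times> 'c. (fst p, snd (snd p)))"
    by (intro definable_map_polymap polymap_Pair polymap_fst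
        polymap_comp[OF polymap_fst polymap_snd] polymap_comp[OF polymap_snd polymap_snd])+
  have "definable (\<lambda>p::'a \<times> 'b \<times> 'c. fst (snd p) = f (fst p) \<and> snd (snd p) = g (fst p))"
    using definable_comp[OF assms(1)[unfolded definable_map_def] 1]
      definable_comp[OF assms(2)[unfolded definable_map_def] 2]
    by (intro definable_intros) auto
  then show ?thesis
    unfolding definable_map_def by (simp add: prod_eq_iff)
qed

lemma definable_map_comp:
  fixes f :: "'a::coordinatized \<Rightarrow> 'b::coordinatized" and g :: "'b \<Rightarrow> 'c::coordinatized"
  assumes g: "definable_map g" and f: "definable_map f"
  shows "definable_map (\<lambda>x. g (f x))"
proof -
  have "definable (\<lambda>x::'a \<times> 'c. \<exists>y::'b. y = f (fst x) \<and> snd x = g y)"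
  proof (intro definable_intros)
    have 1: "definable_map (\<lambda>p::('a \<times> 'c) \<times> 'b. (fst (fst p), snd p))"
      and 2: "definable_map (\<lambda>p::('a \<times> 'c) \<times> 'b. (snd p, snd (fst p)))"
      by (intro definable_map_polymap polymap_Pair polymap_snd
          polymap_comp[OF polymap_fst polymap_fst] polymap_comp[OF polymap_snd polymap_fst])+
    show "definable (\<lambda>p::('a \<times> 'c) \<times> 'b. snd p = f (fst (fst p)))"
      using definable_comp[OF f[unfolded definable_map_def] 1] by simp
    show "definable (\<lambda>p::('a \<times> 'c) \<times> 'b. snd (fst p) = g (snd p))"
      using definable_comp[OF g[unfolded definable_map_def] 2] by simp
  qed
  then show ?thesis
    unfolding definable_map_def by simp
qed

lemma definable_map_fst [definable_intros]:
  fixes f :: "'a::coordinatized \<Rightarrow> 'b::coordinatized \<times> 'c::coordinatized"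
  shows "definable_map f \<Longrightarrow> definable_map (\<lambda>x. fst (f x))"
  and definable_map_snd [definable_intros]: "definable_map f \<Longrightarrow> definable_map (\<lambda>x. snd (f x))"
  using definable_map_comp[OF definable_map_polymap[OF polymap_fst], of f]
    definable_map_comp[OF definable_map_polymap[OF polymap_snd], of f] by simp_all

lemma definable_map_vec_nth [definable_intros]:
  fixes f :: "'a::coordinatized \<Rightarrow> real ^ 'n::{finite,linorder}"
  shows "definable_map f \<Longrightarrow> definable_map (\<lambda>x. f x $ i)"
  by (rule definable_map_comp[OF definable_map_polymap[OF polymap_vec_nth]])

lemma definable_map_add [definable_intros]:
  fixes f g :: "'a::coordinatized \<Rightarrow> real"
  assumes "definable_map f" "definable_map g"
  shows "definable_map (\<lambda>x. f x + g x)"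
  using definable_map_comp[OF definable_map_polymap[OF polymap_add] definable_map_Pair[OF assms]]
  by simp

lemma definable_map_mult [definable_intros]:
  fixes f g :: "'a::coordinatized \<Rightarrow> real"
  assumes "definable_map f" "definable_map g"
  shows "definable_map (\<lambda>x. f x * g x)"
  using definable_map_comp[OF definable_map_polymap[OF polymap_mult] definable_map_Pair[OF assms]]
  by simp

lemma definable_map_diff [definable_intros]:
  fixes f g :: "'a::coordinatized \<Rightarrow> real"
  assumes "definable_map f" "definable_map g"
  shows "definable_map (\<lambda>x. f x - g x)"
proof -
  have "definable_map (\<lambda>x. f x + (-1) * g x)"
    by (intro definable_intros assms)
  then show ?thesis by simp
qed

lemma definable_map_sum [definable_intros]:
  fixes f :: "'i \<Rightarrow> 'a::coordinatized \<Rightarrow> real"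
  assumes "\<And>i. i \<in> I \<Longrightarrow> definable_map (f i)"
  shows "definable_map (\<lambda>x. \<Sum>i\<in>I. f i x)"
  using assms
proof (induction I rule: infinite_finite_induct)
  case (insert i I)
  then have "definable_map (\<lambda>x. f i x + (\<Sum>i\<in>I. f i x))"
    by (intro definable_intros) auto
  then show ?case using insert by simp
qed (simp_all add: definable_map_const)

lemma definable_eq [definable_intros]:
  fixes f g :: "'a::coordinatized \<Rightarrow> 'b::coordinatized"
  assumes "definable_map f" "definable_map g"
  shows "definable (\<lambda>x. f x = g x)"
  using definable_comp[OF definable_map_ident[unfolded definable_map_def] definable_map_Pair[OF assms(2,1)]]
  by simp

text \<open>Order is reduced to algebra: \<open>a \<le> b\<close> iff \<open>b - a\<close> is a
  square, a polynomial equation under an existential quantifier.\<close>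

lemma definable_le [definable_intros]:
  fixes f g :: "'a::coordinatized \<Rightarrow> real"
  assumes "definable_map f" "definable_map g"
  shows "definable (\<lambda>x. f x \<le> g x)"
proof -
  have "definable (\<lambda>x. \<exists>z::real. g (fst (x, z)) - f (fst (x, z)) = snd (x, z) * snd (x, z))"
    by (rule definable_ex, simp, intro definable_intros definable_map_comp[OF assms(1)] definable_map_comp[OF assms(2)])
  moreover have "(\<exists>z. b - a = z * z) \<longleftrightarrow> a \<le> b" for a b :: real
    by (metis diff_ge_0_iff_ge real_sqrt_mult_self abs_of_nonneg zero_le_square)
  ultimately show ?thesis by simp
qed

lemma definable_less [definable_intros]:
  fixes f g :: "'a::coordinatized \<Rightarrow> real"
  assumes "definable_map f" "definable_map g"
  shows "definable (\<lambda>x. f x < g x)"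
  using definable_not[OF definable_le[OF assms(2,1)]] by (simp add: not_le)

text \<open>For functions pinned down by a formula in their value, such as the absolute value and
  the norm as nonnegative square roots.\<close>

lemma definable_map_real:
  fixes f :: "'a::coordinatized \<Rightarrow> real"
  assumes "definable (\<lambda>p. Q (fst p) (snd p))" and "\<And>x z. Q x z \<longleftrightarrow> z = f x"
  shows "definable_map f"
  using assms unfolding definable_map_def by simp

lemma definable_map_abs [definable_intros]:
  fixes f :: "'a::coordinatized \<Rightarrow> real"
  assumes "definable_map f"
  shows "definable_map (\<lambda>x. \<bar>f x\<bar>)"
proof (rule definable_map_real)
  show "definable (\<lambda>p. 0 \<le> snd p \<and> snd p * snd p = f (fst p) * f (fst p))"
    by (intro definable_intros definable_map_comp[OF assms])
  show "0 \<le> z \<and> z * z = f x * f x \<longleftrightarrow> z = \<bar>f x\<bar>" for x z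
    by (auto simp: abs_if square_eq_iff)
qed

lemma definable_map_vec_diff [definable_intros]:
  fixes f g :: "'a::coordinatized \<Rightarrow> real ^ 'n::{finite,linorder}"
  assumes "definable_map f" "definable_map g"
  shows "definable_map (\<lambda>x. f x - g x)"
proof -
  have "definable (\<lambda>p. \<forall>i\<in>UNIV. snd p $ i = f (fst p) $ i - g (fst p) $ i)"
    by (intro definable_intros definable_map_comp[OF assms(1)] definable_map_comp[OF assms(2)]) auto
  then show ?thesis
    unfolding definable_map_def by (simp add: vec_eq_iff)
qed

lemma definable_map_inner [definable_intros]:
  fixes f g :: "'a::coordinatized \<Rightarrow> real ^ 'n::{finite,linorder}"
  assumes "definable_map f" "definable_map g"
  shows "definable_map (\<lambda>x. f x \<bullet> g x)"
  unfolding inner_vec_def inner_real_def by (intro definable_intros assms)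

lemma definable_map_norm [definable_intros]:
  fixes f :: "'a::coordinatized \<Rightarrow> real ^ 'n::{finite,linorder}"
  assumes "definable_map f"
  shows "definable_map (\<lambda>x. norm (f x))"
proof (rule definable_map_real)
  show "definable (\<lambda>p. 0 \<le> snd p \<and> snd p * snd p = f (fst p) \<bullet> f (fst p))"
    by (intro definable_intros definable_map_comp[OF assms])
  show "0 \<le> z \<and> z * z = f x \<bullet> f x \<longleftrightarrow> z = norm (f x)" for x z
    by (auto simp: dot_square_norm power2_eq_square square_eq_iff)
qed

text \<open>The bridge from the list-based notion in the statement to graphs in a product
  type.\<close>

lemma definable_fun_iff:
  fixes G :: "real ^ 'n::{finite,linorder} \<Rightarrow> real"
  shows "definable_fun \<O> G \<longleftrightarrow> definable_map G"
proof -
  have "enc ` {p :: (real, 'n) vec \<times> real. snd p = G (fst p)} = range (\<lambda>x. coords x @ [G x])"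
  proof -
    have "{p :: (real, 'n) vec \<times> real. snd p = G (fst p)} = range (\<lambda>x. (x, G x))"
      by auto
    then show ?thesis by (simp add: image_image enc_prod_def enc_real_vec enc_real_def)
  qed
  then show ?thesis
    unfolding definable_fun_def definable_map_def definable_def
    by (simp add: coord_dim_prod_def coord_dim_real_def coord_dim_vec_def)
qed

end

subsection \<open>Germs of definable functions of one variable\<close>

context o_minimal_structure
begin

text \<open>The only consequence of o-minimality proper that is used: one-sided germs of definable
  predicates are decided.\<close>

lemma definable_germ:
  fixes P :: "real \<Rightarrow> bool"
  assumes "definable P"
    and germ: "\<And>I. is_interval I \<Longrightarrow> (\<forall>\<^sub>F x in F. x \<in> I) \<or> (\<forall>\<^sub>F x in F. x \<notin> I)"
  shows "(\<forall>\<^sub>F x in F. P x) \<or> (\<forall>\<^sub>F x in F. \<not> P x)"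
proof -
  have "enc ` Collect P \<in> \<O> 1"
    using assms by (simp add: definable_def coord_dim_real_def)
  then obtain A where A: "finite A" "\<And>I. I \<in> A \<Longrightarrow> is_interval I"
    and "enc ` Collect P = (\<lambda>x. [x]) ` \<Union>A"
    unfolding unary_sets by blast
  moreover have "inj (\<lambda>x::real. [x])" by (simp add: inj_def)
  ultimately have "Collect P = \<Union>A"
    unfolding enc_real_def by (simp only: inj_image_eq_iff)
  then have P: "P x \<longleftrightarrow> x \<in> \<Union>A" for x
    by blast
  from A have "(\<forall>\<^sub>F x in F. x \<in> \<Union>A) \<or> (\<forall>\<^sub>F x in F. x \<notin> \<Union>A)"
  proof (induction A)
    case (insert I A)
    then have "(\<forall>\<^sub>F x in F. x \<in> I) \<or> (\<forall>\<^sub>F x in F. x \<notin> I)"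
      "(\<forall>\<^sub>F x in F. x \<in> \<Union>A) \<or> (\<forall>\<^sub>F x in F. x \<notin> \<Union>A)"
      using germ by auto
    then show ?case
      by (auto elim: eventually_mono intro: eventually_elim2)
  qed simp
  then show ?thesis by (simp add: P)
qed

text \<open>An interval with points arbitrarily close to \<open>a\<close> from the right, and with
  one fixed point \<open>c\<close> beyond them, contains everything between \<open>a\<close> and
  \<open>c\<close>.\<close>

lemma definable_germ_right:
  fixes P :: "real \<Rightarrow> bool"
  assumes "definable P"
  shows "(\<forall>\<^sub>F x in at_right a. P x) \<or> (\<forall>\<^sub>F x in at_right a. \<not> P x)"
proof (rule definable_germ[OF assms], rule disjCI)
  fix I :: "real set"
  assume I: "is_interval I" and n: "\<not> (\<forall>\<^sub>F x in at_right a. x \<notin> I)"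
  have *: "\<exists>y\<in>I. a < y \<and> y < b" if "b > a" for b
    using n that unfolding eventually_at_right_field by blast
  obtain c where "c \<in> I" "a < c" using *[of "a + 1"] by auto
  then have "x \<in> I" if "a < x" "x < c" for x
    using *[of x] that mem_is_interval_1_I[OF I, of _ c x] by force
  then show "\<forall>\<^sub>F x in at_right a. x \<in> I"
    using \<open>a < c\<close> unfolding eventually_at_right_field by blast
qed

lemma definable_germ_left:
  fixes P :: "real \<Rightarrow> bool"
  assumes "definable P"
  shows "(\<forall>\<^sub>F x in at_left a. P x) \<or> (\<forall>\<^sub>F x in at_left a. \<not> P x)"
proof (rule definable_germ[OF assms], rule disjCI)
  fix I :: "real set"
  assume I: "is_interval I" and n: "\<not> (\<forall>\<^sub>F x in at_left a. x \<notin> I)"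
  have *: "\<exists>y\<in>I. b < y \<and> y < a" if "b < a" for b
    using n that unfolding eventually_at_left_field by blast
  obtain c where "c \<in> I" "c < a" using *[of "a - 1"] by auto
  then have "x \<in> I" if "c < x" "x < a" for x
    using *[of x] that mem_is_interval_1_I[OF I, of c _ x] by force
  then show "\<forall>\<^sub>F x in at_left a. x \<in> I"
    using \<open>c < a\<close> unfolding eventually_at_left_field by blast
qed

lemma definable_eventually_right [definable_intros]:
  fixes P :: "'a::coordinatized \<Rightarrow> real \<Rightarrow> bool"
  assumes "definable (\<lambda>p. P (fst p) (snd p))" "definable_map a"
  shows "definable (\<lambda>x. \<forall>\<^sub>F y in at_right (a x). P x y)"
proof -
  have "definable (\<lambda>x. \<exists>b. a x < b \<and> (\<forall>y. a x < y \<longrightarrow> y < b \<longrightarrow> P x y))"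
    by (intro definable_intros definable_map_comp[OF assms(2)]
        definable_comp[OF assms(1), of "\<lambda>p. (fst (fst p), snd p)", simplified])
  then show ?thesis by (simp add: eventually_at_right_field)
qed

lemma definable_eventually_left [definable_intros]:
  fixes P :: "'a::coordinatized \<Rightarrow> real \<Rightarrow> bool"
  assumes "definable (\<lambda>p. P (fst p) (snd p))" "definable_map a"
  shows "definable (\<lambda>x. \<forall>\<^sub>F y in at_left (a x). P x y)"
proof -
  have "definable (\<lambda>x. \<exists>b. b < a x \<and> (\<forall>y. b < y \<longrightarrow> y < a x \<longrightarrow> P x y))"
    by (intro definable_intros definable_map_comp[OF assms(2)]
        definable_comp[OF assms(1), of "\<lambda>p. (fst (fst p), snd p)", simplified])
  then show ?thesis by (simp add: eventually_at_left_field)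
qed

end

text \<open>At the infimum \<open>s\<close> of the points where the relation fails, the left germ
  hands it on to \<open>s\<close> and the right germ carries it past \<open>s\<close>; the two germs
  take the place of continuity. The relation \<open>R\<close> is instantiated by (\<le>) and by
  (\<ge>).\<close>

lemma locally_monotone_imp_monotone:
  fixes f :: "real \<Rightarrow> 'b"
  assumes "transp R"
    and right: "\<And>x. a < x \<Longrightarrow> x < b \<Longrightarrow> \<forall>\<^sub>F y in at_right x. R (f x) (f y)"
    and left: "\<And>x. a < x \<Longrightarrow> x < b \<Longrightarrow> \<forall>\<^sub>F y in at_left x. R (f y) (f x)"
    and xy: "a < x" "x < y" "y < b"
  shows "R (f x) (f y)"
proof (rule ccontr)
  assume n: "\<not> R (f x) (f y)"
  define B where "B = {w. x < w \<and> w \<le> y \<and> \<not> R (f x) (f w)}"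
  have yB: "y \<in> B" using n xy by (simp add: B_def)
  have bdd: "bdd_below B" by (auto simp: B_def intro!: bdd_belowI[of _ x])
  define s where "s = Inf B"
  have sy: "s \<le> y" unfolding s_def by (rule cInf_lower[OF yB bdd])
  obtain c where c: "c > x" "\<And>w. x < w \<Longrightarrow> w < c \<Longrightarrow> R (f x) (f w)"
    using right[of x] xy unfolding eventually_at_right_field by auto
  have "c \<le> s" unfolding s_def using yB c by (intro cInf_greatest) (force simp: B_def)+
  then have xs: "x < s" using c by simp
  have below: "R (f x) (f w)" if "x < w" "w < s" for w
    using cInf_lower[OF _ bdd, of w] that sy by (force simp: B_def s_def)
  obtain d where d: "d < s" "\<And>w. d < w \<Longrightarrow> w < s \<Longrightarrow> R (f w) (f s)"
    using left[of s] xy xs sy unfolding eventually_at_left_field by auto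
  obtain w where "max d x < w" "w < s" using dense[of "max d x" s] d xs by auto
  then have s: "R (f x) (f s)"
    using below[of w] d(2)[of w] transpD[OF assms(1), of "f x" "f w" "f s"] by auto
  obtain e where e: "e > s" "\<And>w. s < w \<Longrightarrow> w < e \<Longrightarrow> R (f s) (f w)"
    using right[of s] xy xs sy unfolding eventually_at_right_field by auto
  obtain w where w: "w \<in> B" "w < e"
    using cInf_lessD[of B e] yB e(1) unfolding s_def by auto
  have "s \<le> w" unfolding s_def by (rule cInf_lower[OF w(1) bdd])
  then have "R (f x) (f w)"
    using s e(2)[of w] w transpD[OF assms(1), of "f x" "f s" "f w"] by (cases "s = w") auto
  then show False using w by (simp add: B_def)
qed

text \<open>Each such \<open>x\<close> is assigned a rational interval around it in which
  \<open>R (f x) (f y)\<close> holds for all other \<open>y\<close>. Two points with the same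
  interval would be related both ways, against asymmetry, so the assignment is injective.\<close>

lemma countable_strict_local_extrema:
  fixes f :: "real \<Rightarrow> 'b"
  assumes "asymp R"
  shows "countable {x. (\<forall>\<^sub>F y in at_right x. R (f x) (f y)) \<and> (\<forall>\<^sub>F y in at_left x. R (f x) (f y))}"
    (is "countable ?S")
proof -
  have "\<exists>p q :: rat. of_rat p < x \<and> x < of_rat q \<and>
      (\<forall>y. of_rat p < y \<longrightarrow> y < of_rat q \<longrightarrow> y \<noteq> x \<longrightarrow> R (f x) (f y))" if "x \<in> ?S" for x
  proof -
    obtain c d where "c > x" "\<And>w. x < w \<Longrightarrow> w < c \<Longrightarrow> R (f x) (f w)"
      "d < x" "\<And>w. d < w \<Longrightarrow> w < x \<Longrightarrow> R (f x) (f w)"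
      using \<open>x \<in> ?S\<close> unfolding eventually_at_right_field eventually_at_left_field by auto
    note cd = this
    obtain p where p: "d < of_rat p" "of_rat p < x" using of_rat_dense[OF cd(3)] by blast
    obtain q where q: "x < of_rat q" "of_rat q < c" using of_rat_dense[OF cd(1)] by blast
    have "R (f x) (f y)" if "of_rat p < y" "y < of_rat q" "y \<noteq> x" for y
      using cd(2)[of y] cd(4)[of y] that p q by (cases "x < y") auto
    then show ?thesis using p q by blast
  qed
  then have "\<forall>x\<in>?S. \<exists>p q :: rat. of_rat p < x \<and> x < of_rat q \<and>
      (\<forall>y. of_rat p < y \<longrightarrow> y < of_rat q \<longrightarrow> y \<noteq> x \<longrightarrow> R (f x) (f y))"
    by blast
  from bchoice[OF this] obtain p where "\<forall>x\<in>?S. \<exists>q :: rat. of_rat (p x) < x \<and> x < of_rat q \<and>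
      (\<forall>y. of_rat (p x) < y \<longrightarrow> y < of_rat q \<longrightarrow> y \<noteq> x \<longrightarrow> R (f x) (f y))" ..
  from bchoice[OF this] obtain q where pq: "\<forall>x\<in>?S. of_rat (p x) < x \<and> x < of_rat (q x) \<and>
      (\<forall>y. of_rat (p x) < y \<longrightarrow> y < of_rat (q x) \<longrightarrow> y \<noteq> x \<longrightarrow> R (f x) (f y))" ..
  have "inj_on (\<lambda>x. (p x, q x)) ?S"
  proof (rule inj_onI, rule ccontr)
    fix x y assume xy: "x \<in> ?S" "y \<in> ?S" "(p x, q x) = (p y, q y)" "x \<noteq> y"
    have "\<forall>z. of_rat (p x) < z \<longrightarrow> z < of_rat (q x) \<longrightarrow> z \<noteq> x \<longrightarrow> R (f x) (f z)"
      "of_rat (p y) < y" "y < of_rat (q y)"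
      "\<forall>z. of_rat (p y) < z \<longrightarrow> z < of_rat (q y) \<longrightarrow> z \<noteq> y \<longrightarrow> R (f y) (f z)"
      "of_rat (p x) < x" "x < of_rat (q x)"
      using bspec[OF pq xy(1)] bspec[OF pq xy(2)] by blast+
    then have "R (f x) (f y)" "R (f y) (f x)"
      using xy(3,4) by simp_all
    then show False using asympD[OF assms] by blast
  qed
  then show ?thesis
    by (rule countableI')
qed

section \<open>Monotonicity and continuity of definable germs\<close>

context o_minimal_structure
begin

lemma definable_monotone_germ:
  fixes f :: "real \<Rightarrow> real"
  assumes f: "definable_map f"
  obtains b where "b > 0" "monotone_on {0<..<b} (\<le>) (\<le>) f \<or> monotone_on {0<..<b} (\<le>) (\<ge>) f"
proof -
  note fc = definable_map_comp[OF f]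
  define r where "r R x \<longleftrightarrow> (\<forall>\<^sub>F y in at_right x. R (f x) (f y))" for R :: "real \<Rightarrow> real \<Rightarrow> bool" and x
  define l where "l R x \<longleftrightarrow> (\<forall>\<^sub>F y in at_left x. R (f x) (f y))" for R :: "real \<Rightarrow> real \<Rightarrow> bool" and x
  have r: "r (<) x \<or> r (=) x \<or> r (>) x" for x
  proof -
    have "definable (\<lambda>y. f x < f y)" "definable (\<lambda>y. f x > f y)"
      by (intro definable_intros fc)+
    from this[THEN definable_germ_right[of _ x]] show ?thesis
      unfolding r_def by (auto elim: eventually_elim2)
  qed
  have l: "l (<) x \<or> l (=) x \<or> l (>) x" for x
  proof -
    have "definable (\<lambda>y. f x < f y)" "definable (\<lambda>y. f x > f y)"
      by (intro definable_intros fc)+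
    from this[THEN definable_germ_left[of _ x]] show ?thesis
      unfolding l_def by (auto elim: eventually_elim2)
  qed
  have "definable (r R)" "definable (l R)" if "R \<in> {(<), (=), (>)}" for R
  proof -
    have "definable (\<lambda>p. R (f (fst p)) (f (snd p)))"
      using that by (elim insertE emptyE; simp only:) (intro definable_intros fc)+
    then have "definable (\<lambda>x. r R x)" "definable (\<lambda>x. l R x)"
      unfolding r_def l_def by (intro definable_intros; assumption)+
    then show "definable (r R)" "definable (l R)" by simp_all
  qed
  note dr = this(1)[THEN definable_germ_right[of _ 0]] and dl = this(2)[THEN definable_germ_right[of _ 0]]
  obtain Q R where QR: "Q \<in> {(<), (=), (>)}" "R \<in> {(<), (=), (>)}"
    and "\<forall>\<^sub>F x in at_right 0. r Q x" "\<forall>\<^sub>F x in at_right 0. l R x"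
  proof -
    let ?E = "\<lambda>P. \<forall>\<^sub>F x in at_right (0::real). P x"
    \<comment> \<open>The trichotomy at each point becomes a trichotomy of germs because every
      alternative is decided near 0.\<close>
    have dich: "\<exists>Q\<in>{(<), (=), (>)}. ?E (p Q)"
      if "\<And>x. p (<) x \<or> p (=) x \<or> p (>) x"
        and "?E (p (<)) \<or> ?E (\<lambda>x. \<not> p (<) x)" "?E (p (=)) \<or> ?E (\<lambda>x. \<not> p (=) x)"
          "?E (p (>)) \<or> ?E (\<lambda>x. \<not> p (>) x)"
      for p :: "(real \<Rightarrow> real \<Rightarrow> bool) \<Rightarrow> real \<Rightarrow> bool"
    proof (rule ccontr)
      assume "\<not> ?thesis"
      then have "?E (\<lambda>x. \<not> p (<) x)" "?E (\<lambda>x. \<not> p (=) x)" "?E (\<lambda>x. \<not> p (>) x)"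
        using that(2-4) by auto
      then have "?E (\<lambda>x. False)"
        by eventually_elim (use that(1) in blast)
      then show False by simp
    qed
    obtain Q where "Q \<in> {(<), (=), (>)}" "?E (r Q)"
      using dich[of r] r dr by blast
    moreover obtain R where "R \<in> {(<), (=), (>)}" "?E (l R)"
      using dich[of l] l dl by blast
    ultimately show thesis using that by blast
  qed
  then have "\<forall>\<^sub>F x in at_right 0. r Q x \<and> l R x"
    by (simp add: eventually_conj)
  then obtain b where b: "b > 0" "\<And>x. 0 < x \<Longrightarrow> x < b \<Longrightarrow> r Q x \<and> l R x"
    unfolding eventually_at_right_field by auto
  have unc: "\<not> {0<..<b} \<subseteq> S" if "countable S" for S
    using b uncountable_open_interval[of 0 b] countable_subset[OF _ that] by auto
  have "\<not> (Q = (<) \<and> R = (<))"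
    using unc[OF countable_strict_local_extrema[of "(<)" f]] b unfolding r_def l_def
    by (auto simp: subset_eq)
  moreover have "\<not> (Q = (>) \<and> R = (>))"
    using unc[OF countable_strict_local_extrema[of "(>)" f]] b unfolding r_def l_def
    by (auto simp: subset_eq)
  \<comment> \<open>\<open>Q\<close> compares \<open>f x\<close> with the values to its right,
    \<open>R\<close> with those to its left. Without the two pairs that make every point a strict
    extremum, the seven remaining pairs are nondecreasing or nonincreasing, the pair of equalities
    being both.\<close>
  ultimately consider "Q \<le> (\<le>)" "R \<le> (\<ge>)" | "Q \<le> (\<ge>)" "R \<le> (\<le>)"
    using QR by (auto simp: le_fun_def)
  then show thesis
  proof cases
    case 1
    have *: "\<forall>\<^sub>F y in at_right x. f x \<le> f y" "\<forall>\<^sub>F y in at_left x. f y \<le> f x"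
      if "0 < x" "x < b" for x
      using b(2)[OF that] 1 unfolding r_def l_def by (auto elim!: eventually_mono)
    have "f x \<le> f y" if "0 < x" "x < y" "y < b" for x y
      by (rule locally_monotone_imp_monotone[of "(\<le>)" 0 b f, OF _ * that]) auto
    then have "monotone_on {0<..<b} (\<le>) (\<le>) f"
      by (auto simp: monotone_on_def le_less)
    then show thesis using that b by blast
  next
    case 2
    have *: "\<forall>\<^sub>F y in at_right x. f x \<ge> f y" "\<forall>\<^sub>F y in at_left x. f y \<ge> f x"
      if "0 < x" "x < b" for x
      using b(2)[OF that] 2 unfolding r_def l_def by (auto elim!: eventually_mono)
    have "f x \<ge> f y" if "0 < x" "x < y" "y < b" for x y
      by (rule locally_monotone_imp_monotone[of "(\<ge>)" 0 b f, OF _ * that]) auto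
    then have "monotone_on {0<..<b} (\<le>) (\<ge>) f"
      by (auto simp: monotone_on_def le_less)
    then show thesis using that b by blast
  qed
qed

text \<open>Continuity at a point is a definable condition, hence decided near 0. It cannot fail on
  a whole interval where \<open>f\<close> is monotone, since a monotone function has only countably
  many discontinuities.\<close>

lemma definable_continuous_germ:
  fixes f :: "real \<Rightarrow> real"
  assumes f: "definable_map f"
  shows "\<forall>\<^sub>F x in at_right 0. isCont f x"
proof -
  have "definable (\<lambda>x. \<forall>e>0. \<exists>d>0. \<forall>y. \<bar>y - x\<bar> < d \<longrightarrow> \<bar>f y - f x\<bar> < e)"
    by (intro definable_intros definable_map_comp[OF f])
  then have "definable (isCont f)"
    by (rule back_subst[of definable]) (simp add: continuous_at_eps_delta fun_eq_iff dist_real_def)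
  then consider "\<forall>\<^sub>F x in at_right 0. isCont f x" | "\<forall>\<^sub>F x in at_right 0. \<not> isCont f x"
    using definable_germ_right by blast
  then show ?thesis
  proof cases
    case 2
    then obtain c where c: "c > 0" "\<And>x. 0 < x \<Longrightarrow> x < c \<Longrightarrow> \<not> isCont f x"
      unfolding eventually_at_right_field by auto
    obtain b where b: "b > 0" and m: "monotone_on {0<..<b} (\<le>) (\<le>) f \<or> monotone_on {0<..<b} (\<le>) (\<ge>) f"
      using definable_monotone_germ[OF f] .
    have "countable {x\<in>{0<..<b}. \<not> isCont f x}"
      using m
    proof
      assume "monotone_on {0<..<b} (\<le>) (\<le>) f"
      then show ?thesis by (intro mono_on_ctble_discont_open) auto
    next
      assume "monotone_on {0<..<b} (\<le>) (\<ge>) f"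
      then have "monotone_on {0<..<b} (\<le>) (\<le>) (\<lambda>x. - f x)"
        by (simp add: monotone_on_def)
      then have "countable {x\<in>{0<..<b}. \<not> isCont (\<lambda>x. - f x) x}"
        by (intro mono_on_ctble_discont_open) auto
      moreover have "isCont (\<lambda>x. - f x) x \<longleftrightarrow> isCont f x" for x
        using continuous_minus[of "at x" f] continuous_minus[of "at x" "\<lambda>x. - f x"] by auto
      ultimately show ?thesis by simp
    qed
    moreover have "{0<..<min b c} \<subseteq> {x\<in>{0<..<b}. \<not> isCont f x}"
      using c by auto
    ultimately have False
      using uncountable_open_interval[of 0 "min b c"] b c(1) countable_subset by auto
    then show ?thesis ..
  qed
qed

end

subsection \<open>The least gradient norm on levels\<close>

text \<open>Stands in for the sign of a derivative when a function is only known to be continuous,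
  as the length bound \<open>V\<close> below. Continuity carries the inequality to the supremum
  \<open>m\<close> of the good points, and the right germ at \<open>m\<close> carries it further
  unless \<open>m = t\<close>.\<close>

lemma right_locally_mono_imp_le:
  fixes F :: "real \<Rightarrow> real"
  assumes cont: "continuous_on {s..t} F" and "s \<le> t"
    and loc: "\<And>x. s \<le> x \<Longrightarrow> x < t \<Longrightarrow> \<forall>\<^sub>F y in at_right x. F x \<le> F y"
  shows "F s \<le> F t"
proof -
  define A where "A = {u. s \<le> u \<and> u \<le> t \<and> (\<forall>w\<in>{s..u}. F s \<le> F w)}"
  have sA: "s \<in> A" using \<open>s \<le> t\<close> by (auto simp: A_def)
  have bdd: "bdd_above A" by (auto simp: A_def intro!: bdd_aboveI[of _ t])
  define m where "m = Sup A"
  have sm: "s \<le> m" unfolding m_def by (rule cSup_upper[OF sA bdd])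
  have mt: "m \<le> t" unfolding m_def using sA by (intro cSup_least) (auto simp: A_def)
  have below: "F s \<le> F w" if "s \<le> w" "w < m" for w
  proof -
    obtain u where "u \<in> A" "w < u"
      using less_cSupD[of A w] sA \<open>w < m\<close> unfolding m_def by auto
    then show ?thesis using that by (auto simp: A_def)
  qed
  have Fm: "F s \<le> F m"
  proof (cases "s = m")
    case False
    then have "s < m" using sm by simp
    have "(F \<longlongrightarrow> F m) (at m within {s..t})"
      using cont sm mt by (auto simp: continuous_on_def)
    then have "(F \<longlongrightarrow> F m) (at_left m)"
      using \<open>s < m\<close> mt
      by (metis at_within_Icc_at_left tendsto_within_subset atLeastatMost_subset_iff order_refl sm)
    moreover have "\<forall>\<^sub>F w in at_left m. F s \<le> F w"
      using \<open>s < m\<close> below unfolding eventually_at_left_field by (intro exI[of _ s]) auto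
    ultimately show ?thesis
      by (intro tendsto_lowerbound[of F "F m" "at_left m"]) auto
  qed simp
  have "m = t"
  proof (rule ccontr)
    assume "m \<noteq> t"
    then obtain d where d: "d > m" "\<And>y. m < y \<Longrightarrow> y < d \<Longrightarrow> F m \<le> F y"
      using loc[of m] sm mt unfolding eventually_at_right_field by auto
    define u where "u = min t ((m + d) / 2)"
    have u: "m < u" "u < d" "u \<le> t"
      using d(1) \<open>m \<noteq> t\<close> mt by (auto simp: u_def min_def field_simps)
    have "F s \<le> F w" if "s \<le> w" "w \<le> u" for w
    proof (cases w m rule: linorder_cases)
      case greater
      then show ?thesis using d(2)[of w] that u Fm by auto
    qed (use below that Fm in auto)
    then have "u \<in> A" using u sm by (auto simp: A_def)
    then have "u \<le> m" unfolding m_def by (rule cSup_upper[OF _ bdd])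
    then show False using u by simp
  qed
  then show ?thesis using Fm by simp
qed

lemma GDERIV_increment:
  assumes "GDERIV G x :> D" "\<delta> > 0"
  shows "\<exists>d>0. \<forall>y. norm (y - x) < d \<longrightarrow> \<bar>G y - G x\<bar> \<le> (norm D + \<delta>) * norm (y - x)"
proof -
  from assms obtain d where d: "d > 0"
    "\<And>y. norm (y - x) < d \<Longrightarrow> norm (G y - G x - (y - x) \<bullet> D) \<le> \<delta> * norm (y - x)"
    unfolding gderiv_def has_derivative_at_alt by blast
  have "\<bar>G y - G x\<bar> \<le> (norm D + \<delta>) * norm (y - x)" if "norm (y - x) < d" for y
  proof -
    have "\<bar>(y - x) \<bullet> D\<bar> \<le> norm D * norm (y - x)"
      using Cauchy_Schwarz_ineq2[of "y - x" D] by (simp add: mult.commute)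
    with d(2)[OF that] show ?thesis by (simp add: algebra_simps)
  qed
  with d(1) show ?thesis by blast
qed

text \<open>The curve may have no derivative, so the chain rule is replaced by the first-order
  expansion of \<open>G\<close> at \<open>x \<tau>\<close>: with slack \<delta> it bounds the
  unit-rate change of the level by the displacement, hence by \<open>V\<close>, just to the right of
  \<tau>. \<open>right_locally_mono_imp_le\<close> makes this global, and \<delta> tends to 0 at the
  end.\<close>

lemma curve_increment_bound:
  fixes x :: "real \<Rightarrow> 'a::real_inner"
  assumes grad: "\<And>y. GDERIV G y :> g y"
    and level: "\<And>s. 0 < s \<Longrightarrow> s < b \<Longrightarrow> \<bar>G (x s) - l\<bar> = s"
    and V: "\<And>s. 0 < s \<Longrightarrow> s < b \<Longrightarrow> isCont V s"
    and len: "\<And>s t. 0 < s \<Longrightarrow> s \<le> t \<Longrightarrow> t < b \<Longrightarrow> norm (x t - x s) \<le> V t - V s"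
    and st: "0 < s" "s \<le> t" "t < b"
    and c: "\<And>\<tau>. s \<le> \<tau> \<Longrightarrow> \<tau> \<le> t \<Longrightarrow> norm (g (x \<tau>)) \<le> c"
  shows "t - s \<le> c * (V t - V s)"
proof -
  have "t - s \<le> (c + \<delta>) * (V t - V s)" if "\<delta> > 0" for \<delta>
  proof -
    have "(c + \<delta>) * V s - s \<le> (c + \<delta>) * V t - t"
    proof (rule right_locally_mono_imp_le[OF _ \<open>s \<le> t\<close>])
      show "continuous_on {s..t} (\<lambda>\<tau>. (c + \<delta>) * V \<tau> - \<tau>)"
        using V st by (intro continuous_intros continuous_at_imp_continuous_on ballI) auto
      fix \<tau> assume \<tau>: "s \<le> \<tau>" "\<tau> < t"
      then have \<tau>b: "0 < \<tau>" "\<tau> < b" using st by auto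
      obtain d where d: "d > 0"
        "\<And>y. norm (y - x \<tau>) < d \<Longrightarrow> \<bar>G y - G (x \<tau>)\<bar> \<le> (norm (g (x \<tau>)) + \<delta>) * norm (y - x \<tau>)"
        using GDERIV_increment[OF grad \<open>\<delta> > 0\<close>] by blast
      have "(V \<longlongrightarrow> V \<tau>) (at_right \<tau>)"
        using V[OF \<tau>b] by (simp add: isCont_def filterlim_at_split)
      then have "\<forall>\<^sub>F \<sigma> in at_right \<tau>. V \<sigma> < V \<tau> + d"
        using d(1) by (intro order_tendstoD) auto
      moreover have "\<forall>\<^sub>F \<sigma> in at_right \<tau>. \<sigma> < b \<and> \<tau> < \<sigma>"
        using \<tau>b unfolding eventually_at_right_field by auto
      ultimately show "\<forall>\<^sub>F \<sigma> in at_right \<tau>. (c + \<delta>) * V \<tau> - \<tau> \<le> (c + \<delta>) * V \<sigma> - \<sigma>"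
      proof eventually_elim
        case (elim \<sigma>)
        have l: "norm (x \<sigma> - x \<tau>) \<le> V \<sigma> - V \<tau>"
          using len[of \<tau> \<sigma>] \<tau>b elim by auto
        have "\<sigma> - \<tau> \<le> \<bar>G (x \<sigma>) - G (x \<tau>)\<bar>"
          using level[of \<sigma>] level[of \<tau>] \<tau>b elim by auto
        also have "\<dots> \<le> (norm (g (x \<tau>)) + \<delta>) * norm (x \<sigma> - x \<tau>)"
          using l elim by (intro d(2)) auto
        also have "\<dots> \<le> (c + \<delta>) * (V \<sigma> - V \<tau>)"
          using l c[of \<tau>] \<tau> \<open>\<delta> > 0\<close> order_trans[OF norm_ge_zero c[of \<tau>]] by (intro mult_mono) auto
        finally show ?case by (simp add: algebra_simps)
      qed
    qed
    then show ?thesis by (simp add: algebra_simps)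
  qed
  note * = this
  have "((\<lambda>\<delta>. (c + \<delta>) * (V t - V s)) \<longlongrightarrow> (c + 0) * (V t - V s)) (at_right 0)"
    by (intro tendsto_intros)
  moreover have "\<forall>\<^sub>F \<delta> in at_right 0. t - s \<le> (c + \<delta>) * (V t - V s)"
    using * unfolding eventually_at_right_field by (intro exI[of _ 1]) auto
  ultimately show ?thesis
    using tendsto_lowerbound[of _ _ "at_right (0::real)"] by (simp add: trivial_limit_at_right_real)
qed

text \<open>Within \<open>\<bar>g y\<bar>/(2M)\<close> of a non-critical point \<open>y\<close>, a step along \<open>\<plusminus> g y\<close> changes the value by
  order \<open>\<bar>g y\<bar>\<^sup>2/M\<close> while the gradient stays of order \<open>\<bar>g y\<bar>\<close>.\<close>

lemma gradient_le_sqrt_level: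
  fixes G :: "'a::euclidean_space \<Rightarrow> real"
  assumes grad: "\<And>y. GDERIV G y :> g y"
    and lip: "\<And>x y. x \<in> ball a \<rho> \<Longrightarrow> y \<in> ball a \<rho> \<Longrightarrow> norm (g x - g y) \<le> M * norm (x - y)"
    and M: "M > 0" and "g a = 0" and \<delta>: "0 < \<delta>" "\<delta> \<le> \<rho>"
    and nontriv: "\<And>d. d > 0 \<Longrightarrow> \<exists>x\<in>ball a d. G x \<noteq> G a"
  shows "\<exists>x\<in>ball a \<delta>. G x \<noteq> G a \<and> (norm (g x))\<^sup>2 \<le> 9 * M * \<bar>G x - G a\<bar>"
proof -
  have D: "(G has_derivative (\<lambda>h. h \<bullet> g y)) (at y within S)" for y S
    using grad[of y] unfolding gderiv_def by (rule has_derivative_at_withinI)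
  have "\<exists>y\<in>ball a (\<delta> / 2). g y \<noteq> 0"
  proof (rule ccontr)
    assume *: "\<not> ?thesis"
    have "G x = G a" if "x \<in> ball a (\<delta> / 2)" for x
    proof (rule has_derivative_zero_unique[of "ball a (\<delta> / 2)" G x a])
      show "(G has_derivative (\<lambda>h. 0)) (at y within ball a (\<delta> / 2))" if "y \<in> ball a (\<delta> / 2)" for y
        using D[of y] * that by fastforce
    qed (use that \<delta> in auto)
    moreover obtain x where "x \<in> ball a (\<delta> / 2)" "G x \<noteq> G a"
      using nontriv[of "\<delta> / 2"] \<delta> by fastforce
    ultimately show False by blast
  qed
  then obtain y where y: "norm (y - a) < \<delta> / 2" "g y \<noteq> 0"
    by (auto simp: dist_norm norm_minus_commute)
  define w where "w = (1 / (2 * M)) *\<^sub>R g y"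
  have "norm (g y) \<le> M * norm (y - a)"
    using lip[of y a] y(1) \<delta> \<open>g a = 0\<close> by (auto simp: dist_norm norm_minus_commute)
  also have "\<dots> \<le> M * (\<delta> / 2)"
    using y(1) M by (intro mult_left_mono) auto
  finally have w: "norm w \<le> \<delta> / 4"
    using M by (simp add: w_def field_simps)
  have ball: "y + \<theta> *\<^sub>R w \<in> ball a \<delta>" if "\<bar>\<theta>\<bar> \<le> 1" for \<theta>
  proof -
    have "norm (y + \<theta> *\<^sub>R w - a) \<le> norm (y - a) + \<bar>\<theta>\<bar> * norm w"
      using norm_triangle_ineq[of "y - a" "\<theta> *\<^sub>R w"] by (simp add: algebra_simps)
    also have "\<bar>\<theta>\<bar> * norm w \<le> norm w" using that by (simp add: mult_left_le_one_le)
    finally show ?thesis using w y(1) \<delta> by (simp add: dist_norm norm_minus_commute)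
  qed
  have gy: "norm (g (y + \<theta> *\<^sub>R w) - g y) \<le> norm (g y) / 2" if "\<bar>\<theta>\<bar> \<le> 1" for \<theta>
  proof -
    have "norm (g (y + \<theta> *\<^sub>R w) - g y) \<le> M * norm (y + \<theta> *\<^sub>R w - y)"
      using ball[OF that] ball[of 0] \<delta> by (intro lip) (auto simp: less_le_trans)
    also have "\<dots> \<le> M * norm w" using that M by (auto simp: mult_left_le_one_le)
    also have "\<dots> = norm (g y) / 2" using M by (simp add: w_def)
    finally show ?thesis .
  qed
  define h where "h \<theta> = G (y + \<theta> *\<^sub>R w)" for \<theta>
  have h: "(h has_real_derivative (w \<bullet> g (y + \<theta> *\<^sub>R w))) (at \<theta>)" for \<theta>
  proof -
    have "((\<lambda>\<theta>. y + \<theta> *\<^sub>R w) has_derivative (\<lambda>r. r *\<^sub>R w)) (at \<theta>)"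
      by (auto intro!: derivative_eq_intros)
    from has_derivative_compose[OF this grad[unfolded gderiv_def]]
    have "(h has_derivative (\<lambda>r. (r *\<^sub>R w) \<bullet> g (y + \<theta> *\<^sub>R w))) (at \<theta>)"
      unfolding h_def by simp
    then show ?thesis by (simp add: has_field_derivative_def mult_commute_abs)
  qed
  have "\<exists>z. -1 < z \<and> z < 1 \<and> h 1 - h (-1) = (1 - (-1)) * (w \<bullet> g (y + z *\<^sub>R w))"
    by (rule MVT2) (auto intro: h)
  then obtain z where "-1 < z \<and> z < 1 \<and> h 1 - h (-1) = (1 - (-1)) * (w \<bullet> g (y + z *\<^sub>R w))" ..
  then have z: "\<bar>z\<bar> \<le> 1" "h 1 - h (-1) = 2 * (w \<bullet> g (y + z *\<^sub>R w))" by auto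
  have "w \<bullet> g (y + z *\<^sub>R w) = w \<bullet> g y + w \<bullet> (g (y + z *\<^sub>R w) - g y)"
    by (simp add: inner_diff_right)
  moreover have "\<bar>w \<bullet> (g (y + z *\<^sub>R w) - g y)\<bar> \<le> norm w * (norm (g y) / 2)"
    by (rule order_trans[OF Cauchy_Schwarz_ineq2]) (intro mult_left_mono gy z norm_ge_zero)
  moreover have "w \<bullet> g y = (norm (g y))\<^sup>2 / (2 * M)" "norm w * (norm (g y) / 2) = (norm (g y))\<^sup>2 / (4 * M)"
    using M by (simp_all add: w_def power2_norm_eq_inner[symmetric] power2_eq_square)
  ultimately have "h 1 - h (-1) \<ge> (norm (g y))\<^sup>2 / (2 * M)"
    using z(2) by (simp add: field_simps)
  \<comment> \<open>Wherever \<open>G a\<close> lies, one of the two end values is at least half the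
    increment away from it.\<close>
  then have "(norm (g y))\<^sup>2 / (4 * M) \<le> \<bar>h 1 - G a\<bar> \<or> (norm (g y))\<^sup>2 / (4 * M) \<le> \<bar>h (-1) - G a\<bar>"
    by (auto simp: field_simps abs_if split: if_splits)
  then obtain \<theta> where \<theta>: "\<bar>\<theta>\<bar> \<le> 1" "(norm (g y))\<^sup>2 / (4 * M) \<le> \<bar>G (y + \<theta> *\<^sub>R w) - G a\<bar>"
    unfolding h_def by (metis abs_minus_cancel abs_one order_refl)
  have "norm (g (y + \<theta> *\<^sub>R w)) \<le> norm (g y) + norm (g y) / 2"
    using gy[OF \<theta>(1)] norm_triangle_sub[of "g (y + \<theta> *\<^sub>R w)" "g y"] by linarith
  \<comment> \<open>The factor \<open>9 * M\<close> is the product of (3/2)^2, from the growth of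
    the gradient along the step, and of \<open>4 * M\<close>, from the change of the value.\<close>
  then have "(norm (g (y + \<theta> *\<^sub>R w)))\<^sup>2 \<le> (3 / 2 * norm (g y))\<^sup>2"
    by (intro power_mono) auto
  also have "\<dots> \<le> 9 * M * \<bar>G (y + \<theta> *\<^sub>R w) - G a\<bar>"
    using \<theta>(2) M by (simp add: field_simps power2_eq_square)
  finally have "(norm (g (y + \<theta> *\<^sub>R w)))\<^sup>2 \<le> 9 * M * \<bar>G (y + \<theta> *\<^sub>R w) - G a\<bar>" .
  moreover have "G (y + \<theta> *\<^sub>R w) \<noteq> G a"
  proof
    assume "G (y + \<theta> *\<^sub>R w) = G a"
    with \<theta>(2) M have "(norm (g y))\<^sup>2 \<le> 0" by (simp add: field_simps)
    then show False using y(2) by simp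
  qed
  ultimately show ?thesis using ball[OF \<theta>(1)] by auto
qed

section \<open>Definable curves of least gradient and the profile along them\<close>

context o_minimal_structure
begin

text \<open>The epsilon-delta description of the derivative is a first-order formula in
  \<open>G\<close>, and uniqueness of the gradient makes it the graph of \<open>g\<close>.\<close>

lemma definable_map_gradient:
  fixes G :: "real ^ 'n::{finite,linorder} \<Rightarrow> real"
  assumes G: "definable_map G" and grad: "\<And>x. GDERIV G x :> g x"
  shows "definable_map g"
proof -
  let ?Q = "\<lambda>x z. \<forall>e. e > 0 \<longrightarrow> (\<exists>d. d > 0 \<and> (\<forall>y. norm (y - x) < d \<longrightarrow>
    \<bar>G y - G x - (y - x) \<bullet> z\<bar> \<le> e * norm (y - x)))"
  have "definable (\<lambda>p. ?Q (fst p) (snd p))"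
    by (intro definable_intros definable_map_comp[OF G])
  moreover have "?Q x z \<longleftrightarrow> z = g x" for x z
  proof -
    have "?Q x z \<longleftrightarrow> GDERIV G x :> z"
      unfolding gderiv_def has_derivative_at_alt
      by (simp add: bounded_linear_inner_left)
    also have "\<dots> \<longleftrightarrow> z = g x"
      using grad[of x] has_derivative_unique[of G _ x] unfolding gderiv_def
      by (metis inner_commute vector_eq_rdot ext)
    finally show ?thesis .
  qed
  ultimately show ?thesis
    unfolding definable_map_def by simp
qed

text \<open>Lexicographic minimization makes compact definable families single-valued.\<close>

lemma definable_compact_refine:
  fixes K :: "real \<Rightarrow> real ^ 'n::{finite,linorder} \<Rightarrow> bool"
  assumes "finite I" and K: "definable (\<lambda>p. K (fst p) (snd p))" "\<And>s. compact {x. K s x}"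
  shows "\<exists>K'. definable (\<lambda>p. K' (fst p) (snd p)) \<and> (\<forall>s. compact {x. K' s x}) \<and>
    (\<forall>s x. K' s x \<longrightarrow> K s x) \<and> (\<forall>s. (\<exists>x. K s x) \<longrightarrow> (\<exists>x. K' s x)) \<and>
    (\<forall>s x y. K' s x \<longrightarrow> K' s y \<longrightarrow> (\<forall>i\<in>I. x $ i = y $ i))"
  using assms(1)
proof (induction I)
  case empty
  show ?case using K by (intro exI[of _ K]) auto
next
  case (insert i I)
  then obtain K' where K': "definable (\<lambda>p. K' (fst p) (snd p))" "\<And>s. compact {x. K' s x}"
    "\<And>s x. K' s x \<Longrightarrow> K s x" "\<And>s. \<exists>x. K s x \<Longrightarrow> \<exists>x. K' s x"
    "\<And>s x y. K' s x \<Longrightarrow> K' s y \<Longrightarrow> \<forall>i\<in>I. x $ i = y $ i" by metis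
  define L where "L s x \<longleftrightarrow> K' s x \<and> (\<forall>y. K' s y \<longrightarrow> x $ i \<le> y $ i)" for s x
  have K'2: "definable (\<lambda>q::(real \<times> (real, 'n) vec) \<times> (real, 'n) vec. K' (fst (fst q)) (snd q))"
    using definable_comp[OF K'(1), of "\<lambda>q::(real \<times> (real, 'n) vec) \<times> (real, 'n) vec. (fst (fst q), snd q)"]
    by (simp add: definable_map_Pair definable_map_fst definable_map_snd definable_map_ident)
  have "definable (\<lambda>p. L (fst p) (snd p))"
    unfolding L_def by (intro definable_intros K'(1) K'2)
  moreover have "compact {x. L s x}" for s
  proof -
    have "{x. L s x} = {x. K' s x} \<inter> (\<Inter>y\<in>{y. K' s y}. {x. x $ i \<le> y $ i})"
      by (auto simp: L_def)
    moreover have "closed (\<Inter>y\<in>{y. K' s y}. {x. x $ i \<le> y $ i})"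
      by (intro closed_INT ballI closed_Collect_le continuous_intros)
    ultimately show ?thesis using K'(2)[of s] by (simp add: compact_Int_closed)
  qed
  moreover have "\<exists>x. L s x" if "\<exists>x. K s x" for s
  proof -
    have "{x. K' s x} \<noteq> {}" using K'(4)[OF that] by blast
    moreover have "continuous_on {x. K' s x} (\<lambda>x. x $ i)" by (intro continuous_intros)
    ultimately have "\<exists>x\<in>{x. K' s x}. \<forall>y\<in>{x. K' s x}. x $ i \<le> y $ i"
      by (rule continuous_attains_inf[OF K'(2)])
    then show ?thesis by (auto simp: L_def)
  qed
  moreover have "\<forall>j\<in>insert i I. x $ j = y $ j" if "L s x" "L s y" for s x y
  proof -
    have "K' s x" "K' s y" "x $ i \<le> y $ i" "y $ i \<le> x $ i"
      using that unfolding L_def by blast+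
    then show ?thesis using K'(5)[of s x y] by simp
  qed
  moreover have "K s x" if "L s x" for s x
    using that K'(3) unfolding L_def by blast
  ultimately show ?case by (intro exI[of _ L]) blast
qed

lemma definable_selection:
  fixes K :: "real \<Rightarrow> real ^ 'n::{finite,linorder} \<Rightarrow> bool"
  assumes K: "definable (\<lambda>p. K (fst p) (snd p))" "\<And>s. compact {x. K s x}"
  obtains x where "definable_map x" "\<And>s y. K s y \<Longrightarrow> K s (x s)"
proof -
  from definable_compact_refine[OF finite_class.finite_UNIV K] obtain K'
    where *: "definable (\<lambda>p. K' (fst p) (snd p)) \<and> (\<forall>s. compact {x. K' s x}) \<and>
      (\<forall>s x. K' s x \<longrightarrow> K s x) \<and> (\<forall>s. (\<exists>x. K s x) \<longrightarrow> (\<exists>x. K' s x)) \<and>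
      (\<forall>s x y. K' s x \<longrightarrow> K' s y \<longrightarrow> (\<forall>i\<in>UNIV. x $ i = y $ i))" ..
  from * have K'1: "definable (\<lambda>p. K' (fst p) (snd p))" by (rule conjunct1)
  from * have K'2: "\<forall>s x. K' s x \<longrightarrow> K s x" by (elim conjE) assumption
  from * have K'3: "\<forall>s. (\<exists>x. K s x) \<longrightarrow> (\<exists>x. K' s x)" by (elim conjE) assumption
  from * have K'4: "\<forall>s x y. K' s x \<longrightarrow> K' s y \<longrightarrow> (\<forall>i\<in>UNIV. x $ i = y $ i)" by (elim conjE) assumption
  have uniq: "x = y" if "K' s x" "K' s y" for s x y
    using K'4[rule_format, OF that] unfolding vec_eq_iff by simp
  \<comment> \<open>The value 0 on empty fibres makes \<open>x\<close> a total function, and its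
    graph is still definable since emptiness of a fibre is.\<close>
  define x where "x s = (if \<exists>y. K' s y then (THE y. K' s y) else 0)" for s
  have x: "K' s (x s)" if "K' s y" for s y
  proof -
    have "(THE y. K' s y) = y" using that uniq by (intro the_equality)
    moreover have "\<exists>y. K' s y" using that by (rule exI)
    ultimately show ?thesis using that by (simp add: x_def)
  qed
  have ex: "definable (\<lambda>p::real \<times> (real, 'n) vec. \<exists>y. K' (fst p) y)"
  proof -
    have "definable (\<lambda>s. \<exists>y. K' s y)" by (intro definable_intros K'1)
    then show ?thesis by (rule definable_fst)
  qed
  have "definable (\<lambda>p. K' (fst p) (snd p) \<or> (\<not> (\<exists>y. K' (fst p) y) \<and> snd p = 0))"
    by (intro definable_disj definable_conj definable_not K'1 ex) (intro definable_intros)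
  moreover have "K' s y \<or> (\<not> (\<exists>y. K' s y) \<and> y = 0) \<longleftrightarrow> y = x s" for s y
  proof (cases "\<exists>z. K' s z")
    case True
    then have "K' s (x s)" using x by blast
    then show ?thesis using True uniq[of s y "x s"] by auto
  next
    case False
    then have "x s = 0" by (simp add: x_def)
    then show ?thesis using False by auto
  qed
  ultimately have "definable_map x"
    unfolding definable_map_def by simp
  then show thesis
  proof (rule that)
    fix s y assume "K s y"
    then obtain z where "K' s z" using K'3 by blast
    then show "K s (x s)" using x[of s z] K'2 by blast
  qed
qed

text \<open>Levels are taken in the closed ball, where they are compact: the minimum is attained,
  and the minimizers form a compact definable family from which a point can be selected. Nothing is
  claimed about levels that the ball does not meet.\<close>

lemma minimal_gradient_curve:
  fixes G :: "real ^ 'n::{finite,linorder} \<Rightarrow> real"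
  assumes G: "definable_map G" and grad: "\<And>x. GDERIV G x :> g x" and g: "continuous_on UNIV g"
  obtains x where "definable_map x"
    "\<And>s y. norm (y - a) \<le> \<eta> \<Longrightarrow> \<bar>G y - G a\<bar> = s \<Longrightarrow>
      norm (x s - a) \<le> \<eta> \<and> \<bar>G (x s) - G a\<bar> = s \<and> norm (g (x s)) \<le> norm (g y)"
proof -
  have contG: "continuous_on UNIV G"
    using grad by (auto simp: continuous_on_eq_continuous_at gderiv_def intro: has_derivative_continuous)
  note gd = definable_map_gradient[OF G grad]
  define K where "K s x \<longleftrightarrow> norm (x - a) \<le> \<eta> \<and> \<bar>G x - G a\<bar> = s" for s x
  define L where "L s x \<longleftrightarrow> K s x \<and> (\<forall>y. K s y \<longrightarrow> norm (g x) \<le> norm (g y))" for s x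
  have cK: "compact {x. K s x}" for s
  proof -
    have "{x. K s x} = cball a \<eta> \<inter> {x. \<bar>G x - G a\<bar> = s}"
      by (auto simp: K_def dist_norm norm_minus_commute)
    moreover have "closed {x. \<bar>G x - G a\<bar> = s}"
      by (intro closed_Collect_eq continuous_intros contG)
    ultimately show ?thesis by (simp add: compact_Int_closed)
  qed
  have "definable (\<lambda>p. L (fst p) (snd p))"
    unfolding L_def K_def by (intro definable_intros definable_map_comp[OF G] definable_map_comp[OF gd])
  moreover have "compact {x. L s x}" for s
  proof -
    have "{x. L s x} = {x. K s x} \<inter> (\<Inter>y\<in>{y. K s y}. {x. norm (g x) \<le> norm (g y)})"
      by (auto simp: L_def)
    moreover have "closed (\<Inter>y\<in>{y. K s y}. {x. norm (g x) \<le> norm (g y)})"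
      by (intro closed_INT ballI closed_Collect_le continuous_intros g)
    ultimately show ?thesis using cK[of s] by (simp add: compact_Int_closed)
  qed
  ultimately obtain x where x: "definable_map x" "\<And>s y. L s y \<Longrightarrow> L s (x s)"
    using definable_selection[of L] by blast
  have "norm (x s - a) \<le> \<eta> \<and> \<bar>G (x s) - G a\<bar> = s \<and> norm (g (x s)) \<le> norm (g y)"
    if "norm (y - a) \<le> \<eta>" "\<bar>G y - G a\<bar> = s" for s y
  proof -
    have y: "K s y" using that by (simp add: K_def)
    have "continuous_on {x. K s x} (\<lambda>x. norm (g x))"
      by (intro continuous_intros continuous_on_subset[OF g]) auto
    then have "\<exists>z\<in>{x. K s x}. \<forall>y\<in>{x. K s x}. norm (g z) \<le> norm (g y)"
      using y by (intro continuous_attains_inf[OF cK]) auto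
    then have "L s (x s)" using x(2) by (auto simp: L_def)
    then show ?thesis using y by (auto simp: L_def K_def)
  qed
  with x(1) show thesis by (rule that)
qed

text \<open>The coordinates of the curve are eventually monotone, so \<open>V\<close> can be a signed sum of them.\<close>

lemma definable_curve_length:
  fixes x :: "real \<Rightarrow> real ^ 'n::{finite,linorder}"
  assumes x: "definable_map x" and bd: "\<forall>\<^sub>F s in at_right 0. norm (x s) \<le> B"
  obtains V b C where "b > 0" "\<And>s. 0 < s \<Longrightarrow> s < b \<Longrightarrow> isCont V s \<and> \<bar>V s\<bar> \<le> C"
    "\<And>s t. 0 < s \<Longrightarrow> s \<le> t \<Longrightarrow> t < b \<Longrightarrow> norm (x t - x s) \<le> V t - V s"
proof -
  have xi: "definable_map (\<lambda>s. x s $ i)" for i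
    by (intro definable_intros x)
  have "\<exists>\<sigma> b. \<bar>\<sigma>\<bar> = 1 \<and> b > 0 \<and> (\<forall>s t. 0 < s \<longrightarrow> s \<le> t \<longrightarrow> t < b \<longrightarrow> \<sigma> * (x s $ i) \<le> \<sigma> * (x t $ i))"
    for i :: 'n
  proof -
    obtain b where b: "b > 0" "monotone_on {0<..<b} (\<le>) (\<le>) (\<lambda>s. x s $ i) \<or>
        monotone_on {0<..<b} (\<le>) (\<ge>) (\<lambda>s. x s $ i)"
      using definable_monotone_germ[OF xi] .
    from b(2) show ?thesis
    proof
      assume "monotone_on {0<..<b} (\<le>) (\<le>) (\<lambda>s. x s $ i)"
      with b(1) show ?thesis by (intro exI[of _ 1] exI[of _ b]) (auto simp: monotone_on_def)
    next
      assume "monotone_on {0<..<b} (\<le>) (\<ge>) (\<lambda>s. x s $ i)"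
      with b(1) show ?thesis by (intro exI[of _ "-1"] exI[of _ b]) (auto simp: monotone_on_def)
    qed
  qed
  then obtain \<sigma> b where \<sigma>: "\<And>i. \<bar>\<sigma> i\<bar> = 1" and b: "\<And>i. b i > 0"
    and mono: "\<And>i s t. 0 < s \<Longrightarrow> s \<le> t \<Longrightarrow> t < b i \<Longrightarrow> \<sigma> i * (x s $ i) \<le> \<sigma> i * (x t $ i)"
    by metis
  define V where "V s = (\<Sum>i\<in>UNIV. \<sigma> i * (x s $ i))" for s
  have "\<forall>\<^sub>F s in at_right 0. \<forall>i\<in>UNIV. s < b i \<and> isCont (\<lambda>s. x s $ i) s"
    using b unfolding eventually_ball_finite_distrib[OF finite_class.finite_UNIV]
    by (intro ballI eventually_conj definable_continuous_germ xi) (auto simp: eventually_at_right_field)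
  with bd have "\<forall>\<^sub>F s in at_right 0. norm (x s) \<le> B \<and> (\<forall>i. s < b i \<and> isCont (\<lambda>s. x s $ i) s)"
    by eventually_elim auto
  then obtain c where c: "c > 0" "\<And>s. 0 < s \<Longrightarrow> s < c \<Longrightarrow> norm (x s) \<le> B"
    "\<And>s i. 0 < s \<Longrightarrow> s < c \<Longrightarrow> s < b i \<and> isCont (\<lambda>s. x s $ i) s"
    unfolding eventually_at_right_field by blast
  show thesis
  proof (rule that[of c V "CARD('n) * B"])
    fix s assume s: "0 < s" "s < c"
    have "\<bar>V s\<bar> \<le> (\<Sum>i\<in>UNIV. \<bar>\<sigma> i * (x s $ i)\<bar>)" unfolding V_def by (rule sum_abs)
    also have "\<dots> \<le> (\<Sum>i\<in>(UNIV::'n set). B)"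
    proof (rule sum_mono)
      fix i
      show "\<bar>\<sigma> i * (x s $ i)\<bar> \<le> B"
        using component_le_norm_cart[of "x s" i] c(2)[OF s] \<sigma>[of i] by (simp add: abs_mult)
    qed
    finally show "isCont V s \<and> \<bar>V s\<bar> \<le> CARD('n) * B"
      unfolding V_def using c(3)[OF s] by (auto intro!: continuous_intros)
  next
    fix s t assume st: "0 < s" "s \<le> t" "t < c"
    have "norm (x t - x s) \<le> (\<Sum>i\<in>UNIV. \<bar>(x t - x s) $ i\<bar>)" by (rule norm_le_l1_cart)
    also have "\<dots> = (\<Sum>i\<in>UNIV. \<sigma> i * (x t $ i) - \<sigma> i * (x s $ i))"
    proof (rule sum.cong)
      fix i
      have "\<sigma> i * (x s $ i) \<le> \<sigma> i * (x t $ i)" using st c(3)[of t i] by (intro mono) auto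
      moreover have "\<bar>(x t - x s) $ i\<bar> = \<bar>\<sigma> i * (x t $ i) - \<sigma> i * (x s $ i)\<bar>"
        using \<sigma>[of i] by (simp add: abs_mult flip: right_diff_distrib)
      ultimately show "\<bar>(x t - x s) $ i\<bar> = \<sigma> i * (x t $ i) - \<sigma> i * (x s $ i)" by simp
    qed simp
    also have "\<dots> = V t - V s" by (simp add: V_def sum_subtractf)
    finally show "norm (x t - x s) \<le> V t - V s" .
  qed (rule c(1))
qed

text \<open>The doubling property \<open>\<psi> (2 s) \<le> 4 \<psi> s\<close> replaces the regularity that an arbitrary
  desingularizing function may lack.\<close>

lemma gradient_profile:
  fixes G :: "real ^ 'n::{finite,linorder} \<Rightarrow> real"
  assumes G: "definable_map G" and grad: "\<And>x. GDERIV G x :> g x" and g: "continuous_on UNIV g"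
    and lip: "\<And>x y. x \<in> ball a \<rho> \<Longrightarrow> y \<in> ball a \<rho> \<Longrightarrow> norm (g x - g y) \<le> M * norm (x - y)"
    and M: "M > 0" and "g a = 0" and \<eta>: "0 < \<eta>" "\<eta> \<le> \<rho>"
    and nontriv: "\<And>d. d > 0 \<Longrightarrow> \<exists>x\<in>ball a d. G x \<noteq> G a"
  obtains \<psi> V b C where "b > 0"
    "\<And>s. 0 < s \<Longrightarrow> s < b \<Longrightarrow> \<exists>x. norm (x - a) \<le> \<eta> \<and> \<bar>G x - G a\<bar> = s \<and> norm (g x) = \<psi> s"
    "\<And>y. norm (y - a) \<le> \<eta> \<Longrightarrow> 0 < \<bar>G y - G a\<bar> \<Longrightarrow> \<bar>G y - G a\<bar> < b \<Longrightarrow> \<psi> \<bar>G y - G a\<bar> \<le> norm (g y)"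
    "\<And>s. 0 < s \<Longrightarrow> s < b \<Longrightarrow> 0 < \<psi> s \<and> isCont \<psi> s \<and> (\<psi> s)\<^sup>2 \<le> 9 * M * s \<and> \<psi> (2 * s) \<le> 4 * \<psi> s \<and> isCont V s \<and> \<bar>V s\<bar> \<le> C"
    "\<And>s t. 0 < s \<Longrightarrow> s \<le> t \<Longrightarrow> t < b \<Longrightarrow> \<psi> s \<le> \<psi> t"
    "\<And>s t. 0 < s \<Longrightarrow> s \<le> t \<Longrightarrow> t < b \<Longrightarrow> t - s \<le> \<psi> t * (V t - V s)"
proof -
  let ?E = "\<lambda>P. \<forall>\<^sub>F s in at_right (0::real). P s"
  have contG: "isCont G x" for x
    using grad[of x] by (auto simp: gderiv_def intro: has_derivative_continuous)
  obtain x where x: "definable_map x"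
    and min: "\<And>s y. norm (y - a) \<le> \<eta> \<Longrightarrow> \<bar>G y - G a\<bar> = s \<Longrightarrow>
      norm (x s - a) \<le> \<eta> \<and> \<bar>G (x s) - G a\<bar> = s \<and> norm (g (x s)) \<le> norm (g y)"
    using minimal_gradient_curve[OF G grad g, of a \<eta>] by metis
  define \<psi> where "\<psi> s = norm (g (x s))" for s
  have \<psi>def: "definable_map \<psi>"
    unfolding \<psi>_def by (intro definable_intros definable_map_comp[OF definable_map_gradient[OF G grad]] x)
  note \<psi>c = definable_map_comp[OF \<psi>def]
  \<comment> \<open>The levels found here merely accumulate at 0; \<open>dich\<close> upgrades a
    definable property that they share to all small levels.\<close>
  have freq: "\<exists>s. 0 < s \<and> s < d \<and> (\<exists>y. norm (y - a) \<le> \<eta> \<and> \<bar>G y - G a\<bar> = s \<and> (norm (g y))\<^sup>2 \<le> 9 * M * s)"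
    if "d > 0" for d
  proof -
    obtain \<delta> where \<delta>: "\<delta> > 0" "\<And>y. dist y a < \<delta> \<Longrightarrow> dist (G y) (G a) < d"
      using contG[of a] \<open>d > 0\<close> unfolding continuous_at_eps_delta by blast
    have "\<exists>y\<in>ball a (min \<delta> \<eta>). G y \<noteq> G a \<and> (norm (g y))\<^sup>2 \<le> 9 * M * \<bar>G y - G a\<bar>"
      by (rule gradient_le_sqrt_level[OF grad lip M \<open>g a = 0\<close>]) (use nontriv \<delta>(1) \<eta> in auto)
    then obtain y where "y \<in> ball a (min \<delta> \<eta>)" "G y \<noteq> G a" "(norm (g y))\<^sup>2 \<le> 9 * M * \<bar>G y - G a\<bar>"
      by blast
    moreover from this have "norm (y - a) \<le> \<eta>" "0 < \<bar>G y - G a\<bar>" "\<bar>G y - G a\<bar> < d"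
      using \<delta>(2)[of y] by (auto simp: dist_norm norm_minus_commute)
    ultimately show ?thesis by blast
  qed
  have dich: "?E P" if "definable P" and P: "\<And>s y. norm (y - a) \<le> \<eta> \<Longrightarrow> \<bar>G y - G a\<bar> = s \<Longrightarrow>
      (norm (g y))\<^sup>2 \<le> 9 * M * s \<Longrightarrow> P s" for P
  proof (rule ccontr)
    assume "\<not> ?E P"
    then have "?E (\<lambda>s. \<not> P s)" using definable_germ_right[OF \<open>definable P\<close>] by blast
    then obtain d where "d > 0" "\<And>s. 0 < s \<Longrightarrow> s < d \<Longrightarrow> \<not> P s"
      unfolding eventually_at_right_field by blast
    then show False using freq[of d] P by blast
  qed
  have lev: "?E (\<lambda>s. \<exists>y. norm (y - a) \<le> \<eta> \<and> \<bar>G y - G a\<bar> = s)"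
    by (rule dich) (intro definable_intros definable_map_comp[OF G], blast)
  have sq: "?E (\<lambda>s. \<psi> s * \<psi> s \<le> 9 * M * s)"
  proof (rule dich)
    show "definable (\<lambda>s. \<psi> s * \<psi> s \<le> 9 * M * s)" by (intro definable_intros \<psi>c)
    fix s y assume *: "norm (y - a) \<le> \<eta>" "\<bar>G y - G a\<bar> = s" "(norm (g y))\<^sup>2 \<le> 9 * M * s"
    have "\<psi> s * \<psi> s \<le> norm (g y) * norm (g y)"
      using min[OF *(1,2)] unfolding \<psi>_def by (intro mult_mono) auto
    then show "\<psi> s * \<psi> s \<le> 9 * M * s" using *(3) by (simp add: power2_eq_square)
  qed
  have "?E (\<lambda>s. norm (x s) \<le> norm a + \<eta>)"
    using lev
  proof eventually_elim
    case (elim s)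
    then have "norm (x s - a) \<le> \<eta>" using min by blast
    then show ?case using norm_triangle_sub[of "x s" a] by linarith
  qed
  then obtain V b0 C where b0: "b0 > 0" and V: "\<And>s. 0 < s \<Longrightarrow> s < b0 \<Longrightarrow> isCont V s \<and> \<bar>V s\<bar> \<le> C"
    and len: "\<And>s t. 0 < s \<Longrightarrow> s \<le> t \<Longrightarrow> t < b0 \<Longrightarrow> norm (x t - x s) \<le> V t - V s"
    using definable_curve_length[OF x] by metis
  obtain b1 where b1: "b1 > 0" "monotone_on {0<..<b1} (\<le>) (\<le>) \<psi> \<or> monotone_on {0<..<b1} (\<le>) (\<ge>) \<psi>"
    using definable_monotone_germ[OF \<psi>def] .
  have "?E (\<lambda>s. s < b0 \<and> s < b1)"
    using b0 b1(1) unfolding eventually_at_right_field by (intro exI[of _ "min b0 b1"]) auto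
  from this lev sq definable_continuous_germ[OF \<psi>def]
  have "?E (\<lambda>s. (s < b0 \<and> s < b1) \<and> (\<exists>y. norm (y - a) \<le> \<eta> \<and> \<bar>G y - G a\<bar> = s) \<and>
      \<psi> s * \<psi> s \<le> 9 * M * s \<and> isCont \<psi> s)"
    by eventually_elim blast
  then obtain b2 where b2: "b2 > 0" and P: "\<And>s. 0 < s \<Longrightarrow> s < b2 \<Longrightarrow> (s < b0 \<and> s < b1) \<and>
      (\<exists>y. norm (y - a) \<le> \<eta> \<and> \<bar>G y - G a\<bar> = s) \<and> \<psi> s * \<psi> s \<le> 9 * M * s \<and> isCont \<psi> s"
    unfolding eventually_at_right_field by blast
  have xs: "norm (x s - a) \<le> \<eta> \<and> \<bar>G (x s) - G a\<bar> = s" if "0 < s" "s < b2" for s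
    using P[OF that] min by blast
  have \<psi>0: "\<psi> s \<ge> 0" for s by (simp add: \<psi>_def)
  have mono: "\<psi> s \<le> \<psi> t" if st: "0 < s" "s \<le> t" "t < b2" for s t
    using b1(2)
  proof
    assume "monotone_on {0<..<b1} (\<le>) (\<le>) \<psi>"
    then show ?thesis using P[of t] st by (auto simp: monotone_on_def)
  next
    \<comment> \<open>An antitone profile would give
      \<open>\<psi> s * \<psi> s \<le> 9 * M * \<sigma>\<close> for all \<sigma> below
      \<open>s\<close>, so \<open>\<psi> s = 0\<close> and the claim is trivial.\<close>
    assume anti: "monotone_on {0<..<b1} (\<le>) (\<ge>) \<psi>"
    have "\<psi> s * \<psi> s \<le> 9 * M * \<sigma>" if "0 < \<sigma>" "\<sigma> < s" for \<sigma>
    proof -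
      have "\<psi> s \<le> \<psi> \<sigma>" using anti P[of s] that st by (auto simp: monotone_on_def)
      then have "\<psi> s * \<psi> s \<le> \<psi> \<sigma> * \<psi> \<sigma>" using \<psi>0 by (intro mult_mono) auto
      also have "\<dots> \<le> 9 * M * \<sigma>" using P[of \<sigma>] that st by auto
      finally show ?thesis .
    qed
    then have "?E (\<lambda>\<sigma>. \<psi> s * \<psi> s \<le> 9 * M * \<sigma>)"
      using st unfolding eventually_at_right_field by blast
    moreover have "((\<lambda>\<sigma>. 9 * M * \<sigma>) \<longlongrightarrow> 9 * M * 0) (at_right 0)"
      by (intro tendsto_intros)
    ultimately have "\<psi> s * \<psi> s \<le> 0"
      using tendsto_lowerbound[of "\<lambda>\<sigma>. 9 * M * \<sigma>" _ "at_right 0"] by force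
    then have "\<psi> s = 0" using \<psi>0[of s] by (metis mult_eq_0_iff mult_nonneg_nonneg order_antisym)
    then show ?thesis using \<psi>0 by simp
  qed
  have talweg: "t - s \<le> \<psi> t * (V t - V s)" if st: "0 < s" "s \<le> t" "t < b2" for s t
  proof (rule curve_increment_bound[OF grad _ _ _ st])
    show "\<bar>G (x \<sigma>) - G a\<bar> = \<sigma>" if "0 < \<sigma>" "\<sigma> < b2" for \<sigma> using xs[OF that] by blast
    show "isCont V \<sigma>" if "0 < \<sigma>" "\<sigma> < b2" for \<sigma> using V[of \<sigma>] P[OF that] that by blast
    show "norm (x \<tau> - x \<sigma>) \<le> V \<tau> - V \<sigma>" if "0 < \<sigma>" "\<sigma> \<le> \<tau>" "\<tau> < b2" for \<sigma> \<tau>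
      using len[of \<sigma> \<tau>] P[of \<tau>] that by simp
    show "norm (g (x \<tau>)) \<le> \<psi> t" if "s \<le> \<tau>" "\<tau> \<le> t" for \<tau>
      using mono[of \<tau> t] that st by (simp add: \<psi>_def)
  qed
  \<comment> \<open>If \<open>\<psi> t\<close> vanished, \<open>talweg\<close> between
    \<open>t / 2\<close> and \<open>t\<close> would read \<open>t / 2 \<le> 0\<close>. So small
    nonzero levels have no critical point in the ball.\<close>
  have pos: "\<psi> t > 0" if "0 < t" "t < b2" for t
  proof -
    have "0 < \<psi> t * (V t - V (t / 2))" using talweg[of "t / 2" t] that by simp
    then show ?thesis using \<psi>0[of t] by (metis less_eq_real_def mult_zero_left less_irrefl)
  qed
  have lin: "s \<le> 4 * C * \<psi> s" if "0 < s" "s < b2" for s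
  proof -
    have "V s - V (s / 2) \<le> 2 * C"
      using V[of s] V[of "s / 2"] P[of s] P[of "s / 2"] that by (auto simp: abs_le_iff)
    then have "\<psi> s * (V s - V (s / 2)) \<le> \<psi> s * (2 * C)" using \<psi>0 by (intro mult_left_mono)
    moreover have "s / 2 \<le> \<psi> s * (V s - V (s / 2))" using talweg[of "s / 2" s] that by simp
    moreover have "4 * C * \<psi> s = 2 * (\<psi> s * (2 * C))" by simp
    ultimately show ?thesis by linarith
  qed
  \<comment> \<open>If doubling failed at all small \<open>s\<close>, iteration would make \<psi>
    decay quadratically along \<open>s / 2 ^ k\<close>, against the linear lower bound
    \<open>lin\<close>. Any factor above 2 contradicts \<open>lin\<close> in the same way.\<close>
  have "?E (\<lambda>s. \<psi> (2 * s) \<le> 4 * \<psi> s)"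
  proof (rule ccontr)
    assume "\<not> ?thesis"
    moreover have "definable (\<lambda>s. \<psi> (2 * s) \<le> 4 * \<psi> s)" by (intro definable_intros \<psi>c)
    ultimately have "?E (\<lambda>s. \<not> \<psi> (2 * s) \<le> 4 * \<psi> s)" using definable_germ_right by blast
    then obtain d where d: "d > 0" "\<And>s. 0 < s \<Longrightarrow> s < d \<Longrightarrow> 4 * \<psi> s < \<psi> (2 * s)"
      unfolding eventually_at_right_field by force
    define s where "s = min d b2 / 2"
    have s: "0 < s" "s < d" "s < b2" using d(1) b2 by (auto simp: s_def min_def)
    have s2: "0 < s / 2 ^ k" "s / 2 ^ k \<le> s" for k :: nat
      using s(1) by (auto simp: divide_le_eq mult_ge1_I mult_le_cancel_left1)
    have "4 ^ k * \<psi> (s / 2 ^ k) \<le> \<psi> s" for k :: nat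
    proof (induction k)
      case (Suc k)
      have "4 * \<psi> (s / 2 ^ Suc k) \<le> \<psi> (s / 2 ^ k)"
        using d(2)[of "s / 2 ^ Suc k"] s2[of "Suc k"] s by simp
      then have "4 ^ k * (4 * \<psi> (s / 2 ^ Suc k)) \<le> 4 ^ k * \<psi> (s / 2 ^ k)"
        by (intro mult_left_mono) auto
      moreover have "4 ^ Suc k * \<psi> (s / 2 ^ Suc k) = 4 ^ k * (4 * \<psi> (s / 2 ^ Suc k))" by simp
      ultimately show ?case using Suc by linarith
    qed simp
    have C: "C \<ge> 0" using V[of s] P[of s] s by (meson abs_ge_zero order_trans)
    have bound: "2 ^ k * s \<le> 4 * C * \<psi> s" for k :: nat
    proof -
      have "2 ^ k * s = 4 ^ k * (s / 2 ^ k)"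
        by (simp add: field_simps flip: power_mult_distrib)
      also have "\<dots> \<le> 4 ^ k * (4 * C * \<psi> (s / 2 ^ k))"
        using lin[of "s / 2 ^ k"] s2[of k] s by (intro mult_left_mono) auto
      also have "\<dots> = 4 * C * (4 ^ k * \<psi> (s / 2 ^ k))" by simp
      also have "\<dots> \<le> 4 * C * \<psi> s" using C \<open>4 ^ k * \<psi> (s / 2 ^ k) \<le> \<psi> s\<close> by (intro mult_left_mono) auto
      finally show ?thesis .
    qed
    obtain k where "4 * C * \<psi> s / s < 2 ^ k"
      using real_arch_pow[of 2 "4 * C * \<psi> s / s"] by auto
    then show False using bound[of k] s(1) by (simp add: field_simps)
  qed
  then obtain b3 where b3: "b3 > 0" "\<And>s. 0 < s \<Longrightarrow> s < b3 \<Longrightarrow> \<psi> (2 * s) \<le> 4 * \<psi> s"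
    unfolding eventually_at_right_field by blast
  show thesis
  proof (rule that[of "min b2 b3" \<psi> V C])
    show "\<exists>y. norm (y - a) \<le> \<eta> \<and> \<bar>G y - G a\<bar> = s \<and> norm (g y) = \<psi> s"
      if "0 < s" "s < min b2 b3" for s
      using xs[of s] that by (intro exI[of _ "x s"]) (auto simp: \<psi>_def)
    show "\<psi> \<bar>G y - G a\<bar> \<le> norm (g y)" if "norm (y - a) \<le> \<eta>" for y
      using min[OF that refl] by (simp add: \<psi>_def)
    show "0 < \<psi> s \<and> isCont \<psi> s \<and> (\<psi> s)\<^sup>2 \<le> 9 * M * s \<and> \<psi> (2 * s) \<le> 4 * \<psi> s \<and> isCont V s \<and> \<bar>V s\<bar> \<le> C"
      if "0 < s" "s < min b2 b3" for s
      using pos[of s] P[of s] V[of s] b3(2)[of s] that by (simp add: power2_eq_square)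
  qed (use b2 b3(1) mono talweg in auto)
qed

end

subsection \<open>Desingularizing functions\<close>

lemma grad_eqI:
  assumes "GDERIV G x :> D"
  shows "grad G x = D"
  unfolding grad_def
proof (rule the_equality)
  show "GDERIV G x :> D" by (rule assms)
  fix E assume "GDERIV G x :> E"
  then have "(\<lambda>h. h \<bullet> E) = (\<lambda>h. h \<bullet> D)"
    using assms unfolding gderiv_def by (rule has_derivative_unique)
  then show "E = D" by (metis inner_commute vector_eq_rdot)
qed

lemma norm_grad_abs_comp:
  assumes "GDERIV G x :> D" "G x \<noteq> l" "(\<phi> has_real_derivative d) (at \<bar>G x - l\<bar>)"
  shows "norm (grad (\<lambda>y. \<phi> \<bar>G y - l\<bar>) x) = \<bar>d\<bar> * norm D"
proof -
  have "((\<lambda>z. \<bar>z - l\<bar>) has_real_derivative sgn (G x - l)) (at (G x))"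
  proof (cases "G x < l")
    case True
    have "((\<lambda>z. l - z) has_real_derivative sgn (G x - l)) (at (G x))"
      using True by (auto intro!: derivative_eq_intros)
    then show ?thesis
      by (rule has_field_derivative_transform_within_open[of _ _ _ "{..<l}"]) (use True in auto)
  next
    case False
    have "((\<lambda>z. z - l) has_real_derivative sgn (G x - l)) (at (G x))"
      using False assms(2) by (auto intro!: derivative_eq_intros)
    then show ?thesis
      by (rule has_field_derivative_transform_within_open[of _ _ _ "{l<..}"]) (use False assms(2) in auto)
  qed
  from DERIV_chain2[OF assms(3) this]
  have "((\<lambda>z. \<phi> \<bar>z - l\<bar>) has_real_derivative d * sgn (G x - l)) (at (G x))" .
  from GDERIV_DERIV_compose[OF assms(1) this]
  have "grad (\<lambda>y. \<phi> \<bar>G y - l\<bar>) x = (d * sgn (G x - l)) *\<^sub>R D" by (rule grad_eqI)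
  then show ?thesis using assms(2) by (simp add: abs_mult abs_sgn_eq)
qed

lemma C1_deriv:
  assumes "\<phi> C1_differentiable_on {0<..<r}" "0 < s" "s < r"
  shows "(\<phi> has_real_derivative deriv \<phi> s) (at s)" "isCont (deriv \<phi>) s"
proof -
  obtain D where D: "\<And>x. x \<in> {0<..<r} \<Longrightarrow> (\<phi> has_real_derivative D x) (at x)" "continuous_on {0<..<r} D"
    using assms(1) unfolding C1_differentiable_on_def has_real_derivative_iff_has_vector_derivative by blast
  then have eq: "deriv \<phi> x = D x" if "x \<in> {0<..<r}" for x
    using that DERIV_imp_deriv by blast
  then show "(\<phi> has_real_derivative deriv \<phi> s) (at s)" using D(1) assms(2,3) by simp
  have "continuous_on {0<..<r} (deriv \<phi>)"
    using D(2) by (rule continuous_on_cong[THEN iffD1, rotated -1]) (auto simp: eq)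
  then show "isCont (deriv \<phi>) s"
    using assms(2,3) by (simp add: continuous_on_eq_continuous_at)
qed

text \<open>The tangent inequalities at \<open>s\<close> and at \<open>t\<close>, added.\<close>

lemma concave_deriv_antimono:
  assumes "concave_on {0..<r} \<phi>" "\<And>s. 0 < s \<Longrightarrow> s < r \<Longrightarrow> (\<phi> has_real_derivative \<phi>' s) (at s)"
    and st: "0 < s" "s \<le> t" "t < r"
  shows "\<phi>' t \<le> \<phi>' s"
proof -
  have *: "- \<phi> v - - \<phi> u \<ge> - \<phi>' u * (v - u)" if "0 < u" "u < r" "0 < v" "v < r" for u v
  proof (rule convex_on_imp_above_tangent[of "{0..<r}" "\<lambda>x. - \<phi> x"])
    show "convex_on {0..<r} (\<lambda>x. - \<phi> x)" using assms(1) by (simp add: concave_on_def)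
    show "((\<lambda>x. - \<phi> x) has_field_derivative - \<phi>' u) (at u within {0..<r})"
      using assms(2) that by (intro DERIV_subset[OF DERIV_minus]) auto
  qed (use that in \<open>auto simp: interior_atLeastLessThan\<close>)
  have "\<phi>' t * (t - s) \<le> \<phi>' s * (t - s)"
    using *[of s t] *[of t s] st by (simp add: algebra_simps)
  then show ?thesis using st by (cases "s = t") auto
qed

text \<open>By the chain rule the gradient of the composition has norm \<phi>' times the norm of
  \<open>g\<close>; all later arguments use this product form.\<close>

lemma desingularizing_iff:
  assumes grad: "\<And>x. GDERIV G x :> g x"
  shows "desingularizing G a r \<phi> \<longleftrightarrow>
     0 < r \<and> continuous_on {0..<r} \<phi> \<and> \<phi> ` {0..<r} \<subseteq> {0..} \<and> \<phi> 0 = 0 \<and>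
     \<phi> C1_differentiable_on {0<..<r} \<and> concave_on {0..<r} \<phi> \<and>
     (\<forall>s\<in>{0<..<r}. deriv \<phi> s > 0) \<and>
     (\<exists>\<eta>>0. (\<forall>x\<in>ball a \<eta>. \<bar>G x - G a\<bar> < r) \<and>
            (\<forall>x\<in>ball a \<eta>. G x \<noteq> G a \<longrightarrow> 1 \<le> deriv \<phi> \<bar>G x - G a\<bar> * norm (g x)))"
proof -
  have "1 \<le> norm (grad (\<lambda>y. \<phi> \<bar>G y - G a\<bar>) x) \<longleftrightarrow> 1 \<le> deriv \<phi> \<bar>G x - G a\<bar> * norm (g x)"
    if "\<phi> C1_differentiable_on {0<..<r}" "\<forall>s\<in>{0<..<r}. deriv \<phi> s > 0"
      "\<bar>G x - G a\<bar> < r" "G x \<noteq> G a" for x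
  proof -
    have "0 < deriv \<phi> \<bar>G x - G a\<bar>" using that(2-4) by auto
    then have "\<bar>deriv \<phi> \<bar>G x - G a\<bar>\<bar> = deriv \<phi> \<bar>G x - G a\<bar>" by (rule abs_of_pos)
    then show ?thesis
      using norm_grad_abs_comp[OF grad that(4) C1_deriv(1)[OF that(1)]] that by simp
  qed
  then show ?thesis
    unfolding desingularizing_def by (intro conj_cong refl ex_cong1 ball_cong) blast
qed

text \<open>Enlarging \<phi> preserves every lower bound on its derivative. This is how \<phi> is
  adjusted until the energy decays at least at the worst-case speed.\<close>

lemma admissible_scale:
  assumes grad: "\<And>x. GDERIV G x :> g x" and adm: "admissible_desingularizing G a r \<phi>" and \<kappa>: "\<kappa> \<ge> 1"
  shows "admissible_desingularizing G a r (\<lambda>s. \<kappa> * \<phi> s)"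
proof -
  from adm have des: "desingularizing G a r \<phi>"
    and triv: "a \<in> interior (crit G) \<Longrightarrow> \<exists>\<beta>>0. \<forall>\<^sub>F s in at_right 0. deriv \<phi> s \<ge> \<beta> / sqrt s"
    unfolding admissible_desingularizing_def by auto
  note d = des[unfolded desingularizing_iff[OF grad]]
  from d have r: "0 < r" and C1: "\<phi> C1_differentiable_on {0<..<r}" by blast+
  have der: "deriv (\<lambda>s. \<kappa> * \<phi> s) s = \<kappa> * deriv \<phi> s" if "0 < s" "s < r" for s
    by (rule DERIV_imp_deriv) (intro DERIV_cmult C1_deriv(1)[OF C1 that])
  obtain \<eta> where \<eta>: "\<eta> > 0" "\<And>x. x \<in> ball a \<eta> \<Longrightarrow> \<bar>G x - G a\<bar> < r"
    "\<And>x. x \<in> ball a \<eta> \<Longrightarrow> G x \<noteq> G a \<Longrightarrow> 1 \<le> deriv \<phi> \<bar>G x - G a\<bar> * norm (g x)"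
    using d by blast
  have "desingularizing G a r (\<lambda>s. \<kappa> * \<phi> s)"
    unfolding desingularizing_iff[OF grad]
  proof (intro conjI)
    show "continuous_on {0..<r} (\<lambda>s. \<kappa> * \<phi> s)" using d by (intro continuous_intros) blast
    show "(\<lambda>s. \<kappa> * \<phi> s) ` {0..<r} \<subseteq> {0..}" using d \<kappa> by auto
    show "(\<lambda>s. \<kappa> * \<phi> s) C1_differentiable_on {0<..<r}" using C1 by (intro derivative_intros) auto
    have "concave_on {0..<r} \<phi>" using d by blast
    then show "concave_on {0..<r} (\<lambda>s. \<kappa> * \<phi> s)"
      using \<kappa> convex_on_cmul[of \<kappa> "{0..<r}" "\<lambda>s. - \<phi> s"] by (simp add: concave_on_def)
    show "\<forall>s\<in>{0<..<r}. 0 < deriv (\<lambda>s. \<kappa> * \<phi> s) s" using d der \<kappa> by auto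
    show "\<exists>\<eta>>0. (\<forall>x\<in>ball a \<eta>. \<bar>G x - G a\<bar> < r) \<and>
      (\<forall>x\<in>ball a \<eta>. G x \<noteq> G a \<longrightarrow> 1 \<le> deriv (\<lambda>s. \<kappa> * \<phi> s) \<bar>G x - G a\<bar> * norm (g x))"
    proof (intro exI[of _ \<eta>] conjI ballI impI)
      fix x assume x: "x \<in> ball a \<eta>" "G x \<noteq> G a"
      have "1 * 1 \<le> \<kappa> * (deriv \<phi> \<bar>G x - G a\<bar> * norm (g x))"
        using \<eta>(3)[OF x] \<kappa> by (intro mult_mono) auto
      then show "1 \<le> deriv (\<lambda>s. \<kappa> * \<phi> s) \<bar>G x - G a\<bar> * norm (g x)"
        using der[of "\<bar>G x - G a\<bar>"] \<eta>(2)[OF x(1)] x(2) by (simp add: mult.assoc)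
    qed (use \<eta> in auto)
  qed (use d r in auto)
  moreover have "\<exists>\<beta>>0. \<forall>\<^sub>F s in at_right 0. deriv (\<lambda>s. \<kappa> * \<phi> s) s \<ge> \<beta> / sqrt s"
    if int: "a \<in> interior (crit G)"
  proof -
    obtain \<beta> where \<beta>: "\<beta> > 0" "\<forall>\<^sub>F s in at_right 0. deriv \<phi> s \<ge> \<beta> / sqrt s"
      using triv[OF int] by blast
    have "\<forall>\<^sub>F s in at_right 0. s < r \<and> 0 < s"
      using r unfolding eventually_at_right_field by blast
    with \<beta>(2) have "\<forall>\<^sub>F s in at_right 0. deriv (\<lambda>s. \<kappa> * \<phi> s) s \<ge> \<beta> / sqrt s"
    proof eventually_elim
      case (elim s)
      then have "0 \<le> deriv \<phi> s" using \<beta>(1) by (meson divide_nonneg_nonneg less_imp_le order_trans real_sqrt_ge_zero)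
      then have "1 * deriv \<phi> s \<le> \<kappa> * deriv \<phi> s" using \<kappa> by (intro mult_right_mono)
      then show ?case using elim der[of s] by simp
    qed
    then show ?thesis using \<beta>(1) by blast
  qed
  ultimately show ?thesis unfolding admissible_desingularizing_def by blast
qed

lemma grad_zero_of_const_on_ball:
  assumes grad: "\<And>x. GDERIV G x :> g x" and const: "\<And>x. x \<in> ball a d \<Longrightarrow> G x = G a" and x: "x \<in> ball a d"
  shows "g x = 0"
proof -
  have "(G has_derivative (\<lambda>h. 0)) (at x)"
    by (rule has_derivative_transform_within_open[OF has_derivative_const open_ball x])
      (simp add: const)
  then have "GDERIV G x :> 0" by (simp add: gderiv_def)
  then show ?thesis using grad_eqI grad by metis
qed

text \<open>The increasing function \<Phi> has a finite limit at 0 because it is bounded below,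
  which amounts to integrability of \<open>h\<close> at 0. Subtracting that limit gives the value 0
  at 0, and the decrease of \<open>h\<close> gives concavity.\<close>

lemma concave_primitive:
  fixes h :: "real \<Rightarrow> real"
  assumes b: "b > 0" and h: "\<And>s. 0 < s \<Longrightarrow> s < b \<Longrightarrow> h s > 0 \<and> isCont h s"
    and anti: "\<And>s t. 0 < s \<Longrightarrow> s \<le> t \<Longrightarrow> t < b \<Longrightarrow> h t \<le> h s"
    and \<Phi>: "\<And>s. 0 < s \<Longrightarrow> s < b \<Longrightarrow> (\<Phi> has_real_derivative h s) (at s)"
    and bdd: "\<And>s. 0 < s \<Longrightarrow> s < b \<Longrightarrow> B \<le> \<Phi> s"
  obtains \<phi> where "continuous_on {0..<b} \<phi>" "\<phi> ` {0..<b} \<subseteq> {0..}" "\<phi> 0 = 0"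
    "\<phi> C1_differentiable_on {0<..<b}" "concave_on {0..<b} \<phi>" "\<And>s. 0 < s \<Longrightarrow> s < b \<Longrightarrow> deriv \<phi> s = h s"
proof -
  define L where "L = Inf (\<Phi> ` {0<..<b})"
  have ne: "\<Phi> ` {0<..<b} \<noteq> {}" using b by simp
  have bb: "bdd_below (\<Phi> ` {0<..<b})" using bdd by (intro bdd_belowI[of _ B]) auto
  have mono: "\<Phi> s < \<Phi> t" if "0 < s" "s < t" "t < b" for s t
  proof (rule DERIV_pos_imp_increasing[OF \<open>s < t\<close>])
    fix x assume "s \<le> x" "x \<le> t"
    then show "\<exists>y. DERIV \<Phi> x :> y \<and> 0 < y" using \<Phi>[of x] h[of x] that by auto
  qed
  have L: "L \<le> \<Phi> s" if "0 < s" "s < b" for s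
    unfolding L_def using that by (intro cInf_lower bb) auto
  have lim: "(\<Phi> \<longlongrightarrow> L) (at_right 0)"
  proof (rule order_tendstoI)
    fix l assume "l < L"
    then show "\<forall>\<^sub>F x in at_right 0. l < \<Phi> x"
      using L b unfolding eventually_at_right_field by (intro exI[of _ b]) force
  next
    fix u assume "L < u"
    then obtain s where s: "0 < s" "s < b" "\<Phi> s < u"
      using cInf_lessD[OF ne, of u] unfolding L_def by auto
    then have "\<Phi> x < u" if "0 < x" "x < s" for x using mono[of x s] that by simp
    then show "\<forall>\<^sub>F x in at_right 0. \<Phi> x < u"
      using s unfolding eventually_at_right_field by blast
  qed
  define \<phi> where "\<phi> s = (if s \<le> 0 then 0 else \<Phi> s - L)" for s
  have D: "(\<phi> has_real_derivative h s) (at s)" if "0 < s" "s < b" for s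
  proof (rule has_field_derivative_transform_within_open)
    show "((\<lambda>s. \<Phi> s - L) has_real_derivative h s) (at s)"
      using \<Phi>[OF that] by (auto intro!: derivative_eq_intros)
    show "open {0::real<..}" "s \<in> {0<..}" using that by auto
  qed (auto simp: \<phi>_def)
  have lim0: "(\<phi> \<longlongrightarrow> 0) (at_right 0)"
  proof (rule Lim_transform_eventually)
    show "((\<lambda>s. \<Phi> s - L) \<longlongrightarrow> 0) (at_right 0)"
      using tendsto_diff[OF lim tendsto_const[of L]] by simp
    show "\<forall>\<^sub>F x in at_right 0. \<Phi> x - L = \<phi> x"
      unfolding eventually_at_right_field by (intro exI[of _ 1]) (auto simp: \<phi>_def)
  qed
  have cont: "continuous_on {0..<b} \<phi>"
    unfolding continuous_on_eq_continuous_within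
  proof
    fix s assume s: "s \<in> {0..<b}"
    show "continuous (at s within {0..<b}) \<phi>"
    proof (cases "s = 0")
      case True
      have "at 0 within {0..<b} = at_right 0"
        using b by (intro at_within_nhd[of _ "{-1<..<b}"]) auto
      then show ?thesis using lim0 True by (simp add: continuous_within \<phi>_def)
    next
      case False
      then have "isCont \<phi> s" using DERIV_isCont[OF D[of s]] s by simp
      then show ?thesis by (rule continuous_at_imp_continuous_within)
    qed
  qed
  have conc0: "convex_on {0<..<b} (\<lambda>x. - \<phi> x)"
    by (rule convex_on_realI[where f' = "\<lambda>x. - h x"]) (auto intro!: DERIV_minus D anti)
  have conc: "concave_on {0..<b} \<phi>"
    unfolding concave_on_def
  proof (rule convex_on_linorderI)
    fix t x y :: real
    assume t: "0 < t" "t < 1" and xy: "x \<in> {0..<b}" "y \<in> {0..<b}" "x < y"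
    have *: "- \<phi> ((1 - t) * z + t * y) \<le> (1 - t) * - \<phi> z + t * - \<phi> y" if "0 < z" "z < b" for z
      using convex_onD[OF conc0, of t z y] t xy that by simp
    show "- \<phi> ((1 - t) *\<^sub>R x + t *\<^sub>R y) \<le> (1 - t) * - \<phi> x + t * - \<phi> y"
    \<comment> \<open>Concavity on the open interval reaches the end point by letting
      \<open>z\<close> tend to 0 from the right in \<open>*\<close>.\<close>
    proof (cases "x = 0")
      case True
      have "0 < y" using xy True by simp
      then have "t * y < 1 * y" using t by (intro mult_strict_right_mono)
      then have ty: "0 < t * y" "t * y < b" using t xy(2) \<open>0 < y\<close> by (simp_all, linarith)
      have "isCont \<phi> (t * y)" using D[OF ty] by (rule DERIV_isCont)
      moreover have "((\<lambda>z. (1 - t) * z + t * y) \<longlongrightarrow> (1 - t) * 0 + t * y) (at_right 0)"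
        by (intro tendsto_intros)
      ultimately have "((\<lambda>z. - \<phi> ((1 - t) * z + t * y)) \<longlongrightarrow> - \<phi> (t * y)) (at_right 0)"
        by (intro tendsto_minus isCont_tendsto_compose[of _ \<phi>]) auto
      moreover have "((\<lambda>z. (1 - t) * - \<phi> z + t * - \<phi> y) \<longlongrightarrow> (1 - t) * - 0 + t * - \<phi> y) (at_right 0)"
        by (intro tendsto_intros lim0)
      moreover have "\<forall>\<^sub>F z in at_right 0. - \<phi> ((1 - t) * z + t * y) \<le> (1 - t) * - \<phi> z + t * - \<phi> y"
        unfolding eventually_at_right_field using * b by blast
      ultimately have "- \<phi> (t * y) \<le> (1 - t) * - 0 + t * - \<phi> y"
        by (intro tendsto_le[of "at_right (0::real)"]) auto
      then show ?thesis using True by (simp add: \<phi>_def)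
    next
      case False
      then show ?thesis using *[of x] xy by simp
    qed
  qed (rule convex_real_interval)
  show thesis
  proof (rule that[OF cont _ _ _ conc])
    show "\<phi> ` {0..<b} \<subseteq> {0..}" using L by (auto simp: \<phi>_def)
    show "\<phi> C1_differentiable_on {0<..<b}"
      unfolding C1_differentiable_on_def has_real_derivative_iff_has_vector_derivative[symmetric]
      using D h by (intro exI[of _ h] conjI ballI continuous_at_imp_continuous_on) auto
    show "deriv \<phi> s = h s" if "0 < s" "s < b" for s
      using D[OF that] by (rule DERIV_imp_deriv)
  qed (simp add: \<phi>_def)
qed

text \<open>Locally, a primitive of \<open>1/\<psi>\<close> grows no faster than \<open>2V\<close>.\<close>

lemma primitive_of_inverse_profile:
  fixes \<psi> V :: "real \<Rightarrow> real"
  assumes b: "b > 0" and \<psi>: "\<And>s. 0 < s \<Longrightarrow> s < b \<Longrightarrow> 0 < \<psi> s \<and> isCont \<psi> s"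
    and V: "\<And>s. 0 < s \<Longrightarrow> s < b \<Longrightarrow> isCont V s \<and> \<bar>V s\<bar> \<le> C"
    and mono: "\<And>s t. 0 < s \<Longrightarrow> s \<le> t \<Longrightarrow> t < b \<Longrightarrow> \<psi> s \<le> \<psi> t"
    and talweg: "\<And>s t. 0 < s \<Longrightarrow> s \<le> t \<Longrightarrow> t < b \<Longrightarrow> t - s \<le> \<psi> t * (V t - V s)"
  obtains \<Phi> B where "\<And>s. 0 < s \<Longrightarrow> s < b / 2 \<Longrightarrow> (\<Phi> has_real_derivative 1 / \<psi> s) (at s) \<and> B \<le> \<Phi> s"
proof -
  define h where "h s = 1 / \<psi> s" for s
  have h: "isCont h s" "h s > 0" if "0 < s" "s < b" for s
    using \<psi>[OF that] unfolding h_def by (auto intro!: continuous_intros)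
  \<comment> \<open>\<open>h\<close> may be unbounded at 0, so the antiderivative is taken on the
    open interval; the lower bound near 0 is the content of the lemma.\<close>
  obtain \<Phi> where "\<And>s. ereal 0 < ereal s \<Longrightarrow> ereal s < ereal b \<Longrightarrow> (\<Phi> has_vector_derivative h s) (at s)"
    using einterval_antiderivative[of "ereal 0" "ereal b" h] b h(1) by auto
  then have \<Phi>: "(\<Phi> has_real_derivative h s) (at s)" if "0 < s" "s < b" for s
    using that by (simp add: has_real_derivative_iff_has_vector_derivative)
  have "2 * V s - \<Phi> s \<le> 2 * V (b / 2) - \<Phi> (b / 2)" if s: "0 < s" "s \<le> b / 2" for s
  proof (rule right_locally_mono_imp_le[OF _ s(2)])
    show "continuous_on {s..b / 2} (\<lambda>x. 2 * V x - \<Phi> x)"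
      using s V b by (intro continuous_intros continuous_at_imp_continuous_on ballI)
        (auto intro!: continuous_intros DERIV_isCont[OF \<Phi>])
    fix \<tau> assume \<tau>: "s \<le> \<tau>" "\<tau> < b / 2"
    then have \<tau>b: "0 < \<tau>" "\<tau> < b" using s b by auto
    \<comment> \<open>\<open>talweg\<close> involves \<psi> at the right end \<sigma>, the mean
      value theorem involves it at an interior point. Continuity of \<psi> at \<tau> reconciles the
      two at the price of the factor 2.\<close>
    have "(\<psi> \<longlongrightarrow> \<psi> \<tau>) (at_right \<tau>)"
      using \<psi>[OF \<tau>b] by (simp add: isCont_def filterlim_at_split)
    then have "\<forall>\<^sub>F \<sigma> in at_right \<tau>. \<psi> \<sigma> < 2 * \<psi> \<tau>"
      using \<psi>[OF \<tau>b] by (intro order_tendstoD) auto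
    moreover have "\<forall>\<^sub>F \<sigma> in at_right \<tau>. \<sigma> < b \<and> \<tau> < \<sigma>"
      using \<tau>b unfolding eventually_at_right_field by auto
    ultimately show "\<forall>\<^sub>F \<sigma> in at_right \<tau>. 2 * V \<tau> - \<Phi> \<tau> \<le> 2 * V \<sigma> - \<Phi> \<sigma>"
    proof eventually_elim
      case (elim \<sigma>)
      have "\<exists>z. \<tau> < z \<and> z < \<sigma> \<and> \<Phi> \<sigma> - \<Phi> \<tau> = (\<sigma> - \<tau>) * h z"
        by (rule MVT2) (use elim \<tau>b in \<open>auto intro!: \<Phi>\<close>)
      then obtain z where z: "\<tau> < z" "z < \<sigma>" "\<Phi> \<sigma> - \<Phi> \<tau> = (\<sigma> - \<tau>) * h z" by blast
      have pos: "0 < \<psi> \<sigma>" "0 < \<psi> z" "0 < \<psi> \<tau>" using \<psi>[of \<sigma>] \<psi>[of z] \<psi>[of \<tau>] elim \<tau>b z by auto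
      have "\<psi> \<sigma> \<le> 2 * \<psi> z" using elim mono[of \<tau> z] z \<tau>b by simp
      then have "h z \<le> 2 / \<psi> \<sigma>" using pos by (simp add: h_def field_simps)
      then have "\<Phi> \<sigma> - \<Phi> \<tau> \<le> (\<sigma> - \<tau>) * (2 / \<psi> \<sigma>)"
        unfolding z(3) using elim by (intro mult_left_mono) auto
      also have "\<dots> \<le> (\<psi> \<sigma> * (V \<sigma> - V \<tau>)) * (2 / \<psi> \<sigma>)"
        using talweg[of \<tau> \<sigma>] elim \<tau>b pos by (intro mult_right_mono) auto
      also have "\<dots> = 2 * (V \<sigma> - V \<tau>)" using pos by simp
      finally show ?case by simp
    qed
  qed
  then have "\<Phi> (b / 2) - 4 * C \<le> \<Phi> s" if "0 < s" "s < b / 2" for s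
    using that V[of s] V[of "b / 2"] b by (force simp: abs_le_iff)
  then show thesis
    using \<Phi> b by (intro that[of \<Phi> "\<Phi> (b / 2) - 4 * C"]) (auto simp: h_def)
qed

section \<open>Consequences of twice continuous differentiability\<close>

lemma C2E:
  fixes G :: "'a::euclidean_space \<Rightarrow> real"
  assumes "C2 G"
  obtains g H where "g = grad G" "\<And>x. GDERIV G x :> g x"
    "\<And>x. (g has_derivative blinfun_apply (H x)) (at x)" "continuous_on UNIV H" "continuous_on UNIV g"
proof -
  obtain g H where gH: "\<And>x. GDERIV G x :> g x"
    "\<And>x. (g has_derivative blinfun_apply (H x)) (at x)" "continuous_on UNIV H"
    using assms unfolding C2_def by blast
  moreover have "g = grad G" using grad_eqI[OF gH(1)] by (simp add: fun_eq_iff)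
  moreover have "continuous_on UNIV g"
    using gH(2) by (auto simp: continuous_on_eq_continuous_at intro: has_derivative_continuous)
  ultimately show thesis using that by blast
qed

lemma local_lipschitz_derivative:
  fixes g :: "'a::euclidean_space \<Rightarrow> 'a"
  assumes der: "\<And>x. (g has_derivative blinfun_apply (H x)) (at x)" and H: "continuous_on UNIV H"
  obtains \<rho> M where "\<rho> > 0" "M > 0"
    "\<And>x y. x \<in> ball a \<rho> \<Longrightarrow> y \<in> ball a \<rho> \<Longrightarrow> norm (g x - g y) \<le> M * norm (x - y)"
proof -
  have "isCont H a" using H by (simp add: continuous_on_eq_continuous_at)
  then obtain \<rho> where \<rho>: "\<rho> > 0" "\<And>x. dist x a < \<rho> \<Longrightarrow> dist (H x) (H a) < 1"
    unfolding continuous_at_eps_delta by (metis zero_less_one)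
  have "norm (g x - g y) \<le> (norm (H a) + 1) * norm (x - y)" if "x \<in> ball a \<rho>" "y \<in> ball a \<rho>" for x y
  proof (rule differentiable_bound[OF convex_ball _ _ that])
    fix z assume z: "z \<in> ball a \<rho>"
    show "(g has_derivative blinfun_apply (H z)) (at z within ball a \<rho>)"
      using der by (rule has_derivative_at_withinI)
    have "norm (H z) \<le> norm (H a) + norm (H z - H a)" by (rule norm_triangle_sub)
    then show "onorm (blinfun_apply (H z)) \<le> norm (H a) + 1"
      using \<rho>(2)[of z] z by (simp add: norm_blinfun.rep_eq[symmetric] dist_norm norm_minus_commute)
  qed
  then show thesis using \<rho>(1) by (intro that[of \<rho> "norm (H a) + 1"]) (auto simp: add_nonneg_pos)
qed

section \<open>Existence of desingularizing functions and a lower bound valid for all of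
  them\<close>

context o_minimal_structure
begin

lemma exists_admissible_desingularizing:
  fixes G :: "real ^ 'n::{finite,linorder} \<Rightarrow> real"
  assumes G: "definable_map G" and "C2 G" and crit: "grad G a = 0"
  shows "\<exists>r \<phi>. admissible_desingularizing G a r \<phi>"
proof -
  obtain g H where g: "g = grad G" and grad: "\<And>x. GDERIV G x :> g x"
    and der: "\<And>x. (g has_derivative blinfun_apply (H x)) (at x)" "continuous_on UNIV H"
    and contg: "continuous_on UNIV g"
    using C2E[OF \<open>C2 G\<close>] by metis
  have contG: "isCont G x" for x
    using grad[of x] by (auto simp: gderiv_def intro: has_derivative_continuous)
  show ?thesis
  proof (cases "\<exists>d>0. \<forall>x\<in>ball a d. G x = G a")
    case True
    then obtain d where d: "d > 0" "\<And>x. x \<in> ball a d \<Longrightarrow> G x = G a" by blast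
    have D: "(sqrt has_real_derivative inverse (sqrt s) / 2) (at s)" if "s > 0" for s
      using that by (rule DERIV_real_sqrt)
    \<comment> \<open>Where \<open>G\<close> is locally constant only the convention on \<phi>'
      constrains \<phi>, and the square root meets it with constant \<open>1 / 2\<close>.\<close>
    obtain \<phi> where \<phi>: "continuous_on {0..<1} \<phi>" "\<phi> ` {0..<1} \<subseteq> {0..}" "\<phi> 0 = 0"
      "\<phi> C1_differentiable_on {0<..<1}" "concave_on {0..<1} \<phi>"
      "\<And>s. 0 < s \<Longrightarrow> s < 1 \<Longrightarrow> deriv \<phi> s = inverse (sqrt s) / 2"
    proof (rule concave_primitive[of 1 "\<lambda>s. inverse (sqrt s) / 2" sqrt 0])
      show "inverse (sqrt t) / 2 \<le> inverse (sqrt s) / 2" if "0 < s" "s \<le> t" "t < 1" for s t :: real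
        using that by (simp add: field_simps)
      show "0 < inverse (sqrt s) / 2 \<and> isCont (\<lambda>s. inverse (sqrt s) / 2) s" if "0 < s" for s
        using that by (auto intro!: continuous_intros)
      show "0 \<le> sqrt s" if "0 < s" for s :: real using that by simp
    qed (simp_all add: D that)
    have "desingularizing G a 1 \<phi>"
      unfolding desingularizing_iff[OF grad]
    proof (intro conjI)
      show "\<forall>s\<in>{0<..<1}. 0 < deriv \<phi> s"
      proof
        fix s :: real assume "s \<in> {0<..<1}"
        then show "0 < deriv \<phi> s" by (subst \<phi>(6)) auto
      qed
      show "\<exists>\<eta>>0. (\<forall>x\<in>ball a \<eta>. \<bar>G x - G a\<bar> < 1) \<and>
        (\<forall>x\<in>ball a \<eta>. G x \<noteq> G a \<longrightarrow> 1 \<le> deriv \<phi> \<bar>G x - G a\<bar> * norm (g x))"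
      proof (intro exI[of _ d] conjI ballI impI)
        fix x assume "x \<in> ball a d"
        then have "G x = G a" by (rule d(2))
        then show "\<bar>G x - G a\<bar> < 1" and "G x \<noteq> G a \<Longrightarrow> 1 \<le> deriv \<phi> \<bar>G x - G a\<bar> * norm (g x)"
          by simp_all
      qed (rule d(1))
    qed (use \<phi> in simp_all)
    moreover have "\<forall>\<^sub>F s in at_right 0. deriv \<phi> s \<ge> (1 / 2) / sqrt s"
      unfolding eventually_at_right_field using \<phi>(6) by (intro exI[of _ 1]) (auto simp: field_simps)
    ultimately show ?thesis
      unfolding admissible_desingularizing_def
      by (intro exI[of _ 1] exI[of _ \<phi>] conjI impI exI[of _ "1 / 2"]) auto
  next
    case False
    have ga: "g a = 0" using crit by (simp add: g)
    have nontriv: "\<exists>x\<in>ball a d. G x \<noteq> G a" if "d > 0" for d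
      using False that by blast
    obtain \<rho> M where \<rho>: "\<rho> > 0" "M > 0"
      "\<And>x y. x \<in> ball a \<rho> \<Longrightarrow> y \<in> ball a \<rho> \<Longrightarrow> norm (g x - g y) \<le> M * norm (x - y)"
      using local_lipschitz_derivative[OF der, of a] by metis
    obtain \<psi> V b C where b: "b > 0"
      and least: "\<And>y. norm (y - a) \<le> \<rho> \<Longrightarrow> 0 < \<bar>G y - G a\<bar> \<Longrightarrow> \<bar>G y - G a\<bar> < b \<Longrightarrow> \<psi> \<bar>G y - G a\<bar> \<le> norm (g y)"
      and \<psi>: "\<And>s. 0 < s \<Longrightarrow> s < b \<Longrightarrow> 0 < \<psi> s \<and> isCont \<psi> s \<and> (\<psi> s)\<^sup>2 \<le> 9 * M * s \<and> \<psi> (2 * s) \<le> 4 * \<psi> s \<and> isCont V s \<and> \<bar>V s\<bar> \<le> C"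
      and mono: "\<And>s t. 0 < s \<Longrightarrow> s \<le> t \<Longrightarrow> t < b \<Longrightarrow> \<psi> s \<le> \<psi> t"
      and talweg: "\<And>s t. 0 < s \<Longrightarrow> s \<le> t \<Longrightarrow> t < b \<Longrightarrow> t - s \<le> \<psi> t * (V t - V s)"
    proof (rule gradient_profile[OF G grad contg \<rho>(3) \<rho>(2) ga \<rho>(1) order_refl nontriv])
    qed (assumption | rule that)+
    obtain \<Phi> B where \<Phi>: "\<And>s. 0 < s \<Longrightarrow> s < b / 2 \<Longrightarrow> (\<Phi> has_real_derivative 1 / \<psi> s) (at s) \<and> B \<le> \<Phi> s"
    proof (rule primitive_of_inverse_profile[OF b _ _ mono talweg])
      show "0 < \<psi> s \<and> isCont \<psi> s" "isCont V s \<and> \<bar>V s\<bar> \<le> C" if "0 < s" "s < b" for s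
        using \<psi>[OF that] by auto
    qed (use that in auto)
    obtain \<phi> where \<phi>: "continuous_on {0..<b/2} \<phi>" "\<phi> ` {0..<b/2} \<subseteq> {0..}" "\<phi> 0 = 0"
      "\<phi> C1_differentiable_on {0<..<b/2}" "concave_on {0..<b/2} \<phi>"
      "\<And>s. 0 < s \<Longrightarrow> s < b/2 \<Longrightarrow> deriv \<phi> s = 1 / \<psi> s"
    proof (rule concave_primitive[of "b / 2" "\<lambda>s. 1 / \<psi> s" \<Phi> B])
      show "0 < 1 / \<psi> s \<and> isCont (\<lambda>s. 1 / \<psi> s) s" if "0 < s" "s < b / 2" for s
        using \<psi>[of s] that by (auto intro!: continuous_intros)
      show "1 / \<psi> t \<le> 1 / \<psi> s" if "0 < s" "s \<le> t" "t < b / 2" for s t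
        using mono[of s t] \<psi>[of s] that by (intro divide_left_mono) auto
    qed (use b \<Phi> that in auto)
    obtain \<delta> where \<delta>: "\<delta> > 0" "\<And>y. dist y a < \<delta> \<Longrightarrow> dist (G y) (G a) < b / 2"
      using contG[of a] b unfolding continuous_at_eps_delta by (meson half_gt_zero)
    have "desingularizing G a (b / 2) \<phi>"
      unfolding desingularizing_iff[OF grad]
    proof (intro conjI)
      show "\<forall>s\<in>{0<..<b / 2}. 0 < deriv \<phi> s" using \<phi>(6) \<psi> by auto
      show "\<exists>\<eta>>0. (\<forall>x\<in>ball a \<eta>. \<bar>G x - G a\<bar> < b / 2) \<and>
        (\<forall>x\<in>ball a \<eta>. G x \<noteq> G a \<longrightarrow> 1 \<le> deriv \<phi> \<bar>G x - G a\<bar> * norm (g x))"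
      proof (intro exI[of _ "min \<delta> \<rho>"] conjI ballI impI)
        show "0 < min \<delta> \<rho>" using \<delta> \<rho> by simp
        fix x assume x: "x \<in> ball a (min \<delta> \<rho>)"
        then show lt: "\<bar>G x - G a\<bar> < b / 2" using \<delta>(2)[of x] by (auto simp: dist_commute dist_real_def abs_minus_commute)
        assume "G x \<noteq> G a"
        then have "\<psi> \<bar>G x - G a\<bar> \<le> norm (g x)" "0 < \<psi> \<bar>G x - G a\<bar>"
          using least[of x] \<psi>[of "\<bar>G x - G a\<bar>"] lt x b by (auto simp: dist_norm norm_minus_commute)
        then show "1 \<le> deriv \<phi> \<bar>G x - G a\<bar> * norm (g x)"
          using lt \<open>G x \<noteq> G a\<close> by (subst \<phi>(6)) auto
      qed
    qed (use \<phi> b in auto)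
    \<comment> \<open>On a ball inside \<open>crit G\<close> the function would be constant, which
      this case excludes; so the convention on \<phi>' is vacuous here.\<close>
    moreover have "a \<notin> interior (crit G)"
    proof
      assume "a \<in> interior (crit G)"
      then obtain d where d: "d > 0" "ball a d \<subseteq> crit G" by (auto simp: mem_interior)
      have "G x = G a" if "x \<in> ball a d" for x
      proof (rule has_derivative_zero_unique[of "ball a d" G x a])
        show "(G has_derivative (\<lambda>h. 0)) (at y within ball a d)" if "y \<in> ball a d" for y
        proof -
          have "g y = 0" using d(2) that unfolding g crit_def by blast
          then show ?thesis using grad[of y] by (simp add: gderiv_def has_derivative_at_withinI)
        qed
      qed (use that d in auto)
      then show False using False d(1) by blast
    qed
    ultimately show ?thesis unfolding admissible_desingularizing_def by blast
  qed
qed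

text \<open>From here on \<psi> replaces the arbitrary \<phi>. The inequality for \<phi>, evaluated
  at a point of level \<open>s\<close> where the gradient norm equals \<open>\<psi> s\<close>, reads
  \<open>1 \<le> deriv \<phi> s * \<psi> s\<close>. The locally constant case is brought into the
  same form so that the trajectory argument need not distinguish it.\<close>

lemma admissible_profile:
  fixes G :: "real ^ 'n::{finite,linorder} \<Rightarrow> real"
  assumes G: "definable_map G" and "C2 G" and crit: "grad G a = 0"
    and adm: "admissible_desingularizing G a r \<phi>"
  obtains \<psi> b \<eta> \<beta> K where "b > 0" "b \<le> r" "\<eta> > 0" "\<beta> > 0" "K > 0"
    "\<And>s. 0 < s \<Longrightarrow> s < b \<Longrightarrow> 0 < \<psi> s \<and> \<psi> (2 * s) \<le> 4 * \<psi> s \<and> \<psi> s \<le> K * sqrt s \<and> \<beta> / \<psi> s \<le> deriv \<phi> s"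
    "\<And>s t. 0 < s \<Longrightarrow> s \<le> t \<Longrightarrow> t < b \<Longrightarrow> \<psi> s \<le> \<psi> t"
    "\<And>y. norm (y - a) \<le> \<eta> \<Longrightarrow> 0 < \<bar>G y - G a\<bar> \<Longrightarrow> \<bar>G y - G a\<bar> < b \<Longrightarrow> \<psi> \<bar>G y - G a\<bar> \<le> norm (grad G y)"
proof -
  obtain g H where g: "g = grad G" and grad: "\<And>x. GDERIV G x :> g x"
    and der: "\<And>x. (g has_derivative blinfun_apply (H x)) (at x)" "continuous_on UNIV H"
    and contg: "continuous_on UNIV g"
    using C2E[OF \<open>C2 G\<close>] by metis
  from adm have des: "desingularizing G a r \<phi>"
    and triv: "a \<in> interior (crit G) \<Longrightarrow> \<exists>\<beta>>0. \<forall>\<^sub>F s in at_right 0. deriv \<phi> s \<ge> \<beta> / sqrt s"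
    unfolding admissible_desingularizing_def by auto
  note d = des[unfolded desingularizing_iff[OF grad]]
  have r: "r > 0" using d by blast
  obtain \<eta> where \<eta>: "\<eta> > 0" "\<And>x. x \<in> ball a \<eta> \<Longrightarrow> \<bar>G x - G a\<bar> < r"
    "\<And>x. x \<in> ball a \<eta> \<Longrightarrow> G x \<noteq> G a \<Longrightarrow> 1 \<le> deriv \<phi> \<bar>G x - G a\<bar> * norm (g x)"
    using d by blast
  show thesis
  proof (cases "\<exists>d>0. \<forall>x\<in>ball a d. G x = G a")
    case True
    then obtain d where d: "d > 0" "\<And>x. x \<in> ball a d \<Longrightarrow> G x = G a" by blast
    have "ball a d \<subseteq> crit G"
      using grad_zero_of_const_on_ball[OF grad d(2)] by (auto simp: crit_def g)
    then have "a \<in> interior (crit G)" using d(1) by (auto simp: mem_interior)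
    then obtain \<beta> where \<beta>: "\<beta> > 0" "\<forall>\<^sub>F s in at_right 0. deriv \<phi> s \<ge> \<beta> / sqrt s" using triv by blast
    then obtain b where b: "b > 0" "\<And>s. 0 < s \<Longrightarrow> s < b \<Longrightarrow> deriv \<phi> s \<ge> \<beta> / sqrt s"
      unfolding eventually_at_right_field by blast
    have s2: "sqrt 2 \<le> 4" by (rule real_le_lsqrt) auto
    show thesis
    \<comment> \<open>No level but 0 is reached near \<open>a\<close>, so the gradient bound holds
      vacuously and the square root may serve as profile; \<beta> is the constant of the
      convention.\<close>
    proof (rule that[of "min b r" "d / 2" \<beta> 1 sqrt])
      show "0 < sqrt s \<and> sqrt (2 * s) \<le> 4 * sqrt s \<and> sqrt s \<le> 1 * sqrt s \<and> \<beta> / sqrt s \<le> deriv \<phi> s"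
        if "0 < s" "s < min b r" for s
        using b(2)[of s] that s2 by (auto simp: real_sqrt_mult)
      show "sqrt \<bar>G y - G a\<bar> \<le> norm (grad G y)" if "norm (y - a) \<le> d / 2" "0 < \<bar>G y - G a\<bar>" for y
        using d(2)[of y] that d(1) by (auto simp: dist_norm norm_minus_commute)
    qed (use r b d \<beta> in auto)
  next
    case False
    have ga: "g a = 0" using crit by (simp add: g)
    have nontriv: "\<exists>x\<in>ball a d. G x \<noteq> G a" if "d > 0" for d
      using False that by blast
    obtain \<rho> M where \<rho>: "\<rho> > 0" "M > 0"
      "\<And>x y. x \<in> ball a \<rho> \<Longrightarrow> y \<in> ball a \<rho> \<Longrightarrow> norm (g x - g y) \<le> M * norm (x - y)"
      using local_lipschitz_derivative[OF der, of a] by metis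
    \<comment> \<open>The points attaining \<psi> lie in a closed ball; its radius stays below
      \<eta> so that the inequality for \<phi> can be applied at them.\<close>
    define \<epsilon> where "\<epsilon> = min \<rho> (\<eta> / 2)"
    have \<epsilon>: "0 < \<epsilon>" "\<epsilon> \<le> \<rho>" "\<epsilon> < \<eta>" using \<rho> \<eta> by (auto simp: \<epsilon>_def)
    obtain \<psi> V b C where b: "b > 0"
      and att: "\<And>s. 0 < s \<Longrightarrow> s < b \<Longrightarrow> \<exists>x. norm (x - a) \<le> \<epsilon> \<and> \<bar>G x - G a\<bar> = s \<and> norm (g x) = \<psi> s"
      and least: "\<And>y. norm (y - a) \<le> \<epsilon> \<Longrightarrow> 0 < \<bar>G y - G a\<bar> \<Longrightarrow> \<bar>G y - G a\<bar> < b \<Longrightarrow> \<psi> \<bar>G y - G a\<bar> \<le> norm (g y)"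
      and \<psi>: "\<And>s. 0 < s \<Longrightarrow> s < b \<Longrightarrow> 0 < \<psi> s \<and> isCont \<psi> s \<and> (\<psi> s)\<^sup>2 \<le> 9 * M * s \<and> \<psi> (2 * s) \<le> 4 * \<psi> s \<and> isCont V s \<and> \<bar>V s\<bar> \<le> C"
      and mono: "\<And>s t. 0 < s \<Longrightarrow> s \<le> t \<Longrightarrow> t < b \<Longrightarrow> \<psi> s \<le> \<psi> t"
      and "\<And>s t. 0 < s \<Longrightarrow> s \<le> t \<Longrightarrow> t < b \<Longrightarrow> t - s \<le> \<psi> t * (V t - V s)"
    proof (rule gradient_profile[OF G grad contg \<rho>(3) \<rho>(2) ga \<epsilon>(1,2) nontriv])
    qed (assumption | rule that)+
    show thesis
    proof (rule that[of "min b r" \<epsilon> 1 "sqrt (9 * M)" \<psi>])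
      show "0 < \<psi> s \<and> \<psi> (2 * s) \<le> 4 * \<psi> s \<and> \<psi> s \<le> sqrt (9 * M) * sqrt s \<and> 1 / \<psi> s \<le> deriv \<phi> s"
        if s: "0 < s" "s < min b r" for s
      proof (intro conjI)
        show pos: "0 < \<psi> s" and "\<psi> (2 * s) \<le> 4 * \<psi> s" using \<psi>[of s] s by auto
        have "\<psi> s \<le> sqrt (9 * M * s)" using \<psi>[of s] s by (intro real_le_rsqrt) auto
        then show "\<psi> s \<le> sqrt (9 * M) * sqrt s" by (simp add: real_sqrt_mult)
        obtain x where x: "norm (x - a) \<le> \<epsilon>" "\<bar>G x - G a\<bar> = s" "norm (g x) = \<psi> s"
          using att[of s] s by auto
        then have "1 \<le> deriv \<phi> s * \<psi> s"
          using \<eta>(3)[of x] \<epsilon> s by (auto simp: dist_norm norm_minus_commute)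
        then show "1 / \<psi> s \<le> deriv \<phi> s" using pos by (simp add: divide_le_eq)
      qed
    qed (use r b \<epsilon> \<rho> mono least in \<open>auto simp: g\<close>)
  qed
qed

end

subsection \<open>The worst-case gradient system\<close>

text \<open>Here \<open>f\<close> is \<phi>'. In the variable
  \<open>\<omega> = \<theta> \<nu>\<close> the system becomes
  \<open>\<omega>' = - 1 / (f \<omega>)\<^sup>2\<close>, the form used for comparison and for
  existence. \<open>growth\<close> says that \<phi> is at 0 at least as steep as a multiple of the
  square root; this keeps solutions from reaching 0 in finite time.\<close>

locale worst_case =
  fixes r :: real and \<phi> f :: "real \<Rightarrow> real" and A b :: real
  assumes r: "r > 0" and cont: "continuous_on {0..<r} \<phi>" and \<phi>0: "\<phi> 0 = 0"
    and der: "\<And>s. 0 < s \<Longrightarrow> s < r \<Longrightarrow> (\<phi> has_real_derivative f s) (at s)"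
    and pos: "\<And>s. 0 < s \<Longrightarrow> s < r \<Longrightarrow> f s > 0"
    and contf: "\<And>s. 0 < s \<Longrightarrow> s < r \<Longrightarrow> isCont f s"
    and anti: "\<And>s t. 0 < s \<Longrightarrow> s \<le> t \<Longrightarrow> t < r \<Longrightarrow> f t \<le> f s"
    and A: "A > 0" and b: "0 < b" "b < r"
    and growth: "\<And>s. 0 < s \<Longrightarrow> s \<le> b \<Longrightarrow> A / sqrt s \<le> f s"
begin

definition \<theta> :: "real \<Rightarrow> real" where "\<theta> = inv_into {0..<r} \<phi>"

lemma \<phi>_strict_mono:
  assumes "0 \<le> s" "s < t" "t < r"
  shows "\<phi> s < \<phi> t"
proof (rule DERIV_pos_imp_increasing_open[OF assms(2)])
  show "continuous_on {s..t} \<phi>" using assms by (intro continuous_on_subset[OF cont]) auto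
  fix x assume "s < x" "x < t"
  then show "\<exists>y. (\<phi> has_real_derivative y) (at x) \<and> 0 < y"
    using der[of x] pos[of x] assms by auto
qed

lemma inj_on_\<phi>: "inj_on \<phi> {0..<r}"
  by (rule linorder_inj_onI) (auto dest: \<phi>_strict_mono)

lemma \<theta>_\<phi>: "0 \<le> s \<Longrightarrow> s < r \<Longrightarrow> \<theta> (\<phi> s) = s"
  unfolding \<theta>_def by (intro inv_into_f_f inj_on_\<phi>) auto

lemma \<phi>_\<theta>: "y \<in> \<phi> ` {0..<r} \<Longrightarrow> \<phi> (\<theta> y) = y"
  unfolding \<theta>_def by (rule f_inv_into_f)

lemma \<theta>_range: "y \<in> \<phi> ` {0..<r} \<Longrightarrow> 0 \<le> \<theta> y \<and> \<theta> y < r"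
  using inv_into_into[of y \<phi> "{0..<r}"] unfolding \<theta>_def by auto

lemma \<phi>_pos: "0 < s \<Longrightarrow> s < r \<Longrightarrow> 0 < \<phi> s"
  using \<phi>_strict_mono[of 0 s] \<phi>0 by simp

lemma \<phi>_nonneg: "y \<in> \<phi> ` {0..<r} \<Longrightarrow> 0 \<le> y"
  using \<phi>_pos \<phi>0 by (force simp: le_less)

lemma \<theta>_pos: "y \<in> \<phi> ` {0..<r} \<Longrightarrow> 0 < y \<Longrightarrow> 0 < \<theta> y"
  using \<phi>_\<theta>[of y] \<theta>_range[of y] \<phi>0 by (cases "\<theta> y = 0") auto

lemma \<theta>_mono: "x \<in> \<phi> ` {0..<r} \<Longrightarrow> y \<in> \<phi> ` {0..<r} \<Longrightarrow> x \<le> y \<Longrightarrow> \<theta> x \<le> \<theta> y"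
  using \<phi>_strict_mono[of "\<theta> y" "\<theta> x"] \<phi>_\<theta>[of x] \<phi>_\<theta>[of y] \<theta>_range[of x] \<theta>_range[of y]
  by (cases "\<theta> x \<le> \<theta> y") auto

lemma \<theta>_der:
  assumes "0 < s" "s < r"
  shows "(\<theta> has_real_derivative 1 / f s) (at (\<phi> s))"
proof -
  have "(\<theta> has_derivative times (1 / f s)) (at (\<phi> s))"
  proof (rule has_derivative_inverse_strong[of "{0<..<r}" s \<phi> \<theta>])
    show "(\<phi> has_derivative times (f s)) (at s)"
      using der[OF assms] by (simp add: has_field_derivative_def)
    show "continuous_on {0<..<r} \<phi>" by (rule continuous_on_subset[OF cont]) auto
    show "times (f s) \<circ> times (1 / f s) = id" using pos[OF assms] by (auto simp: fun_eq_iff)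
  qed (use assms \<theta>_\<phi> in auto)
  then show ?thesis by (simp add: has_field_derivative_def)
qed

text \<open>The derivative of the inverse in \<open>worst_case_solution\<close> is taken within the
  range of \<phi>. Away from the end point 0 it is thus an ordinary derivative and determined by
  \<open>f\<close>.\<close>

lemma nhd_range:
  assumes "0 < s" "s < r"
  shows "at (\<phi> s) within \<phi> ` {0..<r} = at (\<phi> s)"
proof (rule at_within_nhd)
  define t where "t = (s + r) / 2"
  have t: "s < t" "t < r" using assms by (auto simp: t_def)
  show "\<phi> s \<in> {0<..<\<phi> t}" using \<phi>_pos[OF assms] \<phi>_strict_mono[of s t] t assms by auto
  have "y \<in> \<phi> ` {0..<r}" if "0 < y" "y < \<phi> t" for y
  proof -
    have "\<exists>x\<ge>0. x \<le> t \<and> \<phi> x = y"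
      by (rule IVT') (use that t assms \<phi>0 in \<open>auto intro: continuous_on_subset[OF cont]\<close>)
    then show ?thesis using t by force
  qed
  then show "\<phi> ` {0..<r} \<inter> {0<..<\<phi> t} - {\<phi> s} = UNIV \<inter> {0<..<\<phi> t} - {\<phi> s}" by auto
qed auto

lemma \<phi>_ge_sqrt:
  assumes "0 \<le> s" "s \<le> b"
  shows "2 * A * sqrt s \<le> \<phi> s"
proof -
  have "(\<lambda>x. \<phi> x - 2 * A * sqrt x) 0 \<le> (\<lambda>x. \<phi> x - 2 * A * sqrt x) s"
  proof (rule DERIV_nonneg_imp_increasing_open[OF assms(1)])
    fix x assume x: "0 < x" "x < s"
    have "((\<lambda>x. \<phi> x - 2 * A * sqrt x) has_real_derivative f x - 2 * A * (inverse (sqrt x) / 2)) (at x)"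
      using x assms b by (intro DERIV_diff DERIV_cmult DERIV_real_sqrt der) auto
    moreover have "f x - 2 * A * (inverse (sqrt x) / 2) \<ge> 0"
      using growth[of x, unfolded divide_inverse] x assms by simp
    ultimately show "\<exists>y. ((\<lambda>x. \<phi> x - 2 * A * sqrt x) has_real_derivative y) (at x) \<and> y \<ge> 0" by blast
  next
    have "continuous_on {0..s} \<phi>"
      by (rule continuous_on_subset[OF cont]) (use assms b in auto)
    then show "continuous_on {0..s} (\<lambda>x. \<phi> x - 2 * A * sqrt x)"
      by (intro continuous_intros)
  qed
  then show ?thesis using \<phi>0 by simp
qed

text \<open>Hence \<open>\<nu>' \<ge> - C \<nu>\<close> for worst-case solutions: they never vanish, and a time shift costs only
  a constant factor.\<close>

lemma speed_linear:
  assumes w: "0 < w" "w < r"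
  obtains C where "C \<ge> 0" "\<And>s. 0 < s \<Longrightarrow> s \<le> w \<Longrightarrow> 1 / f s \<le> C * \<phi> s"
proof
  \<comment> \<open>The first entry serves \<open>s \<le> b\<close>, through
    \<open>1 / f s \<le> sqrt s / A\<close> and \<open>\<phi>_ge_sqrt\<close>; the second serves
    \<open>b < s\<close>, where \<open>f s \<ge> f w\<close> and
    \<open>\<phi> s \<ge> \<phi> b\<close>.\<close>
  define C where "C = max (1 / (2 * A\<^sup>2)) (1 / (f w * \<phi> b))"
  show "C \<ge> 0" using A by (auto simp: C_def le_max_iff_disj)
  fix s assume s: "0 < s" "s \<le> w"
  have \<phi>s: "\<phi> s > 0" using \<phi>_pos[of s] s w by simp
  show "1 / f s \<le> C * \<phi> s"
  proof (cases "s \<le> b")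
    case True
    have "1 / f s \<le> 1 / (A / sqrt s)"
      using growth[of s] A s True by (intro divide_left_mono mult_pos_pos) (auto intro: less_le_trans[of 0 "A / sqrt s"])
    also have "\<dots> = sqrt s / A" by simp
    also have "\<dots> = (1 / (2 * A\<^sup>2)) * (2 * A * sqrt s)" using A by (simp add: power2_eq_square)
    also have "\<dots> \<le> (1 / (2 * A\<^sup>2)) * \<phi> s" using \<phi>_ge_sqrt[of s] s True by (intro mult_left_mono) auto
    also have "\<dots> \<le> C * \<phi> s" using \<phi>s by (intro mult_right_mono) (auto simp: C_def)
    finally show ?thesis .
  next
    case False
    have fw: "0 < f w" "f w \<le> f s" using pos[OF w] anti[of s w] s w by auto
    have "\<phi> b \<le> \<phi> s" "0 < \<phi> b" using \<phi>_strict_mono[of b s] False s w b \<phi>_pos[of b] by auto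
    have "1 / f s \<le> 1 / f w" using fw by (intro divide_left_mono mult_pos_pos) auto
    also have "\<dots> = (1 / (f w * \<phi> b)) * \<phi> b" using \<open>0 < \<phi> b\<close> by simp
    also have "\<dots> \<le> (1 / (f w * \<phi> b)) * \<phi> s"
      using fw \<open>0 < \<phi> b\<close> \<open>\<phi> b \<le> \<phi> s\<close> by (intro mult_left_mono) auto
    also have "\<dots> \<le> C * \<phi> s" using \<phi>s by (intro mult_right_mono) (auto simp: C_def)
    finally show ?thesis .
  qed
qed

lemma solution_derivative:
  assumes "worst_case_solution r \<phi> \<nu>" "t \<ge> 0" "\<nu> t > 0"
  shows "(\<nu> has_real_derivative - (1 / f (\<theta> (\<nu> t)))) (at t within {0..})"
proof -
  obtain d where \<nu>: "\<nu> t \<in> \<phi> ` {0..<r}"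
    and d: "(\<theta> has_real_derivative d) (at (\<nu> t) within \<phi> ` {0..<r})"
    "(\<nu> has_real_derivative - d) (at t within {0..})"
    using assms(1,2) unfolding worst_case_solution_def \<theta>_def by blast
  have w: "0 < \<theta> (\<nu> t)" "\<theta> (\<nu> t) < r" "\<phi> (\<theta> (\<nu> t)) = \<nu> t"
    using \<theta>_pos[OF \<nu> assms(3)] \<theta>_range[OF \<nu>] \<phi>_\<theta>[OF \<nu>] by auto
  have "(\<theta> has_real_derivative d) (at (\<nu> t))"
    using d(1) nhd_range[OF w(1,2)] w(3) by simp
  moreover have "(\<theta> has_real_derivative 1 / f (\<theta> (\<nu> t))) (at (\<nu> t))"
    using \<theta>_der[OF w(1,2)] w(3) by simp
  ultimately have "d = 1 / f (\<theta> (\<nu> t))" by (rule DERIV_unique)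
  then show ?thesis using d(2) by simp
qed

lemma solution_properties:
  assumes sol: "worst_case_solution r \<phi> \<nu>"
  shows "continuous_on {0..} \<nu>" "\<And>t. t \<ge> 0 \<Longrightarrow> \<nu> t > 0" "\<And>t. t \<ge> 0 \<Longrightarrow> \<nu> t \<in> \<phi> ` {0..<r}"
    "\<exists>C\<ge>0. \<forall>s t. 0 \<le> s \<longrightarrow> s \<le> t \<longrightarrow> exp (C * s) * \<nu> s \<le> exp (C * t) * \<nu> t"
proof -
  show rng: "\<nu> t \<in> \<phi> ` {0..<r}" if "t \<ge> 0" for t
    using sol that unfolding worst_case_solution_def by blast
  have \<nu>0: "\<nu> 0 > 0" using sol unfolding worst_case_solution_def by blast
  show cont\<nu>: "continuous_on {0..} \<nu>"
    unfolding continuous_on_eq_continuous_within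
    using sol unfolding worst_case_solution_def by (auto intro: DERIV_continuous)
  have D: "(\<nu> has_real_derivative - (1 / f (\<theta> (\<nu> t)))) (at t)" if "t > 0" "\<nu> t > 0" for t
    using solution_derivative[OF sol _ that(2)] that(1) at_within_open_subset[of t "{0<..}" "{0..}"]
      less_imp_le[of 0] by (auto simp: subset_iff)
  have w: "0 < \<theta> (\<nu> t)" "\<theta> (\<nu> t) < r" "\<phi> (\<theta> (\<nu> t)) = \<nu> t" if "t \<ge> 0" "\<nu> t > 0" for t
    using \<theta>_pos[OF rng that(2)] \<theta>_range[OF rng] \<phi>_\<theta>[OF rng] that by auto
  obtain C where C: "C \<ge> 0" "\<And>s. 0 < s \<Longrightarrow> s \<le> \<theta> (\<nu> 0) \<Longrightarrow> 1 / f s \<le> C * \<phi> s"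
    using speed_linear[OF w(1,2)[OF order_refl \<nu>0]] by blast
  \<comment> \<open>Positivity is asked only before \<open>t\<close>, so that the inequality can be
    applied at a first zero of \<nu> and rule it out.\<close>
  have grow: "exp (C * s) * \<nu> s \<le> exp (C * t) * \<nu> t"
    if st: "0 \<le> s" "s \<le> t" and p: "\<And>x. 0 \<le> x \<Longrightarrow> x < t \<Longrightarrow> \<nu> x > 0" for s t
  proof (rule DERIV_nonneg_imp_increasing_open[OF st(2)])
    have "continuous_on {s..t} \<nu>"
      by (rule continuous_on_subset[OF cont\<nu>]) (use st in auto)
    then show "continuous_on {s..t} (\<lambda>x. exp (C * x) * \<nu> x)"
      by (intro continuous_intros)
    fix x assume x: "s < x" "x < t"
    then have x0: "0 < x" "\<nu> x > 0" using st p by auto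
    have "\<nu> x \<le> \<nu> 0"
    proof (rule DERIV_nonpos_imp_decreasing_open[of 0 x])
      show "continuous_on {0..x} \<nu>" by (rule continuous_on_subset[OF cont\<nu>]) auto
      fix y assume "0 < y" "y < x"
      then have "\<nu> y > 0" "y > 0" using p x by auto
      then show "\<exists>z. (\<nu> has_real_derivative z) (at y) \<and> z \<le> 0"
        using D[of y] pos[OF w(1,2)[of y]] by (intro exI[of _ "- (1 / f (\<theta> (\<nu> y)))"]) auto
    qed (use x0 in simp)
    then have "\<theta> (\<nu> x) \<le> \<theta> (\<nu> 0)" using x0 by (intro \<theta>_mono rng) auto
    then have "1 / f (\<theta> (\<nu> x)) \<le> C * \<nu> x" using C(2)[of "\<theta> (\<nu> x)"] w[of x] x0 by simp
    then have "0 \<le> exp (C * x) * (C * \<nu> x - 1 / f (\<theta> (\<nu> x)))" by simp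
    moreover have "((\<lambda>x. exp (C * x) * \<nu> x) has_real_derivative
        exp (C * x) * (C * \<nu> x - 1 / f (\<theta> (\<nu> x)))) (at x)"
      using D[OF x0] by (auto intro!: derivative_eq_intros simp: algebra_simps)
    ultimately show "\<exists>y. ((\<lambda>x. exp (C * x) * \<nu> x) has_real_derivative y) (at x) \<and> y \<ge> 0" by blast
  qed
  show p: "\<nu> t > 0" if "t \<ge> 0" for t
  proof (rule ccontr)
    assume "\<not> \<nu> t > 0"
    then have "\<nu> t = 0" using \<phi>_nonneg[OF rng[OF that]] by simp
    let ?Z = "{x \<in> {0..t}. \<nu> x = 0}"
    have "compact ?Z"
      by (rule closedin_compact[OF compact_Icc continuous_closedin_preimage_constant])
        (auto intro: continuous_on_subset[OF cont\<nu>])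
    moreover have "?Z \<noteq> {}" using \<open>\<nu> t = 0\<close> that by auto
    ultimately obtain z where z: "z \<in> ?Z" "\<And>x. x \<in> ?Z \<Longrightarrow> z \<le> x"
      using compact_attains_inf[of ?Z] by blast
    have "\<nu> x > 0" if "0 \<le> x" "x < z" for x
      using z(2)[of x] z(1) that \<phi>_nonneg[OF rng[OF that(1)]] by force
    then have "exp (C * 0) * \<nu> 0 \<le> exp (C * z) * \<nu> z"
      using z(1) by (intro grow) auto
    then show False using z(1) \<nu>0 by simp
  qed
  show "\<exists>C\<ge>0. \<forall>s t. 0 \<le> s \<longrightarrow> s \<le> t \<longrightarrow> exp (C * s) * \<nu> s \<le> exp (C * t) * \<nu> t"
    using C(1) grow p by blast
qed

text \<open>Since \<open>f\<close> is antitone, \<open>E\<close> falls at least as fast as \<omega>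
  while it lies above \<omega>. After the last time with \<open>E \<le> \<omega>\<close> the
  difference therefore cannot grow. Monotonicity of \<open>f\<close> does here what a Lipschitz
  condition does in the usual comparison theorem.\<close>

lemma comparison:
  assumes sol: "worst_case_solution r \<phi> \<nu>"
    and E: "\<And>t. t \<ge> 0 \<Longrightarrow> 0 < E t \<and> E t < r"
    and dE: "\<And>t. t \<ge> 0 \<Longrightarrow> (E has_real_derivative E' t) (at t)"
    and le: "\<And>t. t \<ge> 0 \<Longrightarrow> E' t \<le> - (1 / (f (E t))\<^sup>2)"
    and init: "\<phi> (E 0) \<le> \<nu> 0" and "t \<ge> 0"
  shows "\<phi> (E t) \<le> \<nu> t"
proof -
  note p = solution_properties[OF sol]
  define \<omega> where "\<omega> t = \<theta> (\<nu> t)" for t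
  have \<omega>: "0 < \<omega> t" "\<omega> t < r" "\<phi> (\<omega> t) = \<nu> t" if "t \<ge> 0" for t
    using \<theta>_pos[OF p(3) p(2)] \<theta>_range[OF p(3)] \<phi>_\<theta>[OF p(3)] that by (auto simp: \<omega>_def)
  have D: "(\<omega> has_real_derivative - (1 / (f (\<omega> t))\<^sup>2)) (at t within {0..})" if "t \<ge> 0" for t
  proof -
    have "(\<theta> has_real_derivative 1 / f (\<omega> t)) (at (\<nu> t))"
      using \<theta>_der[OF \<omega>(1,2)[OF that]] \<omega>(3)[OF that] by simp
    from DERIV_chain2[OF this solution_derivative[OF sol that p(2)[OF that]]]
    show ?thesis unfolding \<omega>_def by (simp add: power2_eq_square)
  qed
  have cont\<omega>: "continuous_on {0..} \<omega>"
    unfolding continuous_on_eq_continuous_within using D by (auto intro: DERIV_continuous)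
  have contE: "continuous_on {0..} E"
    using dE by (intro continuous_at_imp_continuous_on) (auto intro: DERIV_isCont)
  have "E t \<le> \<omega> t"
  proof (rule ccontr)
    assume n: "\<not> E t \<le> \<omega> t"
    let ?Z = "{x \<in> {0..t}. E x \<le> \<omega> x}"
    have "E 0 \<le> \<omega> 0"
      using init \<phi>_strict_mono[of "\<omega> 0" "E 0"] \<omega>[of 0] E[of 0] by force
    then have "?Z \<noteq> {}" using \<open>t \<ge> 0\<close> by auto
    moreover have "compact ?Z"
    proof -
      have "closed ?Z"
        by (rule continuous_on_closed_Collect_le[OF continuous_on_subset[OF contE]
              continuous_on_subset[OF cont\<omega>] closed_atLeastAtMost]) auto
      then have "compact ({0..t} \<inter> ?Z)" by (intro compact_Int_closed compact_Icc)
      moreover have "{0..t} \<inter> ?Z = ?Z" by blast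
      ultimately show ?thesis by simp
    qed
    ultimately obtain z where z: "z \<in> ?Z" "\<And>x. x \<in> ?Z \<Longrightarrow> x \<le> z"
      using compact_attains_sup[of ?Z] by blast
    have gt: "E x > \<omega> x" if "z < x" "x \<le> t" for x
      using z(2)[of x] z(1) that by force
    have "(\<lambda>x. E x - \<omega> x) z \<ge> (\<lambda>x. E x - \<omega> x) t"
    proof (rule DERIV_nonpos_imp_decreasing_open[of z t])
      have "continuous_on {z..t} E" "continuous_on {z..t} \<omega>"
        using z(1) by (auto intro!: continuous_on_subset[OF contE] continuous_on_subset[OF cont\<omega>])
      then show "continuous_on {z..t} (\<lambda>x. E x - \<omega> x)"
        by (intro continuous_intros)
      fix x assume x: "z < x" "x < t"
      then have x0: "0 < x" using z(1) by auto
      have "(\<omega> has_real_derivative - (1 / (f (\<omega> x))\<^sup>2)) (at x)"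
        using D[of x] x0 at_within_open_subset[of x "{0<..}" "{0..}"]
      less_imp_le[of 0] by (auto simp: subset_iff)
      then have "((\<lambda>x. E x - \<omega> x) has_real_derivative E' x - - (1 / (f (\<omega> x))\<^sup>2)) (at x)"
        using x0 by (intro DERIV_diff dE) auto
      moreover have "E' x - - (1 / (f (\<omega> x))\<^sup>2) \<le> 0"
      proof -
        have "f (E x) \<le> f (\<omega> x)" "0 < f (E x)"
          using gt[of x] x x0 \<omega>[of x] E[of x] by (auto intro!: anti pos)
        then have "1 / (f (\<omega> x))\<^sup>2 \<le> 1 / (f (E x))\<^sup>2"
          by (intro divide_left_mono power_mono mult_pos_pos) auto
        then show ?thesis using le[of x] x0 by simp
      qed
      ultimately show "\<exists>y. ((\<lambda>x. E x - \<omega> x) has_real_derivative y) (at x) \<and> y \<le> 0" by blast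
    qed (use z in auto)
    then show False using z(1) n by auto
  qed
  then show ?thesis
    using \<phi>_strict_mono[of "E t" "\<omega> t"] \<omega>[OF \<open>t \<ge> 0\<close>] E[OF \<open>t \<ge> 0\<close>] by (cases "E t = \<omega> t") auto
qed

text \<open>Separation of variables: \<open>T\<close> is a primitive of the square of
  \<open>f\<close>, and \<omega> solves \<open>T (\<omega> t) = T w0 - t\<close>. By
  \<open>growth\<close>, \<open>T\<close> falls to minus infinity at 0 at least like a logarithm, so
  \<omega> is defined for all times.\<close>

lemma solution_exists: "\<exists>\<nu>. worst_case_solution r \<phi> \<nu>"
proof -
  obtain T where "\<And>s. ereal 0 < ereal s \<Longrightarrow> ereal s < ereal r \<Longrightarrow> (T has_vector_derivative (f s)\<^sup>2) (at s)"
    using einterval_antiderivative[of "ereal 0" "ereal r" "\<lambda>s. (f s)\<^sup>2"] r contf by auto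
  then have T: "(T has_real_derivative (f s)\<^sup>2) (at s)" if "0 < s" "s < r" for s
    using that by (simp add: has_real_derivative_iff_has_vector_derivative)
  have contT: "continuous_on {0<..<r} T"
    by (intro continuous_at_imp_continuous_on ballI DERIV_isCont[OF T]) auto
  have monoT: "T s < T t" if "0 < s" "s < t" "t < r" for s t
  proof (rule DERIV_pos_imp_increasing[OF that(2)])
    fix x assume "s \<le> x" "x \<le> t"
    then show "\<exists>y. DERIV T x :> y \<and> 0 < y" using T[of x] pos[of x] that by (intro exI[of _ "(f x)\<^sup>2"]) auto
  qed
  have injT: "inj_on T {0<..<r}" by (rule linorder_inj_onI) (auto dest: monoT)
  have low: "T s \<le> T b - A\<^sup>2 * (ln b - ln s)" if "0 < s" "s \<le> b" for s
  proof -
    have "(\<lambda>x. T x - A\<^sup>2 * ln x) s \<le> (\<lambda>x. T x - A\<^sup>2 * ln x) b"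
    proof (rule DERIV_nonneg_imp_nondecreasing[OF that(2)])
      fix x assume x: "s \<le> x" "x \<le> b"
      have "((\<lambda>x. T x - A\<^sup>2 * ln x) has_real_derivative (f x)\<^sup>2 - A\<^sup>2 * (1 / x)) (at x)"
        using x that b by (intro DERIV_diff DERIV_cmult T) (auto intro!: derivative_eq_intros)
      moreover have "(A / sqrt x)\<^sup>2 \<le> (f x)\<^sup>2"
        using growth[of x] A x that by (intro power_mono) auto
      then have "(f x)\<^sup>2 - A\<^sup>2 * (1 / x) \<ge> 0" using x that by (simp add: power_divide)
      ultimately show "\<exists>y. ((\<lambda>x. T x - A\<^sup>2 * ln x) has_real_derivative y) (at x) \<and> 0 \<le> y" by blast
    qed
    then show ?thesis by (simp add: algebra_simps)
  qed
  define w0 where "w0 = b"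
  define \<omega> where "\<omega> t = inv_into {0<..<r} T (T w0 - t)" for t
  have \<omega>: "0 < \<omega> t" "\<omega> t < r" "T (\<omega> t) = T w0 - t" if "t \<ge> 0" for t
  proof -
    \<comment> \<open>At this \<open>s\<close> the upper bound \<open>low\<close> for
      \<open>T s\<close> is exactly \<open>T w0 - t\<close>, so the intermediate value theorem
      applies between \<open>s\<close> and \<open>b\<close>.\<close>
    define s where "s = b * exp (- (t / A\<^sup>2))"
    have s: "0 < s" "s \<le> b" using b A that by (auto simp: s_def mult_le_cancel_left2)
    have "ln s = ln b - t / A\<^sup>2" using b by (simp add: s_def ln_mult)
    then have "T s \<le> T w0 - t" using low[OF s] A by (simp add: w0_def)
    then have "\<exists>x\<ge>s. x \<le> b \<and> T x = T w0 - t"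
      by (intro IVT') (use that s b in \<open>auto simp: w0_def intro: continuous_on_subset[OF contT]\<close>)
    then obtain x where "s \<le> x" "x \<le> b" "T x = T w0 - t" by blast
    then have "T w0 - t \<in> T ` {0<..<r}" using s b by (intro image_eqI[of _ T x]) auto
    then show "0 < \<omega> t" "\<omega> t < r" "T (\<omega> t) = T w0 - t"
      using inv_into_into[of "T w0 - t" T "{0<..<r}"] f_inv_into_f[of "T w0 - t" T "{0<..<r}"]
      unfolding \<omega>_def by auto
  qed
  have D\<omega>: "(\<omega> has_real_derivative - (1 / (f (\<omega> t))\<^sup>2)) (at t)" if "t \<ge> 0" for t
  proof -
    note w = \<omega>[OF that]
    have "(inv_into {0<..<r} T has_derivative times (1 / (f (\<omega> t))\<^sup>2)) (at (T (\<omega> t)))"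
    proof (rule has_derivative_inverse_strong[of "{0<..<r}" "\<omega> t" T])
      show "(T has_derivative times ((f (\<omega> t))\<^sup>2)) (at (\<omega> t))"
        using T[OF w(1,2)] by (simp add: has_field_derivative_def)
      show "times ((f (\<omega> t))\<^sup>2) \<circ> times (1 / (f (\<omega> t))\<^sup>2) = id"
        using pos[OF w(1,2)] by (auto simp: fun_eq_iff)
    qed (use w contT inv_into_f_f[OF injT] in auto)
    then have "(inv_into {0<..<r} T has_real_derivative 1 / (f (\<omega> t))\<^sup>2) (at (T w0 - t))"
      using w(3) by (simp add: has_field_derivative_def)
    moreover have "((\<lambda>t. T w0 - t) has_real_derivative -1) (at t)"
      by (auto intro!: derivative_eq_intros)
    ultimately have "((\<lambda>t. inv_into {0<..<r} T (T w0 - t)) has_real_derivative 1 / (f (\<omega> t))\<^sup>2 * -1) (at t)"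
      by (rule DERIV_chain2)
    then show ?thesis unfolding \<omega>_def by simp
  qed
  have "worst_case_solution r \<phi> (\<lambda>t. \<phi> (\<omega> t))"
    unfolding worst_case_solution_def
  proof (intro conjI allI impI)
    show "0 < \<phi> (\<omega> 0)" using \<omega>[of 0] by (intro \<phi>_pos) auto
    fix t :: real assume t: "t \<ge> 0"
    note w = \<omega>[OF t]
    show "\<phi> (\<omega> t) \<in> \<phi> ` {0..<r}" using w by auto
    have "(inv_into {0..<r} \<phi> has_real_derivative 1 / f (\<omega> t)) (at (\<phi> (\<omega> t)) within \<phi> ` {0..<r})"
      using \<theta>_der[OF w(1,2)] unfolding \<theta>_def by (rule has_field_derivative_at_within)
    moreover have "((\<lambda>t. \<phi> (\<omega> t)) has_real_derivative - (1 / f (\<omega> t))) (at t within {0..})"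
    proof -
      have "((\<lambda>t. \<phi> (\<omega> t)) has_real_derivative f (\<omega> t) * - (1 / (f (\<omega> t))\<^sup>2)) (at t)"
        by (rule DERIV_chain2[OF der[OF w(1,2)] D\<omega>[OF t]])
      moreover have "f (\<omega> t) * - (1 / (f (\<omega> t))\<^sup>2) = - (1 / f (\<omega> t))"
        using pos[OF w(1,2)] by (simp add: power2_eq_square)
      ultimately show ?thesis by (simp add: has_field_derivative_at_within)
    qed
    ultimately show "\<exists>d. (inv_into {0..<r} \<phi> has_real_derivative d) (at (\<phi> (\<omega> t)) within \<phi> ` {0..<r}) \<and>
      ((\<lambda>t. \<phi> (\<omega> t)) has_real_derivative - d) (at t within {0..})" by blast
  qed
  then show ?thesis by blast
qed

end

subsection \<open>Damped second-order trajectories\<close>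

text \<open>Beyond \<open>N\<close> the integral of the norm is at most the total drop of \<Phi>,
  which is bounded; monotone convergence over \<open>{0..real k}\<close> then gives
  integrability.\<close>

lemma absolutely_integrable_of_dominating_decay:
  fixes f :: "real \<Rightarrow> 'a::euclidean_space"
  assumes cont: "continuous_on {0..} f" and N: "N > 0"
    and \<Phi>: "\<And>t. t \<ge> N \<Longrightarrow> (\<Phi> has_real_derivative \<Phi>' t) (at t)"
    and le: "\<And>t. t \<ge> N \<Longrightarrow> norm (f t) \<le> - \<Phi>' t" and bdd: "\<And>t. t \<ge> N \<Longrightarrow> L \<le> \<Phi> t"
  shows "f absolutely_integrable_on {0<..}"
proof -
  have contn: "continuous_on {a..b} (\<lambda>t. norm (f t))" if "a \<ge> 0" for a b
    using that by (intro continuous_on_norm continuous_on_subset[OF cont]) auto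
  have int: "(\<lambda>t. norm (f t)) integrable_on {a..b}" if "a \<ge> 0" for a b
    by (rule integrable_continuous_interval[OF contn[OF that]])
  define g where "g k t = (if t \<in> {0..real k} then norm (f t) else 0)" for k t
  have integral_g: "integral {0..} (g k) = integral {0..real k} (\<lambda>t. norm (f t))"
    and int_g: "g k integrable_on {0..}" for k
  proof -
    have "{0..real k} \<inter> {0..} = {0..real k}" by auto
    then show "integral {0..} (g k) = integral {0..real k} (\<lambda>t. norm (f t))"
      and "g k integrable_on {0..}"
      unfolding g_def using integral_restrict_Int[of "{0..}" "{0..real k}" "\<lambda>t. norm (f t)"]
        integrable_restrict_Int[of "{0..real k}" "\<lambda>t. norm (f t)" "{0..}"] int[of 0 "real k"]
      by (auto simp: Int_commute)
  qed
  have bound: "integral {0..real k} (\<lambda>t. norm (f t)) \<le> integral {0..N} (\<lambda>t. norm (f t)) + (\<Phi> N - L)" for k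
  proof (cases "real k \<le> N")
    case True
    then have "integral {0..real k} (\<lambda>t. norm (f t)) \<le> integral {0..N} (\<lambda>t. norm (f t))"
      by (intro integral_subset_le int) auto
    then show ?thesis using bdd[of N] by simp
  next
    case False
    have "integral {0..real k} (\<lambda>t. norm (f t)) =
        integral {0..N} (\<lambda>t. norm (f t)) + integral {N..real k} (\<lambda>t. norm (f t))"
      using False N by (intro Henstock_Kurzweil_Integration.integral_combine[symmetric] int) auto
    moreover have "((\<lambda>t. - \<Phi>' t) has_integral (- \<Phi> (real k) - - \<Phi> N)) {N..real k}"
      using False by (intro fundamental_theorem_of_calculus has_vector_derivative_minus
          has_vector_derivative_at_within[OF \<Phi>[unfolded has_real_derivative_iff_has_vector_derivative]]) auto
    then have "integral {N..real k} (\<lambda>t. norm (f t)) \<le> - \<Phi> (real k) - - \<Phi> N"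
      using le N by (intro has_integral_le[OF integrable_integral[OF int]]) auto
    ultimately show ?thesis using bdd[of "real k"] False by simp
  qed
  have "(\<lambda>t. norm (f t)) integrable_on {0..}"
  proof (rule monotone_convergence_increasing[THEN conjunct1])
    show "g k integrable_on {0..}" for k by (rule int_g)
    show "g k t \<le> g (Suc k) t" for k t by (auto simp: g_def)
    show "(\<lambda>k. g k t) \<longlonglongrightarrow> norm (f t)" if "t \<in> {0..}" for t
    proof (rule tendsto_eventually)
      obtain k0 where "t \<le> real k0" using real_arch_simple by blast
      then show "\<forall>\<^sub>F k in sequentially. g k t = norm (f t)"
        using that by (intro eventually_sequentiallyI[of k0]) (auto simp: g_def)
    qed
    have "0 \<le> integral {0..real k} (\<lambda>t. norm (f t))" for k
      by (intro integral_nonneg int) auto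
    then have "\<bar>integral {0..} (g k)\<bar> \<le> integral {0..N} (\<lambda>t. norm (f t)) + (\<Phi> N - L)" for k
      using bound[of k] by (simp add: integral_g)
    then show "bounded (range (\<lambda>k. integral {0..} (g k)))"
      by (auto simp: bounded_real)
  qed
  moreover have "f \<in> borel_measurable (lebesgue_on {0..})"
    by (intro continuous_imp_measurable_on_sets_lebesgue cont) auto
  ultimately have "f absolutely_integrable_on {0..}"
    by (intro measurable_bounded_by_integrable_imp_absolutely_integrable[where g = "\<lambda>t. norm (f t)"]) auto
  then show ?thesis
    by (rule set_integrable_subset) auto
qed

section \<open>Energy, dissipation and cluster points of a trajectory\<close>

locale heavy_ball =
  fixes \<gamma> :: real and G :: "'a::euclidean_space \<Rightarrow> real" and g :: "'a \<Rightarrow> 'a"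
    and H :: "'a \<Rightarrow> 'a \<Rightarrow>\<^sub>L 'a" and u u' u'' :: "real \<Rightarrow> 'a"
  assumes \<gamma>: "\<gamma> > 0" and grad: "\<And>x. GDERIV G x :> g x"
    and der: "\<And>x. (g has_derivative blinfun_apply (H x)) (at x)" and contH: "continuous_on UNIV H"
    and u: "\<And>t. t \<ge> 0 \<Longrightarrow> (u has_vector_derivative u' t) (at t within {0..})"
    and u': "\<And>t. t \<ge> 0 \<Longrightarrow> (u' has_vector_derivative u'' t) (at t within {0..})"
    and ode: "\<And>t. t \<ge> 0 \<Longrightarrow> u'' t + \<gamma> *\<^sub>R u' t + g (u t) = 0"
    and bdd: "bounded (u ` {0..})"
begin

lemma contg: "continuous_on UNIV g"
  using der by (auto simp: continuous_on_eq_continuous_at intro: has_derivative_continuous)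

lemma contG: "continuous_on UNIV G"
  using grad by (auto simp: continuous_on_eq_continuous_at gderiv_def intro: has_derivative_continuous)

lemma within_pos: "t > 0 \<Longrightarrow> at t within {0..} = at (t::real)"
  by (rule at_within_open_subset[of t "{0<..}"]) auto

lemma u_at: "t > 0 \<Longrightarrow> (u has_vector_derivative u' t) (at t)"
  and u'_at: "t > 0 \<Longrightarrow> (u' has_vector_derivative u'' t) (at t)"
  using u[of t] u'[of t] within_pos[of t] by auto

lemma cont_u: "continuous_on {0..} u" and cont_u': "continuous_on {0..} u'"
  and cont_gu: "continuous_on {0..} (\<lambda>t. g (u t))"
proof -
  show *: "continuous_on {0..} u" and "continuous_on {0..} u'"
    unfolding continuous_on_eq_continuous_within
    using u u' by (auto intro: has_vector_derivative_continuous)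
  show "continuous_on {0..} (\<lambda>t. g (u t))"
    by (rule continuous_on_compose2[OF contg *]) auto
qed

definition D :: "real \<Rightarrow> real" where "D t = (norm (u' t))\<^sup>2 + (norm (g (u t)))\<^sup>2"

definition energy :: "real \<Rightarrow> real \<Rightarrow> real" where
  "energy \<mu> t = (u' t \<bullet> u' t) / 2 + G (u t) + \<mu> * (g (u t) \<bullet> u' t)"

text \<open>Minus the derivative of the energy along the equation, by
  \<open>energy_derivative\<close>. With \<mu> = 0 only the velocity term is lost; the cross term of
  the energy contributes the square of the gradient.\<close>

definition dissipation :: "real \<Rightarrow> real \<Rightarrow> real" where
  "dissipation \<mu> t = \<gamma> * (u' t \<bullet> u' t) - \<mu> * (H (u t) (u' t) \<bullet> u' t)
     + \<mu> * \<gamma> * (g (u t) \<bullet> u' t) + \<mu> * (g (u t) \<bullet> g (u t))"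

lemma energy_derivative:
  assumes "t > 0"
  shows "(energy \<mu> has_real_derivative - dissipation \<mu> t) (at t)"
proof -
  have du: "(u has_derivative (\<lambda>h. h *\<^sub>R u' t)) (at t)" and du': "(u' has_derivative (\<lambda>h. h *\<^sub>R u'' t)) (at t)"
    using u_at[OF assms] u'_at[OF assms] by (simp_all add: has_vector_derivative_def)
  have dG: "((\<lambda>s. G (u s)) has_derivative (\<lambda>h. (h *\<^sub>R u' t) \<bullet> g (u t))) (at t)"
    by (rule has_derivative_compose[OF du grad[unfolded gderiv_def]])
  have dg: "((\<lambda>s. g (u s)) has_derivative (\<lambda>h. H (u t) (h *\<^sub>R u' t))) (at t)"
    by (rule has_derivative_compose[OF du der])
  have u'': "u'' t = - (\<gamma> *\<^sub>R u' t) - g (u t)"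
    using ode[of t] assms by (simp add: algebra_simps eq_neg_iff_add_eq_0)
  have "(energy \<mu> has_derivative (\<lambda>h. ((u' t \<bullet> (h *\<^sub>R u'' t) + (h *\<^sub>R u'' t) \<bullet> u' t)) / 2 + (h *\<^sub>R u' t) \<bullet> g (u t)
      + \<mu> * (g (u t) \<bullet> (h *\<^sub>R u'' t) + H (u t) (h *\<^sub>R u' t) \<bullet> u' t))) (at t)"
    unfolding energy_def[abs_def]
    by (intro has_derivative_add bounded_linear.has_derivative[OF bounded_linear_divide] has_derivative_mult_right has_derivative_inner du' dG dg)
  then have "(energy \<mu> has_derivative times (- dissipation \<mu> t)) (at t)"
    by (rule has_derivative_eq_rhs)
      (simp add: fun_eq_iff dissipation_def u'' blinfun.scaleR_right inner_diff_right inner_diff_left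
        inner_commute field_simps)
  then show ?thesis by (simp add: has_field_derivative_def)
qed

lemma lyapunov:
  obtains \<mu> \<alpha> C B where "\<alpha> > 0" "C > 0"
    "\<And>t. t > 0 \<Longrightarrow> \<alpha> * D t \<le> dissipation \<mu> t \<and> \<bar>energy \<mu> t - G (u t)\<bar> \<le> C * D t \<and> B \<le> energy \<mu> t"
proof -
  obtain R where R: "\<And>t. t \<ge> 0 \<Longrightarrow> norm (u t) \<le> R"
    using bdd unfolding bounded_iff by auto
  have bnd: "\<exists>B>0. \<forall>t\<ge>0. norm (h (u t)) \<le> B" if "continuous_on UNIV h" for h :: "'a \<Rightarrow> 'b::real_normed_vector"
  proof -
    have "compact (h ` cball 0 R)"
      by (intro compact_continuous_image continuous_on_subset[OF that]) auto
    then obtain B where "B > 0" "\<forall>y\<in>h ` cball 0 R. norm y \<le> B"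
      using compact_imp_bounded bounded_pos by metis
    then show ?thesis using R by (intro exI[of _ B]) auto
  qed
  obtain M where M: "M > 0" "\<And>t. t \<ge> 0 \<Longrightarrow> norm (H (u t)) \<le> M" using bnd[OF contH] by blast
  obtain M1 where M1: "M1 > 0" "\<And>t. t \<ge> 0 \<Longrightarrow> norm (g (u t)) \<le> M1" using bnd[OF contg] by blast
  obtain M0 where M0: "M0 > 0" "\<And>t. t \<ge> 0 \<Longrightarrow> \<bar>G (u t)\<bar> \<le> M0" using bnd[OF contG] by force
  \<comment> \<open>Bounding the Hessian term by \<open>M\<close> and the mixed term by Young's
    inequality costs \<open>\<mu> * (M + \<gamma>\<^sup>2 / 2) * v\<^sup>2\<close> and half of
    \<open>\<mu> * q\<^sup>2\<close>. This \<mu> makes the first loss exactly half of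
    \<open>\<gamma> * v\<^sup>2\<close>.\<close>
  define \<mu> where "\<mu> = \<gamma> / (2 * M + \<gamma>\<^sup>2)"
  have \<mu>: "\<mu> > 0" "\<mu> * (2 * M + \<gamma>\<^sup>2) = \<gamma>"
  proof -
    have "2 * M + \<gamma>\<^sup>2 > 0" using M(1) by (simp add: add_pos_nonneg)
    then show "\<mu> > 0" "\<mu> * (2 * M + \<gamma>\<^sup>2) = \<gamma>" using \<gamma> by (simp_all add: \<mu>_def)
  qed
  show thesis
  proof (rule that[of "min (\<gamma> / 2) (\<mu> / 2)" "1 + \<mu>" \<mu> "- M0 - \<mu>\<^sup>2 * M1\<^sup>2 / 2"])
    fix t :: real assume t: "t > 0"
    define v q where "v = norm (u' t)" and "q = norm (g (u t))"
    have vq: "u' t \<bullet> u' t = v\<^sup>2" "g (u t) \<bullet> g (u t) = q\<^sup>2" "v \<ge> 0" "q \<ge> 0"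
      by (simp_all add: v_def q_def power2_norm_eq_inner)
    have i: "\<bar>g (u t) \<bullet> u' t\<bar> \<le> q * v"
      unfolding v_def q_def by (rule Cauchy_Schwarz_ineq2)
    have h: "\<bar>H (u t) (u' t) \<bullet> u' t\<bar> \<le> M * v\<^sup>2"
    proof -
      have "\<bar>H (u t) (u' t) \<bullet> u' t\<bar> \<le> norm (H (u t) (u' t)) * v"
        unfolding v_def by (rule Cauchy_Schwarz_ineq2)
      also have "\<dots> \<le> (norm (H (u t)) * v) * v"
        unfolding v_def by (intro mult_right_mono norm_blinfun) auto
      also have "\<dots> \<le> (M * v) * v" using M(2)[of t] t vq by (intro mult_right_mono) auto
      finally show ?thesis by (simp add: power2_eq_square)
    qed
    have y1: "2 * (\<gamma> * v) * q \<le> (\<gamma> * v)\<^sup>2 + q\<^sup>2" and y2: "2 * q * v \<le> q\<^sup>2 + v\<^sup>2"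
      and y3: "2 * (\<mu> * q) * v \<le> (\<mu> * q)\<^sup>2 + v\<^sup>2"
      by (rule sum_squares_bound)+
    have "\<gamma> * \<bar>g (u t) \<bullet> u' t\<bar> \<le> \<gamma> * (q * v)" using i \<gamma> by (intro mult_left_mono) auto
    then have "\<gamma> * \<bar>g (u t) \<bullet> u' t\<bar> \<le> ((\<gamma> * v)\<^sup>2 + q\<^sup>2) / 2" using y1 by (simp add: mult_ac)
    then have "\<mu> * (\<gamma> * \<bar>g (u t) \<bullet> u' t\<bar>) \<le> \<mu> * (((\<gamma> * v)\<^sup>2 + q\<^sup>2) / 2)"
      using \<mu> by (intro mult_left_mono) auto
    moreover have "\<mu> * \<bar>H (u t) (u' t) \<bullet> u' t\<bar> \<le> \<mu> * (M * v\<^sup>2)"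
      using h \<mu> by (intro mult_left_mono) auto
    moreover have "\<bar>\<mu> * \<gamma> * (g (u t) \<bullet> u' t)\<bar> = \<mu> * (\<gamma> * \<bar>g (u t) \<bullet> u' t\<bar>)"
      "\<bar>\<mu> * (H (u t) (u' t) \<bullet> u' t)\<bar> = \<mu> * \<bar>H (u t) (u' t) \<bullet> u' t\<bar>"
      using \<gamma> \<mu> by (simp_all add: abs_mult)
    ultimately have "dissipation \<mu> t \<ge> \<gamma> * v\<^sup>2 - \<mu> * (M * v\<^sup>2) - \<mu> * (((\<gamma> * v)\<^sup>2 + q\<^sup>2) / 2) + \<mu> * q\<^sup>2"
      unfolding dissipation_def vq(1,2) by linarith
    also have "\<gamma> * v\<^sup>2 - \<mu> * (M * v\<^sup>2) - \<mu> * (((\<gamma> * v)\<^sup>2 + q\<^sup>2) / 2) + \<mu> * q\<^sup>2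
        = \<gamma> * v\<^sup>2 - (\<mu> * (2 * M + \<gamma>\<^sup>2)) / 2 * v\<^sup>2 + \<mu> / 2 * q\<^sup>2"
      by (simp add: field_simps power_mult_distrib)
    also have "\<dots> = \<gamma> / 2 * v\<^sup>2 + \<mu> / 2 * q\<^sup>2" unfolding \<mu>(2) by simp
    finally have "dissipation \<mu> t \<ge> \<gamma> / 2 * v\<^sup>2 + \<mu> / 2 * q\<^sup>2" .
    moreover have "min (\<gamma> / 2) (\<mu> / 2) * v\<^sup>2 \<le> \<gamma> / 2 * v\<^sup>2" "min (\<gamma> / 2) (\<mu> / 2) * q\<^sup>2 \<le> \<mu> / 2 * q\<^sup>2"
      by (intro mult_right_mono; simp)+
    ultimately have d: "min (\<gamma> / 2) (\<mu> / 2) * D t \<le> dissipation \<mu> t"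
      by (simp add: D_def distrib_left flip: v_def q_def)
    have "\<mu> * \<bar>g (u t) \<bullet> u' t\<bar> \<le> \<mu> * (q * v)" using i \<mu> by (intro mult_left_mono) auto
    then have li: "\<bar>\<mu> * (g (u t) \<bullet> u' t)\<bar> \<le> \<mu> * (q * v)" using \<mu> by (simp add: abs_mult)
    have "\<mu> * (2 * q * v) \<le> \<mu> * (q\<^sup>2 + v\<^sup>2)" using y2 \<mu> by (intro mult_left_mono) auto
    moreover have "0 \<le> \<mu> * (q\<^sup>2 + v\<^sup>2)" using \<mu> by auto
    ultimately have "v\<^sup>2 / 2 + \<mu> * (q * v) \<le> (1 + \<mu>) * (v\<^sup>2 + q\<^sup>2)"
      by (simp add: algebra_simps) (use zero_le_power2[of q] zero_le_power2[of v] in linarith)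
    then have e: "\<bar>energy \<mu> t - G (u t)\<bar> \<le> (1 + \<mu>) * D t"
      using li unfolding energy_def vq D_def v_def[symmetric] q_def[symmetric]
      by (simp add: abs_le_iff) (use zero_le_power2[of v] in linarith)
    \<comment> \<open>By \<open>y3\<close> the kinetic energy absorbs the cross term, so the lower
      bound involves only the bounded quantities \<open>G (u t)\<close> and
      \<open>g (u t)\<close>.\<close>
    have "(\<mu> * q)\<^sup>2 \<le> \<mu>\<^sup>2 * M1\<^sup>2"
      unfolding power_mult_distrib using M1(2)[of t] t by (intro mult_left_mono power_mono) (auto simp: q_def)
    then have "- M0 - \<mu>\<^sup>2 * M1\<^sup>2 / 2 \<le> energy \<mu> t"
      using li y3 M0(2)[of t] t unfolding energy_def vq by (simp add: abs_le_iff)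
    with d e show "min (\<gamma> / 2) (\<mu> / 2) * D t \<le> dissipation \<mu> t \<and>
      \<bar>energy \<mu> t - G (u t)\<bar> \<le> (1 + \<mu>) * D t \<and> - M0 - \<mu>\<^sup>2 * M1\<^sup>2 / 2 \<le> energy \<mu> t" by blast
  qed (use \<gamma> \<mu> in auto)
qed

lemma D_nonneg: "D t \<ge> 0"
  by (simp add: D_def)

text \<open>The energy is nonincreasing and bounded below, so \<open>D\<close> cannot stay away from
  0; along times where it tends to 0 the bounded trajectory clusters at some \<open>a\<close>.
  \<open>D\<close> controls both the gradient and the distance of the energy from
  \<open>G (u t)\<close>. Hence \<open>a\<close> is critical, and \<open>G a\<close> is the limit of
  the monotone energy over all times.\<close>

lemma cluster_point:
  assumes \<alpha>: "\<alpha> > 0" and C: "C > 0"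
    and dis: "\<And>t. t > 0 \<Longrightarrow> \<alpha> * D t \<le> dissipation \<mu> t \<and> \<bar>energy \<mu> t - G (u t)\<bar> \<le> C * D t \<and> B \<le> energy \<mu> t"
  obtains a where "g a = 0" "\<And>t. t > 0 \<Longrightarrow> G a \<le> energy \<mu> t"
    "(energy \<mu> \<longlongrightarrow> G a) at_top" "\<And>\<epsilon> T. \<epsilon> > 0 \<Longrightarrow> \<exists>t\<ge>T. norm (u t - a) < \<epsilon>"
proof -
  define E where "E = energy \<mu>"
  have dec: "E t + \<alpha> * c * (t - s) \<le> E s"
    if st: "0 < s" "s \<le> t" and c: "\<And>x. s \<le> x \<Longrightarrow> x \<le> t \<Longrightarrow> c \<le> D x" for s t c
  proof -
    have "(\<lambda>x. E x + \<alpha> * c * x) s \<ge> (\<lambda>x. E x + \<alpha> * c * x) t"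
    proof (rule DERIV_nonpos_imp_nonincreasing[OF st(2)])
      fix x assume x: "s \<le> x" "x \<le> t"
      have "((\<lambda>x. E x + \<alpha> * c * x) has_real_derivative - dissipation \<mu> x + \<alpha> * c) (at x)"
        unfolding E_def using x st by (auto intro!: derivative_eq_intros energy_derivative)
      moreover have "\<alpha> * c \<le> \<alpha> * D x" using c[OF x] \<alpha> by (intro mult_left_mono) auto
      then have "- dissipation \<mu> x + \<alpha> * c \<le> 0" using dis[of x] x st by auto
      ultimately show "\<exists>y. ((\<lambda>x. E x + \<alpha> * c * x) has_real_derivative y) (at x) \<and> y \<le> 0" by blast
    qed
    then show ?thesis by (simp add: algebra_simps)
  qed
  have anti: "E t \<le> E s" if "0 < s" "s \<le> t" for s t
    using dec[OF that, of 0] D_nonneg by simp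
  define l where "l = Inf (E ` {0<..})"
  have bb: "bdd_below (E ` {0<..})"
    using dis unfolding E_def by (intro bdd_belowI[of _ B]) auto
  have l: "l \<le> E t" if "t > 0" for t
    unfolding l_def using that by (intro cInf_lower bb) auto
  have lim: "(E \<longlongrightarrow> l) at_top"
  proof (rule order_tendstoI)
    fix y assume "y < l"
    then have "y < E t" if "1 \<le> t" for t using l[of t] that by simp
    then show "\<forall>\<^sub>F t in at_top. y < E t" by (rule eventually_at_top_linorderI)
  next
    fix y assume "l < y"
    then obtain s where s: "s > 0" "E s < y"
      using cInf_lessD[of "E ` {0<..}" y] unfolding l_def by auto
    then have "E t < y" if "s \<le> t" for t using anti[of s t] that by simp
    then show "\<forall>\<^sub>F t in at_top. E t < y" by (rule eventually_at_top_linorderI)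
  qed
  have "\<exists>t\<ge>real (Suc n). D t < 1 / real (Suc n)" for n
  proof (rule ccontr)
    assume "\<not> ?thesis"
    then have n: "D t \<ge> 1 / real (Suc n)" if "t \<ge> real (Suc n)" for t
      using that by (metis not_less)
    define c where "c = 1 / real (Suc n)"
    have c: "c > 0" by (simp add: c_def)
    \<comment> \<open>After this much time with \<open>D\<close> at least \<open>c\<close> the
      energy would be at least 1 below its infimum \<open>l\<close>.\<close>
    define t where "t = real (Suc n) + (E (real (Suc n)) - l + 1) / (\<alpha> * c)"
    have "E (real (Suc n)) \<ge> l" by (intro l) simp
    then have t: "t \<ge> real (Suc n)" using \<alpha> c by (simp add: t_def)
    have "E t + \<alpha> * c * (t - real (Suc n)) \<le> E (real (Suc n))"
      using n t by (intro dec) (auto simp: c_def)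
    moreover have "\<alpha> * c * (t - real (Suc n)) = E (real (Suc n)) - l + 1"
      using \<alpha> c by (simp add: t_def)
    ultimately show False using l[of t] t by simp
  qed
  then obtain \<tau> where \<tau>: "\<And>n. \<tau> n \<ge> real (Suc n)" "\<And>n. D (\<tau> n) < 1 / real (Suc n)" by metis
  have "bounded (range (u \<circ> \<tau>))"
    using bounded_subset[OF bdd, of "range (u \<circ> \<tau>)"] order_trans[OF of_nat_0_le_iff \<tau>(1)] by auto
  then obtain a \<rho> where \<rho>: "strict_mono \<rho>" and a: "((u \<circ> \<tau>) \<circ> \<rho>) \<longlonglongrightarrow> a"
    using bounded_imp_convergent_subsequence by blast
  define \<sigma> where "\<sigma> n = \<tau> (\<rho> n)" for n
  have \<sigma>a: "(\<lambda>n. u (\<sigma> n)) \<longlonglongrightarrow> a" using a by (simp add: \<sigma>_def o_def)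
  have \<sigma>ge: "\<sigma> n \<ge> real (Suc n)" for n
    using \<tau>(1)[of "\<rho> n"] seq_suble[OF \<rho>, of n] unfolding \<sigma>_def by simp
  have \<sigma>top: "filterlim \<sigma> at_top sequentially"
    by (rule filterlim_at_top_mono[OF filterlim_real_sequentially])
      (auto intro!: always_eventually order_trans[OF _ \<sigma>ge])
  have D0: "(\<lambda>n. D (\<sigma> n)) \<longlonglongrightarrow> 0"
  proof (rule tendsto_sandwich[OF _ _ tendsto_const])
    show "(\<lambda>n. 1 / real (Suc n)) \<longlonglongrightarrow> 0" using LIMSEQ_inverse_real_of_nat by (simp add: inverse_eq_divide)
    show "\<forall>\<^sub>F n in sequentially. D (\<sigma> n) \<le> 1 / real (Suc n)"
    proof (rule always_eventually, rule)
      fix n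
      have "1 / real (Suc (\<rho> n)) \<le> 1 / real (Suc n)"
        using seq_suble[OF \<rho>, of n] by (intro divide_left_mono) auto
      then show "D (\<sigma> n) \<le> 1 / real (Suc n)" using \<tau>(2)[of "\<rho> n"] unfolding \<sigma>_def by linarith
    qed
  qed (simp add: D_nonneg)
  have "(\<lambda>n. (norm (g (u (\<sigma> n))))\<^sup>2) \<longlonglongrightarrow> 0"
    by (rule tendsto_sandwich[OF _ _ tendsto_const D0]) (auto simp: D_def)
  moreover have "(\<lambda>n. (norm (g (u (\<sigma> n))))\<^sup>2) \<longlonglongrightarrow> (norm (g a))\<^sup>2"
    using contg \<sigma>a by (intro tendsto_intros isCont_tendsto_compose[of a g]) (auto simp: continuous_on_eq_continuous_at)
  ultimately have "(norm (g a))\<^sup>2 = 0" by (rule LIMSEQ_unique[symmetric])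
  then have ga: "g a = 0" by simp
  have "(\<lambda>n. E (\<sigma> n) - G (u (\<sigma> n))) \<longlonglongrightarrow> 0"
  proof (rule Lim_null_comparison)
    show "(\<lambda>n. C * D (\<sigma> n)) \<longlonglongrightarrow> 0" using tendsto_mult_right_zero[OF D0] .
    have "norm (E (\<sigma> n) - G (u (\<sigma> n))) \<le> C * D (\<sigma> n)" for n
      using dis[of "\<sigma> n"] \<sigma>ge[of n] unfolding E_def by simp
    then show "\<forall>\<^sub>F n in sequentially. norm (E (\<sigma> n) - G (u (\<sigma> n))) \<le> C * D (\<sigma> n)"
      by (rule always_eventually[OF allI])
  qed
  moreover have "(\<lambda>n. E (\<sigma> n) - G (u (\<sigma> n))) \<longlonglongrightarrow> l - G a"
    using contG \<sigma>a
    by (intro tendsto_diff filterlim_compose[OF lim \<sigma>top] isCont_tendsto_compose[of a G])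
      (auto simp: continuous_on_eq_continuous_at)
  ultimately have "l - G a = 0" by (rule LIMSEQ_unique[symmetric])
  then have Ga: "G a = l" by simp
  show thesis
  proof (rule that[OF ga])
    show "\<exists>t\<ge>T. norm (u t - a) < \<epsilon>" if "\<epsilon> > 0" for \<epsilon> T :: real
    proof -
      have "\<forall>\<^sub>F n in sequentially. dist (u (\<sigma> n)) a < \<epsilon>" using \<sigma>a that by (rule tendstoD)
      moreover have "\<forall>\<^sub>F n in sequentially. T \<le> \<sigma> n" using \<sigma>top by (simp add: filterlim_at_top)
      ultimately have "\<forall>\<^sub>F n in sequentially. dist (u (\<sigma> n)) a < \<epsilon> \<and> T \<le> \<sigma> n" by eventually_elim simp
      then obtain n where "dist (u (\<sigma> n)) a < \<epsilon> \<and> T \<le> \<sigma> n"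
        using eventually_happens'[OF sequentially_bot] by blast
      then show ?thesis unfolding dist_norm by blast
    qed
  qed (use l lim in \<open>auto simp: Ga E_def\<close>)
qed

text \<open>\<open>least\<close> is available only near \<open>a\<close>, while staying near
  \<open>a\<close> is what has to be shown. So \<open>travel\<close> bounds the displacement as long
  as the trajectory is near, and at a late time close to \<open>a\<close> this bound excludes a
  first exit (\<open>trap\<close>). The alternative in the conclusion singles out motion that stops
  at \<open>a\<close> in finite time, where \<phi> would have to be differentiated at 0.\<close>

lemma trajectory_decay:
  fixes \<phi> f \<psi> :: "real \<Rightarrow> real"
  assumes \<alpha>: "\<alpha> > 0" and C: "C > 0"
    and dis: "\<And>t. t > 0 \<Longrightarrow> \<alpha> * D t \<le> dissipation \<mu> t \<and> \<bar>energy \<mu> t - G (u t)\<bar> \<le> C * D t"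
    and low: "\<And>t. t > 0 \<Longrightarrow> G a \<le> energy \<mu> t" and lim: "(energy \<mu> \<longlongrightarrow> G a) at_top"
    and cluster: "\<And>\<epsilon> T. \<epsilon> > 0 \<Longrightarrow> \<exists>t\<ge>T. norm (u t - a) < \<epsilon>"
    and cont\<phi>: "continuous_on {0..<r} \<phi>" and \<phi>0: "\<phi> 0 = 0" and \<phi>nn: "\<And>s. 0 \<le> s \<Longrightarrow> s < r \<Longrightarrow> 0 \<le> \<phi> s"
    and der\<phi>: "\<And>s. 0 < s \<Longrightarrow> s < r \<Longrightarrow> (\<phi> has_real_derivative f s) (at s)"
    and b: "b > 0" "b \<le> r" and \<eta>: "\<eta> > 0" and \<beta>: "\<beta> > 0" and K: "K > 0"
    and \<psi>: "\<And>s. 0 < s \<Longrightarrow> s < b \<Longrightarrow>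
      0 < \<psi> s \<and> \<psi> (2 * s) \<le> 4 * \<psi> s \<and> \<psi> s \<le> K * sqrt s \<and> \<beta> / \<psi> s \<le> f s"
    and mono: "\<And>s t. 0 < s \<Longrightarrow> s \<le> t \<Longrightarrow> t < b \<Longrightarrow> \<psi> s \<le> \<psi> t"
    and least: "\<And>y. norm (y - a) \<le> \<eta> \<Longrightarrow> 0 < \<bar>G y - G a\<bar> \<Longrightarrow> \<bar>G y - G a\<bar> < b \<Longrightarrow>
      \<psi> \<bar>G y - G a\<bar> \<le> norm (g y)"
  obtains N \<kappa> c where "N > 0" "\<kappa> > 0" "c > 0" "((\<lambda>t. \<phi> (energy \<mu> t - G a)) \<longlongrightarrow> 0) at_top"
    "\<And>t. t \<ge> N \<Longrightarrow> energy \<mu> t - G a < r \<and> norm (u t - a) \<le> \<kappa> * \<phi> (energy \<mu> t - G a)"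
    "(\<forall>t\<ge>N. u t = a \<and> D t = 0) \<or>
     (\<forall>t\<ge>N. 0 < energy \<mu> t - G a \<and>
        sqrt (D t) \<le> \<kappa> * (f (energy \<mu> t - G a) * dissipation \<mu> t) \<and>
        c / (f (energy \<mu> t - G a))\<^sup>2 \<le> dissipation \<mu> t)"
proof -
  define e where "e t = energy \<mu> t - G a" for t
  have de: "(e has_real_derivative - dissipation \<mu> t) (at t)" if "t > 0" for t
    unfolding e_def using energy_derivative[OF that] by (auto intro!: derivative_eq_intros)
  have e0: "e t \<ge> 0" if "t > 0" for t using low[OF that] by (simp add: e_def)
  have dnn: "dissipation \<mu> t \<ge> 0" if "t > 0" for t
    using dis[OF that] mult_nonneg_nonneg[of \<alpha> "D t"] \<alpha> D_nonneg[of t] by linarith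
  have anti: "e t \<le> e s" if "0 < s" "s \<le> t" for s t
  proof (rule DERIV_nonpos_imp_nonincreasing[OF that(2)])
    fix x assume "s \<le> x" "x \<le> t"
    then show "\<exists>y. (e has_real_derivative y) (at x) \<and> y \<le> 0"
      using de[of x] dnn[of x] that by (intro exI[of _ "- dissipation \<mu> x"]) auto
  qed
  have elim: "(e \<longlongrightarrow> 0) at_top"
    unfolding e_def using tendsto_diff[OF lim tendsto_const[of "G a"]] by simp
  have \<phi>lim: "((\<lambda>t. \<phi> (e t)) \<longlongrightarrow> 0) at_top"
  proof -
    have "\<forall>\<^sub>F t in at_top. e t < r \<and> 0 < t"
      using order_tendstoD(2)[OF elim, of r] b eventually_gt_at_top[of 0] by (auto intro: eventually_conj)
    then have "\<forall>\<^sub>F t in at_top. e t \<in> {0..<r}" by eventually_elim (use e0 in auto)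
    then have "((\<lambda>t. \<phi> (e t)) \<longlongrightarrow> \<phi> 0) at_top"
      using b by (intro continuous_on_tendsto_compose[OF cont\<phi> elim]) auto
    then show ?thesis using \<phi>0 by simp
  qed
  show thesis
  proof (cases "\<exists>t0>0. e t0 = 0")
    case True
    then obtain t0 where t0: "t0 > 0" "e t0 = 0" by blast
    \<comment> \<open>Once the energy has reached its limit the dissipation vanishes, so the motion
      has stopped, and it can only have stopped at the cluster point.\<close>
    have z: "e t = 0" if "t \<ge> t0" for t using anti[of t0 t] e0[of t] t0 that by simp
    have D0: "D t = 0" if "t > t0" for t
    proof -
      have "(e has_real_derivative 0) (at t)"
        by (rule has_field_derivative_transform_within_open[of "\<lambda>_. 0" _ _ "{t0<..}"])
          (use that z in auto)
      then have "dissipation \<mu> t = 0" using DERIV_unique[OF de[of t], of 0] that t0 by simp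
      then have "\<alpha> * D t \<le> 0" using dis[of t] that t0 by simp
      then show ?thesis using \<alpha> D_nonneg[of t] by (simp add: mult_le_0_iff)
    qed
    have const: "u s = u t" if "t0 < s" "s \<le> t" for s t
    proof (rule has_derivative_zero_unique[of "{s..t}"])
      show "(u has_derivative (\<lambda>h. 0)) (at x within {s..t})" if x: "x \<in> {s..t}" for x
      proof -
        have "u' x = 0" using D0[of x] x \<open>t0 < s\<close> by (simp add: D_def add_nonneg_eq_0_iff)
        then show ?thesis
          using u_at[of x] x \<open>t0 < s\<close> t0 by (simp add: has_vector_derivative_def has_derivative_at_withinI)
      qed
    qed (use that in auto)
    have ua: "u t = a" if "t > t0" for t
    proof (rule ccontr)
      assume "u t \<noteq> a"
      then obtain s where "s \<ge> t" "norm (u s - a) < norm (u t - a)" using cluster[of "norm (u t - a)" t] by auto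
      then show False using const[of t s] that by simp
    qed
    show thesis
    proof (rule that[of "t0 + 1" 1 1])
      show "energy \<mu> t - G a < r \<and> norm (u t - a) \<le> 1 * \<phi> (energy \<mu> t - G a)" if "t \<ge> t0 + 1" for t
        using z[of t] ua[of t] that b \<phi>0 by (simp add: e_def)
      show "(\<forall>t\<ge>t0 + 1. u t = a \<and> D t = 0) \<or> (\<forall>t\<ge>t0 + 1. 0 < energy \<mu> t - G a \<and>
        sqrt (D t) \<le> 1 * (f (energy \<mu> t - G a) * dissipation \<mu> t) \<and>
        1 / (f (energy \<mu> t - G a))\<^sup>2 \<le> dissipation \<mu> t)"
        using ua D0 by simp
    qed (use t0 \<phi>lim in \<open>auto simp: e_def\<close>)
  next
    case False
    then have epos: "e t > 0" if "t > 0" for t using e0[OF that] that by force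
    have "isCont G a" using contG by (simp add: continuous_on_eq_continuous_at)
    then obtain \<delta>0 where \<delta>0: "\<delta>0 > 0" "\<And>y. dist y a < \<delta>0 \<Longrightarrow> dist (G y) (G a) < b"
      using b(1) unfolding continuous_at_eps_delta by blast
    define \<delta> where "\<delta> = min \<eta> (\<delta>0 / 2)"
    have \<delta>: "\<delta> > 0" "\<delta> \<le> \<eta>" "\<delta> < \<delta>0" using \<eta> \<delta>0 by (auto simp: \<delta>_def)
    \<comment> \<open>One entry for each case of \<open>key\<close>. If \<open>G (u t)\<close>
      accounts for at most half of the gap \<open>e t\<close>, then
      \<open>e t \<le> 2 * C * D t\<close>, and \<psi> is bounded by \<open>K\<close> times a square
      root. Otherwise doubling leads from \<open>e t\<close> down to the level of
      \<open>G (u t)\<close>, where \<open>least\<close> applies; its factor 4 is squared.\<close>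
    define c1 where "c1 = min (1 / (2 * C * K\<^sup>2)) (1 / 16)"
    have c1: "c1 > 0" "c1 \<le> 1 / (2 * C * K\<^sup>2)" "c1 \<le> 1 / 16" using C K by (auto simp: c1_def)
    have key: "c1 * (\<psi> (e t))\<^sup>2 \<le> D t" if t: "t > 0" "norm (u t - a) \<le> \<delta>" "e t < b" for t
    proof -
      let ?s = "\<bar>G (u t) - G a\<bar>"
      have s: "?s < b" using \<delta>0(2)[of "u t"] t \<delta> by (simp add: dist_norm)
      note p = \<psi>[OF epos[OF t(1)] t(3)]
      show ?thesis
      proof (cases "?s \<le> e t / 2")
        case True
        have "e t \<le> ?s + C * D t" using conjunct2[OF dis[OF t(1)]] unfolding e_def by linarith
        then have "e t \<le> 2 * C * D t" using True by simp
        have "(\<psi> (e t))\<^sup>2 \<le> (K * sqrt (e t))\<^sup>2" using p by (intro power_mono) auto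
        also have "\<dots> = K\<^sup>2 * e t" using epos[OF t(1)] by (simp add: power_mult_distrib)
        also have "\<dots> \<le> K\<^sup>2 * (2 * C * D t)" using \<open>e t \<le> 2 * C * D t\<close> by (intro mult_left_mono) auto
        finally have "(\<psi> (e t))\<^sup>2 \<le> (2 * C * K\<^sup>2) * D t" by (simp add: mult_ac)
        then have "1 / (2 * C * K\<^sup>2) * (\<psi> (e t))\<^sup>2 \<le> D t" using C K by (simp add: field_simps)
        moreover have "c1 * (\<psi> (e t))\<^sup>2 \<le> 1 / (2 * C * K\<^sup>2) * (\<psi> (e t))\<^sup>2" by (intro mult_right_mono c1) auto
        ultimately show ?thesis by linarith
      next
        case False
        have "e t / 2 > 0" using epos[OF t(1)] by simp
        have "\<psi> (e t) \<le> 4 * \<psi> (e t / 2)" using \<psi>[of "e t / 2"] \<open>e t / 2 > 0\<close> t(3) by simp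
        also have "\<psi> (e t / 2) \<le> \<psi> ?s" using False \<open>e t / 2 > 0\<close> s by (intro mono) auto
        also have "\<psi> ?s \<le> norm (g (u t))" using False \<open>e t / 2 > 0\<close> s t \<delta> by (intro least) auto
        finally have "(\<psi> (e t))\<^sup>2 \<le> (4 * norm (g (u t)))\<^sup>2" using p by (intro power_mono) auto
        then have "1 / 16 * (\<psi> (e t))\<^sup>2 \<le> (norm (g (u t)))\<^sup>2" by (simp add: power_mult_distrib)
        also have "\<dots> \<le> D t" by (simp add: D_def)
        finally have "1 / 16 * (\<psi> (e t))\<^sup>2 \<le> D t" .
        moreover have "c1 * (\<psi> (e t))\<^sup>2 \<le> 1 / 16 * (\<psi> (e t))\<^sup>2" by (intro mult_right_mono c1) auto
        ultimately show ?thesis by linarith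
      qed
    qed
    \<comment> \<open>Collects the constants of three bounds at the gap \<open>e t\<close>:
      \<open>sqrt c1 * \<psi> \<le> sqrt D\<close>, \<open>\<beta> / \<psi> \<le> f\<close> and
      \<open>\<alpha> * D \<le> dissipation\<close>.\<close>
    define \<kappa> where "\<kappa> = 1 / (\<alpha> * \<beta> * sqrt c1)"
    have \<kappa>: "\<kappa> > 0" using \<alpha> \<beta> c1 by (simp add: \<kappa>_def)
    have speed: "sqrt (D t) \<le> \<kappa> * (f (e t) * dissipation \<mu> t) \<and> \<alpha> * c1 * \<beta>\<^sup>2 / (f (e t))\<^sup>2 \<le> dissipation \<mu> t"
      if t: "t > 0" "norm (u t - a) \<le> \<delta>" "e t < b" for t
    proof
      note p = \<psi>[OF epos[OF t(1)] t(3)]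
      have "sqrt c1 * \<psi> (e t) = sqrt (c1 * (\<psi> (e t))\<^sup>2)" using p by (simp add: real_sqrt_mult)
      also have "\<dots> \<le> sqrt (D t)" using key[OF t] by simp
      finally have sq: "sqrt c1 * \<psi> (e t) \<le> sqrt (D t)" .
      have "sqrt c1 * \<psi> (e t) * sqrt (D t) \<le> sqrt (D t) * sqrt (D t)"
        using sq D_nonneg by (intro mult_right_mono) auto
      then have "sqrt c1 * \<psi> (e t) * sqrt (D t) \<le> D t" using D_nonneg by simp
      then have "sqrt (D t) \<le> D t / (sqrt c1 * \<psi> (e t))"
        using p c1 by (simp add: pos_le_divide_eq mult_ac)
      also have "\<dots> = \<kappa> * (\<beta> / \<psi> (e t) * (\<alpha> * D t))"
        using \<alpha> \<beta> c1 p by (simp add: \<kappa>_def field_simps)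
      also have "\<dots> \<le> \<kappa> * (f (e t) * dissipation \<mu> t)"
      proof (intro mult_left_mono mult_mono)
        have "0 < \<beta> / \<psi> (e t)" using \<beta> p by simp
        then show "0 \<le> f (e t)" using p by linarith
      qed (use p dis[OF t(1)] \<alpha> D_nonneg \<kappa> in auto)
      finally show "sqrt (D t) \<le> \<kappa> * (f (e t) * dissipation \<mu> t)" .
      have "0 < \<beta> / \<psi> (e t)" using \<beta> p by simp
      then have "f (e t) > 0" using p by linarith
      have "0 < \<psi> (e t)" "\<beta> / \<psi> (e t) \<le> f (e t)" using p by blast+
      then have "\<beta> / f (e t) \<le> \<psi> (e t)"
        using \<open>f (e t) > 0\<close> by (simp add: pos_divide_le_eq mult.commute)
      then have "(\<beta> / f (e t))\<^sup>2 \<le> (\<psi> (e t))\<^sup>2"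
        using \<beta> \<open>f (e t) > 0\<close> by (intro power_mono) auto
      then have "c1 * (\<beta> / f (e t))\<^sup>2 \<le> c1 * (\<psi> (e t))\<^sup>2" using c1 by (intro mult_left_mono) auto
      then have "c1 * (\<beta> / f (e t))\<^sup>2 \<le> D t" using key[OF t] by linarith
      then have "\<alpha> * (c1 * (\<beta> / f (e t))\<^sup>2) \<le> \<alpha> * D t" using \<alpha> by (intro mult_left_mono) auto
      then show "\<alpha> * c1 * \<beta>\<^sup>2 / (f (e t))\<^sup>2 \<le> dissipation \<mu> t"
        using dis[OF t(1)] by (simp add: power_divide mult_ac)
    qed
    have "\<forall>\<^sub>F t in at_top. e t < b \<and> \<kappa> * \<phi> (e t) < \<delta> / 2 \<and> 0 < t"
    proof (intro eventually_conj eventually_gt_at_top)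
      show "\<forall>\<^sub>F t in at_top. e t < b" using order_tendstoD(2)[OF elim b(1)] .
      have "((\<lambda>t. \<kappa> * \<phi> (e t)) \<longlongrightarrow> 0) at_top" using tendsto_mult_right_zero[OF \<phi>lim] .
      then show "\<forall>\<^sub>F t in at_top. \<kappa> * \<phi> (e t) < \<delta> / 2" using \<delta> by (intro order_tendstoD) auto
    qed
    then obtain T where T: "\<And>t. t \<ge> T \<Longrightarrow> e t < b \<and> \<kappa> * \<phi> (e t) < \<delta> / 2 \<and> 0 < t"
      unfolding eventually_at_top_linorder by blast
    obtain N where N: "N \<ge> T" "norm (u N - a) < \<delta> / 2" using cluster[of "\<delta> / 2" T] \<delta> by auto
    have dz: "((\<lambda>t. - \<kappa> * \<phi> (e t)) has_real_derivative \<kappa> * (f (e t) * dissipation \<mu> t)) (at t)" if "t \<ge> N" for t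
    proof -
      have "0 < t" "e t < r" "0 < e t" using T[of t] that N b epos[of t] by auto
      then have "((\<lambda>t. \<phi> (e t)) has_real_derivative f (e t) * - dissipation \<mu> t) (at t)"
        by (intro DERIV_chain2[OF der\<phi> de]) auto
      from DERIV_cmult[OF this, of "- \<kappa>"] show ?thesis by simp
    qed
    \<comment> \<open>\<open>inside\<close> is asked only strictly between \<open>s\<close> and
      \<open>t\<close>, so that the bound can be used up to a first exit time.\<close>
    have travel: "norm (u t - u s) \<le> \<kappa> * \<phi> (e s)"
      if st: "N \<le> s" "s \<le> t" and inside: "\<And>x. s < x \<Longrightarrow> x < t \<Longrightarrow> norm (u x - a) \<le> \<delta>" for s t
    proof (cases "s = t")
      case True
      then show ?thesis using \<phi>nn[of "e s"] e0[of s] T[of s] st N b \<kappa> by simp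
    next
      case False
      have "norm (u t - u s) \<le> - \<kappa> * \<phi> (e t) - - \<kappa> * \<phi> (e s)"
      proof (rule differentiable_bound_general[of s t])
        show "s < t" using st False by simp
        have s0: "0 < s" using T[of s] st N by simp
        then show "continuous_on {s..t} u" by (intro continuous_on_subset[OF cont_u]) auto
        show "continuous_on {s..t} (\<lambda>t. - \<kappa> * \<phi> (e t))"
          using st by (intro continuous_at_imp_continuous_on ballI DERIV_isCont[OF dz]) auto
        fix x assume x: "s < x" "x < t"
        then have x0: "0 < x" "e x < b" using T[of x] st N by auto
        show "(u has_vector_derivative u' x) (at x)" using x0 by (intro u_at)
        show "((\<lambda>t. - \<kappa> * \<phi> (e t)) has_vector_derivative \<kappa> * (f (e x) * dissipation \<mu> x)) (at x)"
          using dz[of x] x st by (simp add: has_real_derivative_iff_has_vector_derivative)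
        have "norm (u' x) \<le> sqrt (D x)" by (rule real_le_rsqrt) (simp add: D_def)
        also have "\<dots> \<le> \<kappa> * (f (e x) * dissipation \<mu> x)" using speed[OF x0(1) inside[OF x] x0(2)] by blast
        finally show "norm (u' x) \<le> \<kappa> * (f (e x) * dissipation \<mu> x)" .
      qed
      moreover have "0 \<le> \<kappa> * \<phi> (e t)" using \<phi>nn[of "e t"] e0[of t] T[of t] st N b \<kappa> by simp
      ultimately show ?thesis by simp
    qed
    \<comment> \<open>\<open>u N\<close> is within \<open>\<delta> / 2\<close> of \<open>a\<close>
      and the travel after \<open>N\<close> is less than \<open>\<delta> / 2\<close>, so the sphere
      of radius \<delta> is never reached.\<close>
    have trap: "norm (u t - a) \<le> \<delta>" if "t \<ge> N" for t
    proof (rule ccontr)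
      assume far: "\<not> ?thesis"
      have N0: "N > 0" using T[of N] N by simp
      have "continuous_on {N..t} (\<lambda>x. norm (u x - a))"
        by (intro continuous_intros continuous_on_subset[OF cont_u]) (use N0 in auto)
      moreover have "norm (u N - a) \<le> \<delta>" using N \<delta> by simp
      ultimately have "\<exists>x\<ge>N. x \<le> t \<and> norm (u x - a) = \<delta>"
        using that far by (intro IVT') auto
      then have ne: "{x \<in> {N..t}. norm (u x - a) = \<delta>} \<noteq> {}" (is "?Z \<noteq> {}") by auto
      have "closed ?Z"
        by (rule continuous_closed_preimage_constant) (use \<open>continuous_on {N..t} _\<close> in auto)
      then have "compact ({N..t} \<inter> ?Z)" by (intro compact_Int_closed compact_Icc)
      moreover have "{N..t} \<inter> ?Z = ?Z" by blast
      ultimately obtain z where z: "z \<in> ?Z" "\<And>x. x \<in> ?Z \<Longrightarrow> z \<le> x"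
        using compact_attains_inf[of ?Z] ne by auto
      have "norm (u x - a) \<le> \<delta>" if x: "N < x" "x < z" for x
      proof (rule ccontr)
        assume "\<not> ?thesis"
        moreover have "continuous_on {N..x} (\<lambda>x. norm (u x - a))"
          by (rule continuous_on_subset[OF \<open>continuous_on {N..t} _\<close>]) (use x z(1) in auto)
        ultimately have "\<exists>y\<ge>N. y \<le> x \<and> norm (u y - a) = \<delta>"
          using x \<open>norm (u N - a) \<le> \<delta>\<close> by (intro IVT') auto
        then obtain y where "N \<le> y" "y \<le> x" "norm (u y - a) = \<delta>" by blast
        then show False using z(2)[of y] x z(1) by auto
      qed
      then have "norm (u z - u N) \<le> \<kappa> * \<phi> (e N)" using z(1) by (intro travel) auto
      also have "\<dots> < \<delta> / 2" using T[of N] N by simp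
      finally have "norm (u z - a) < \<delta>"
        using N(2) norm_triangle_ineq[of "u z - u N" "u N - a"] by simp
      then show False using z(1) by simp
    qed
    show thesis
    proof (rule that[of N \<kappa> "\<alpha> * c1 * \<beta>\<^sup>2"])
      show "N > 0" using T[of N] N by simp
      show "energy \<mu> t - G a < r \<and> norm (u t - a) \<le> \<kappa> * \<phi> (energy \<mu> t - G a)" if t: "t \<ge> N" for t
      proof
        show "energy \<mu> t - G a < r" using T[of t] t N b by (simp add: e_def)
        \<comment> \<open>The travel after \<open>t\<close> bounds the distance from
          \<open>u t\<close> to later points that are arbitrarily close to \<open>a\<close>.\<close>
        have "norm (u t - a) \<le> \<kappa> * \<phi> (e t) + \<epsilon>" if \<epsilon>: "\<epsilon> > 0" for \<epsilon>
        proof -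
          obtain s where s: "s \<ge> t" "norm (u s - a) < \<epsilon>" using cluster[OF \<epsilon>, of t] by blast
          have "norm (u s - u t) \<le> \<kappa> * \<phi> (e t)" using t s by (intro travel trap) auto
          then show ?thesis
            using s norm_triangle_ineq[of "u t - u s" "u s - a"] by (simp add: norm_minus_commute)
        qed
        then show "norm (u t - a) \<le> \<kappa> * \<phi> (energy \<mu> t - G a)"
          unfolding e_def by (rule field_le_epsilon)
      qed
      have "0 < e t \<and> sqrt (D t) \<le> \<kappa> * (f (e t) * dissipation \<mu> t) \<and>
        \<alpha> * c1 * \<beta>\<^sup>2 / (f (e t))\<^sup>2 \<le> dissipation \<mu> t" if "t \<ge> N" for t
        using epos[of t] speed[of t] T[of t] trap[of t] N that by auto
      then show "(\<forall>t\<ge>N. u t = a \<and> D t = 0) \<or> (\<forall>t\<ge>N. 0 < energy \<mu> t - G a \<and>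
        sqrt (D t) \<le> \<kappa> * (f (energy \<mu> t - G a) * dissipation \<mu> t) \<and>
        \<alpha> * c1 * \<beta>\<^sup>2 / (f (energy \<mu> t - G a))\<^sup>2 \<le> dissipation \<mu> t)"
        unfolding e_def by blast
    qed (use \<alpha> \<beta> c1 \<kappa> \<phi>lim in \<open>auto simp: e_def\<close>)
  qed
qed

end

subsection \<open>Convergence and rate\<close>

context o_minimal_structure
begin

lemma worst_case_of_admissible:
  fixes G :: "real ^ 'n::{finite,linorder} \<Rightarrow> real"
  assumes G: "definable_map G" and "C2 G" and crit: "grad G a = 0"
    and adm: "admissible_desingularizing G a r \<phi>"
  shows "\<exists>A b. worst_case r \<phi> (deriv \<phi>) A b"
proof -
  obtain g H where grad: "\<And>x. GDERIV G x :> g x"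
    using C2E[OF \<open>C2 G\<close>] by metis
  have des: "desingularizing G a r \<phi>" using adm by (simp add: admissible_desingularizing_def)
  note d = des[unfolded desingularizing_iff[OF grad]]
  have C1: "\<phi> C1_differentiable_on {0<..<r}" and conc: "concave_on {0..<r} \<phi>" using d by blast+
  obtain \<psi> b \<eta> \<beta> K where b: "b > 0" "b \<le> r" and \<beta>: "\<beta> > 0" and K: "K > 0"
    and \<psi>: "\<And>s. 0 < s \<Longrightarrow> s < b \<Longrightarrow>
      0 < \<psi> s \<and> \<psi> (2 * s) \<le> 4 * \<psi> s \<and> \<psi> s \<le> K * sqrt s \<and> \<beta> / \<psi> s \<le> deriv \<phi> s"
    using admissible_profile[OF G \<open>C2 G\<close> crit adm] by metis
  \<comment> \<open>\<open>\<beta> / \<psi> s \<le> deriv \<phi> s\<close> and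
    \<open>\<psi> s \<le> K * sqrt s\<close> give the growth constant \<open>\<beta> / K\<close>.
    Halving \<open>b\<close> puts the threshold strictly below \<open>r\<close>.\<close>
  have "worst_case r \<phi> (deriv \<phi>) (\<beta> / K) (b / 2)"
  proof
    show "\<beta> / K / sqrt s \<le> deriv \<phi> s" if "0 < s" "s \<le> b / 2" for s
    proof -
      have "\<beta> / K / sqrt s = \<beta> / (K * sqrt s)" by simp
      also have "\<dots> \<le> \<beta> / \<psi> s"
        using \<psi>[of s] that \<beta> K by (intro divide_left_mono mult_pos_pos) auto
      also have "\<dots> \<le> deriv \<phi> s" using \<psi>[of s] that by simp
      finally show ?thesis .
    qed
    show "deriv \<phi> t \<le> deriv \<phi> s" if "0 < s" "s \<le> t" "t < r" for s t
      by (rule concave_deriv_antimono[OF conc C1_deriv(1)[OF C1] that])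
  qed (use d b \<beta> K C1_deriv[OF C1] in auto)
  then show ?thesis by blast
qed

text \<open>Used twice with the same energy: for the constructed desingularizing function, to obtain
  convergence and integrability, and for an arbitrary one, to obtain the rate.\<close>

lemma heavy_ball_decay:
  fixes G :: "real ^ 'n::{finite,linorder} \<Rightarrow> real"
  assumes G: "definable_map G" and "C2 G" and hb: "heavy_ball \<gamma> G g H u u' u''" and crit: "g a = 0"
    and adm: "admissible_desingularizing G a r \<phi>"
    and \<alpha>: "\<alpha> > 0" and C: "C > 0"
    and dis: "\<And>t. t > 0 \<Longrightarrow> \<alpha> * heavy_ball.D g u u' t \<le> heavy_ball.dissipation \<gamma> g H u u' \<mu> t \<and>
      \<bar>heavy_ball.energy G g u u' \<mu> t - G (u t)\<bar> \<le> C * heavy_ball.D g u u' t"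
    and low: "\<And>t. t > 0 \<Longrightarrow> G a \<le> heavy_ball.energy G g u u' \<mu> t"
    and lim: "(heavy_ball.energy G g u u' \<mu> \<longlongrightarrow> G a) at_top"
    and cluster: "\<And>\<epsilon> T. \<epsilon> > 0 \<Longrightarrow> \<exists>t\<ge>T. norm (u t - a) < \<epsilon>"
  obtains N \<kappa> c where "N > 0" "\<kappa> > 0" "c > 0"
    "((\<lambda>t. \<phi> (heavy_ball.energy G g u u' \<mu> t - G a)) \<longlongrightarrow> 0) at_top"
    "\<And>t. t \<ge> N \<Longrightarrow> heavy_ball.energy G g u u' \<mu> t - G a < r \<and>
      norm (u t - a) \<le> \<kappa> * \<phi> (heavy_ball.energy G g u u' \<mu> t - G a)"
    "(\<forall>t\<ge>N. u t = a \<and> heavy_ball.D g u u' t = 0) \<or>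
     (\<forall>t\<ge>N. 0 < heavy_ball.energy G g u u' \<mu> t - G a \<and>
        sqrt (heavy_ball.D g u u' t) \<le> \<kappa> * (deriv \<phi> (heavy_ball.energy G g u u' \<mu> t - G a) *
          heavy_ball.dissipation \<gamma> g H u u' \<mu> t) \<and>
        c / (deriv \<phi> (heavy_ball.energy G g u u' \<mu> t - G a))\<^sup>2 \<le> heavy_ball.dissipation \<gamma> g H u u' \<mu> t)"
proof -
  interpret heavy_ball \<gamma> G g H u u' u'' by (rule hb)
  have g: "grad G = g" using grad_eqI[OF grad] by (simp add: fun_eq_iff)
  have des: "desingularizing G a r \<phi>" using adm by (simp add: admissible_desingularizing_def)
  note d = des[unfolded desingularizing_iff[OF grad]]
  have cont\<phi>: "continuous_on {0..<r} \<phi>" and \<phi>0: "\<phi> 0 = 0" and "\<phi> ` {0..<r} \<subseteq> {0..}"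
    and C1: "\<phi> C1_differentiable_on {0<..<r}" using d by blast+
  then have \<phi>nn: "0 \<le> \<phi> s" if "0 \<le> s" "s < r" for s
    using that by (simp add: image_subset_iff)
  obtain \<psi> b \<eta> \<beta> K where b: "b > 0" "b \<le> r" and \<eta>: "\<eta> > 0" and \<beta>: "\<beta> > 0" and K: "K > 0"
    and \<psi>: "\<And>s. 0 < s \<Longrightarrow> s < b \<Longrightarrow>
      0 < \<psi> s \<and> \<psi> (2 * s) \<le> 4 * \<psi> s \<and> \<psi> s \<le> K * sqrt s \<and> \<beta> / \<psi> s \<le> deriv \<phi> s"
    and mono: "\<And>s t. 0 < s \<Longrightarrow> s \<le> t \<Longrightarrow> t < b \<Longrightarrow> \<psi> s \<le> \<psi> t"
    and least: "\<And>y. norm (y - a) \<le> \<eta> \<Longrightarrow> 0 < \<bar>G y - G a\<bar> \<Longrightarrow> \<bar>G y - G a\<bar> < b \<Longrightarrow>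
      \<psi> \<bar>G y - G a\<bar> \<le> norm (g y)"
    using admissible_profile[OF G \<open>C2 G\<close> _ adm] crit unfolding g by metis
  show thesis
    by (rule trajectory_decay[OF \<alpha> C dis low lim cluster cont\<phi> \<phi>0 \<phi>nn C1_deriv(1)[OF C1] b \<eta> \<beta> K \<psi> mono least])
      (assumption | rule that)+
qed

end

text \<open>A bound from time \<open>T\<close> on extends to all times, because before
  \<open>T\<close> the function \<open>x\<close> is bounded above while \<nu> is at least
  \<open>exp (- C * T) * \<nu> 0\<close>.\<close>

lemma bound_by_solution:
  fixes x \<nu> :: "real \<Rightarrow> real"
  assumes bdd: "\<And>t. t \<ge> 0 \<Longrightarrow> x t \<le> B" and late: "\<And>t. t \<ge> T \<Longrightarrow> x t \<le> A * \<nu> t"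
    and \<nu>: "\<And>t. t \<ge> 0 \<Longrightarrow> \<nu> 0 \<le> exp (C * t) * \<nu> t" "\<nu> 0 > 0" and C: "C \<ge> 0"
  shows "\<exists>c. \<forall>t\<ge>0. x t \<le> c * \<nu> t"
proof (intro exI allI impI)
  fix t :: real assume t: "t \<ge> 0"
  define A' where "A' = \<bar>B\<bar> * exp (C * T) / \<nu> 0"
  have "0 < exp (C * t) * \<nu> t" using \<nu>(1)[OF t] \<nu>(2) by linarith
  then have pos: "\<nu> t > 0" by (simp add: zero_less_mult_iff)
  show "x t \<le> max A A' * \<nu> t"
  proof (cases "T \<le> t")
    case True
    have "x t \<le> A * \<nu> t" by (rule late[OF True])
    also have "\<dots> \<le> max A A' * \<nu> t" using pos by (intro mult_right_mono) auto
    finally show ?thesis .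
  next
    case False
    have "\<nu> 0 \<le> exp (C * T) * \<nu> t"
    proof (rule order_trans[OF \<nu>(1)[OF t]])
      show "exp (C * t) * \<nu> t \<le> exp (C * T) * \<nu> t"
        using False C pos by (intro mult_right_mono) (auto intro: mult_left_mono)
    qed
    then have "\<bar>B\<bar> * \<nu> 0 \<le> \<bar>B\<bar> * (exp (C * T) * \<nu> t)" by (intro mult_left_mono) auto
    then have "\<bar>B\<bar> \<le> A' * \<nu> t" using \<nu>(2) by (simp add: A'_def field_simps)
    also have "\<dots> \<le> max A A' * \<nu> t" using pos by (intro mult_right_mono) auto
    finally show ?thesis using bdd[OF t] by linarith
  qed
qed

text \<open>In the second part the worst-case system belongs to a multiple of the given
  \<open>\<phi>\<^sub>0\<close>, which is again desingularizing: the energy dissipates a fixed but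
  possibly small fraction of the speed prescribed by \<open>\<phi>\<^sub>0\<close>, and the multiple
  absorbs that fraction. The factor is chosen before \<nu>.\<close>

theorem corollary5p2:
  fixes \<O> :: "nat \<Rightarrow> real list set set"
    and \<gamma> :: real
    and G :: "real ^ 'n::{finite,linorder} \<Rightarrow> real"
    and u u' u'' :: "real \<Rightarrow> real ^ 'n::{finite,linorder}"
  assumes "o_minimal \<O>"
    and "\<And>n A. semialgebraic n A \<Longrightarrow> A \<in> \<O> n"
    and "\<gamma> > 0"
    and "C2 G"
    and "definable_fun \<O> G"
    and "\<And>t. t \<ge> 0 \<Longrightarrow> (u has_vector_derivative u' t) (at t within {0..})"
    and "\<And>t. t \<ge> 0 \<Longrightarrow> (u' has_vector_derivative u'' t) (at t within {0..})"
    and "\<And>t. t \<ge> 0 \<Longrightarrow> u'' t + \<gamma> *\<^sub>R u' t + grad G (u t) = 0"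
    and "bounded (u ` {0..})"
  shows "(u' absolutely_integrable_on {0<..} \<and> u'' absolutely_integrable_on {0<..} \<and>
          (\<exists>ulim\<in>crit G. (u \<longlongrightarrow> ulim) at_top)) \<and>
         (\<forall>ulim. (u \<longlongrightarrow> ulim) at_top \<longrightarrow>
            (\<exists>r \<phi>. admissible_desingularizing G ulim r \<phi>) \<and>
            (\<forall>r \<phi>\<^sub>0. admissible_desingularizing G ulim r \<phi>\<^sub>0 \<longrightarrow>
               (\<exists>\<kappa>\<ge>1. let \<phi> = (\<lambda>s. \<kappa> * \<phi>\<^sub>0 s) in
                  admissible_desingularizing G ulim r \<phi> \<and>
                  (\<exists>\<nu>. worst_case_solution r \<phi> \<nu>) \<and>
                  (\<forall>\<nu>. worst_case_solution r \<phi> \<nu> \<longrightarrow>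
                     (\<exists>c. \<forall>t\<ge>0. norm (u t - ulim) \<le> c * \<nu> t)))))"
proof -
  interpret o_minimal_structure \<O> by standard (rule assms(1))
  have G: "definable_map G" using assms(5) by (simp add: definable_fun_iff)
  obtain g H where g: "g = grad G" and grad: "\<And>x. GDERIV G x :> g x"
    and der: "\<And>x. (g has_derivative blinfun_apply (H x)) (at x)" "continuous_on UNIV H"
    using C2E[OF assms(4)] by metis
  have hb: "heavy_ball \<gamma> G g H u u' u''"
    by standard (use assms(3,6-9) grad der g in auto)
  interpret heavy_ball \<gamma> G g H u u' u'' by (rule hb)
  obtain \<mu> \<alpha> C B where \<alpha>: "\<alpha> > 0" and C: "C > 0"
    and dis: "\<And>t. t > 0 \<Longrightarrow> \<alpha> * D t \<le> dissipation \<mu> t \<and> \<bar>energy \<mu> t - G (u t)\<bar> \<le> C * D t \<and> B \<le> energy \<mu> t"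
    using lyapunov by metis
  obtain a where ga: "g a = 0" and low: "\<And>t. t > 0 \<Longrightarrow> G a \<le> energy \<mu> t"
    and lim: "(energy \<mu> \<longlongrightarrow> G a) at_top" and cluster: "\<And>\<epsilon> T. \<epsilon> > 0 \<Longrightarrow> \<exists>t\<ge>T. norm (u t - a) < \<epsilon>"
    using cluster_point[OF \<alpha> C dis] by metis
  have crit: "grad G a = 0" using ga by (simp add: g)
  have dis': "\<alpha> * D t \<le> dissipation \<mu> t \<and> \<bar>energy \<mu> t - G (u t)\<bar> \<le> C * D t" if "t > 0" for t
    using dis[OF that] by blast
  note hb_decay = heavy_ball_decay[OF G assms(4) hb ga _ \<alpha> C dis' low lim cluster]
  define e where "e t = energy \<mu> t - G a" for t
  have de: "(e has_real_derivative - dissipation \<mu> t) (at t)" if "t > 0" for t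
    unfolding e_def using energy_derivative[OF that] by (auto intro!: derivative_eq_intros)
  obtain r1 \<phi>1 where adm1: "admissible_desingularizing G a r1 \<phi>1"
    using exists_admissible_desingularizing[OF G assms(4) crit] by blast
  obtain N1 \<kappa>1 c1 where N1: "N1 > 0" and \<kappa>1: "\<kappa>1 > 0"
    and lim1: "((\<lambda>t. \<phi>1 (e t)) \<longlongrightarrow> 0) at_top"
    and near1: "\<And>t. t \<ge> N1 \<Longrightarrow> e t < r1 \<and> norm (u t - a) \<le> \<kappa>1 * \<phi>1 (e t)"
    and alt1: "(\<forall>t\<ge>N1. u t = a \<and> D t = 0) \<or>
     (\<forall>t\<ge>N1. 0 < e t \<and> sqrt (D t) \<le> \<kappa>1 * (deriv \<phi>1 (e t) * dissipation \<mu> t) \<and>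
        c1 / (deriv \<phi>1 (e t))\<^sup>2 \<le> dissipation \<mu> t)"
    by (rule hb_decay[OF adm1, folded e_def]) (assumption | rule that)+
  have conv: "(u \<longlongrightarrow> a) at_top"
  proof (rule Lim_null[THEN iffD2], rule Lim_null_comparison)
    show "((\<lambda>t. \<kappa>1 * \<phi>1 (e t)) \<longlongrightarrow> 0) at_top" using tendsto_mult_right_zero[OF lim1] .
    show "\<forall>\<^sub>F t in at_top. norm (u t - a) \<le> \<kappa>1 * \<phi>1 (e t)"
      using near1 by (intro eventually_at_top_linorderI[of N1]) auto
  qed
  have des1: "desingularizing G a r1 \<phi>1" using adm1 by (simp add: admissible_desingularizing_def)
  note d1 = des1[unfolded desingularizing_iff[OF grad]]
  \<comment> \<open>If the motion goes on, \<Phi> is a multiple of \<open>\<phi>1 (e t)\<close>. If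
    it has stopped, \<open>e t\<close> may be 0, where \<open>\<phi>1\<close> need not be
    differentiable, and a constant serves.\<close>
  have "\<exists>\<Phi> \<Phi>'. \<forall>t\<ge>N1. (\<Phi> has_real_derivative \<Phi>' t) (at t) \<and> sqrt (D t) \<le> - \<Phi>' t \<and> 0 \<le> \<Phi> t"
    using alt1
  proof
    assume "\<forall>t\<ge>N1. u t = a \<and> D t = 0"
    then show ?thesis by (intro exI[of _ "\<lambda>_. 0"]) auto
  next
    assume *: "\<forall>t\<ge>N1. 0 < e t \<and> sqrt (D t) \<le> \<kappa>1 * (deriv \<phi>1 (e t) * dissipation \<mu> t) \<and>
        c1 / (deriv \<phi>1 (e t))\<^sup>2 \<le> dissipation \<mu> t"
    show ?thesis
    proof (rule exI[of _ "\<lambda>t. \<kappa>1 * \<phi>1 (e t)"],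
        rule exI[of _ "\<lambda>t. \<kappa>1 * (deriv \<phi>1 (e t) * - dissipation \<mu> t)"], intro allI impI)
      fix t assume t: "t \<ge> N1"
      have r: "0 < e t" "e t < r1" using * near1 t by auto
      have "((\<lambda>t. \<kappa>1 * \<phi>1 (e t)) has_real_derivative \<kappa>1 * (deriv \<phi>1 (e t) * - dissipation \<mu> t)) (at t)"
        using d1 t N1 by (intro DERIV_cmult DERIV_chain2[OF C1_deriv(1)[OF _ r] de]) auto
      moreover have "0 \<le> \<phi>1 (e t)" using d1 r by (simp add: image_subset_iff)
      ultimately show "((\<lambda>t. \<kappa>1 * \<phi>1 (e t)) has_real_derivative \<kappa>1 * (deriv \<phi>1 (e t) * - dissipation \<mu> t)) (at t) \<and>
        sqrt (D t) \<le> - (\<kappa>1 * (deriv \<phi>1 (e t) * - dissipation \<mu> t)) \<and> 0 \<le> \<kappa>1 * \<phi>1 (e t)"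
        using * t \<kappa>1 by simp
    qed
  qed
  then obtain \<Phi> \<Phi>' where \<Phi>: "\<And>t. t \<ge> N1 \<Longrightarrow> (\<Phi> has_real_derivative \<Phi>' t) (at t)"
    and \<Phi>le: "\<And>t. t \<ge> N1 \<Longrightarrow> sqrt (D t) \<le> - \<Phi>' t" and \<Phi>0: "\<And>t. t \<ge> N1 \<Longrightarrow> 0 \<le> \<Phi> t"
    by blast
  have sD: "norm (u' t) \<le> sqrt (D t)" "norm (g (u t)) \<le> sqrt (D t)" for t
    by (rule real_le_rsqrt, simp add: D_def)+
  have int1: "u' absolutely_integrable_on {0<..}"
    by (rule absolutely_integrable_of_dominating_decay[OF cont_u' N1 \<Phi> _ \<Phi>0])
      (use sD(1) \<Phi>le in \<open>auto intro: order_trans\<close>)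
  have u''_eq: "u'' t = - (\<gamma> *\<^sub>R u' t) - g (u t)" if "t \<ge> 0" for t
    using ode[OF that] by (simp add: algebra_simps eq_neg_iff_add_eq_0)
  have int2: "u'' absolutely_integrable_on {0<..}"
  proof (rule absolutely_integrable_of_dominating_decay[OF _ N1, where \<Phi> = "\<lambda>t. (\<gamma> + 1) * \<Phi> t"
        and \<Phi>' = "\<lambda>t. (\<gamma> + 1) * \<Phi>' t" and L = 0])
    have "continuous_on {0..} (\<lambda>t. - (\<gamma> *\<^sub>R u' t) - g (u t))"
      by (intro continuous_intros cont_u' cont_gu)
    then show "continuous_on {0..} u''"
      by (rule continuous_on_cong[THEN iffD1, rotated -1]) (auto simp: u''_eq)
    fix t assume t: "t \<ge> N1"
    show "((\<lambda>t. (\<gamma> + 1) * \<Phi> t) has_real_derivative (\<gamma> + 1) * \<Phi>' t) (at t)"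
      by (intro DERIV_cmult \<Phi> t)
    have "norm (u'' t) \<le> \<gamma> * norm (u' t) + norm (g (u t))"
      using norm_triangle_ineq4[of "- (\<gamma> *\<^sub>R u' t)" "g (u t)"] u''_eq[of t] t N1 \<gamma> by simp
    also have "\<dots> \<le> \<gamma> * sqrt (D t) + sqrt (D t)"
      using sD[of t] \<gamma> by (intro add_mono mult_left_mono) auto
    also have "\<dots> = (\<gamma> + 1) * sqrt (D t)" by (simp add: algebra_simps)
    also have "\<dots> \<le> (\<gamma> + 1) * - \<Phi>' t" using \<Phi>le[OF t] \<gamma> by (intro mult_left_mono) auto
    finally show "norm (u'' t) \<le> - ((\<gamma> + 1) * \<Phi>' t)" by simp
    show "0 \<le> (\<gamma> + 1) * \<Phi> t" using \<Phi>0[OF t] \<gamma> by simp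
  qed
  obtain R where R: "\<And>t. t \<ge> 0 \<Longrightarrow> norm (u t) \<le> R"
    using bdd unfolding bounded_iff by auto
  have far: "norm (u t - a) \<le> R + norm a" if "t \<ge> 0" for t
    using norm_triangle_ineq4[of "u t" a] R[OF that] by linarith
  have rate: "\<exists>\<kappa>\<ge>1. let \<phi> = (\<lambda>s. \<kappa> * \<phi>\<^sub>0 s) in
      admissible_desingularizing G a r \<phi> \<and> (\<exists>\<nu>. worst_case_solution r \<phi> \<nu>) \<and>
      (\<forall>\<nu>. worst_case_solution r \<phi> \<nu> \<longrightarrow> (\<exists>c. \<forall>t\<ge>0. norm (u t - a) \<le> c * \<nu> t))"
    if adm: "admissible_desingularizing G a r \<phi>\<^sub>0" for r \<phi>\<^sub>0
  proof -
    obtain N \<kappa>0 c where N: "N > 0" and \<kappa>0: "\<kappa>0 > 0" and c: "c > 0"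
      and lim0: "((\<lambda>t. \<phi>\<^sub>0 (e t)) \<longlongrightarrow> 0) at_top"
      and near: "\<And>t. t \<ge> N \<Longrightarrow> e t < r \<and> norm (u t - a) \<le> \<kappa>0 * \<phi>\<^sub>0 (e t)"
      and alt: "(\<forall>t\<ge>N. u t = a \<and> D t = 0) \<or>
       (\<forall>t\<ge>N. 0 < e t \<and> sqrt (D t) \<le> \<kappa>0 * (deriv \<phi>\<^sub>0 (e t) * dissipation \<mu> t) \<and>
          c / (deriv \<phi>\<^sub>0 (e t))\<^sup>2 \<le> dissipation \<mu> t)"
      by (rule hb_decay[OF adm, folded e_def]) (assumption | rule that)+
    have des: "desingularizing G a r \<phi>\<^sub>0" using adm by (simp add: admissible_desingularizing_def)
    note d = des[unfolded desingularizing_iff[OF grad]]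
    \<comment> \<open>The bound \<open>1 / \<kappa>\<^sup>2 \<le> c\<close> turns the decay rate
      \<open>c / (deriv \<phi>\<^sub>0 s)\<^sup>2\<close> of the energy into at least
      \<open>1 / (deriv \<phi> s)\<^sup>2\<close> for the multiple \<phi>; the maximum with 1 keeps
      \<phi> desingularizing.\<close>
    define \<kappa> where "\<kappa> = max 1 (1 / sqrt c)"
    have \<kappa>: "\<kappa> \<ge> 1" by (simp add: \<kappa>_def)
    have \<kappa>c: "1 / \<kappa>\<^sup>2 \<le> c"
    proof -
      have "(1 / sqrt c)\<^sup>2 \<le> \<kappa>\<^sup>2" using c by (intro power_mono) (auto simp: \<kappa>_def)
      then have "1 / c \<le> \<kappa>\<^sup>2" using c by (simp add: power_divide)
      moreover have "\<kappa>\<^sup>2 > 0" using \<kappa> by (simp add: zero_less_power)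
      ultimately show ?thesis using c by (simp add: field_simps)
    qed
    define \<phi> where "\<phi> = (\<lambda>s. \<kappa> * \<phi>\<^sub>0 s)"
    have adm\<phi>: "admissible_desingularizing G a r \<phi>"
      unfolding \<phi>_def by (rule admissible_scale[OF grad adm \<kappa>])
    obtain A b where "worst_case r \<phi> (deriv \<phi>) A b"
      using worst_case_of_admissible[OF G assms(4) crit adm\<phi>] by blast
    then interpret wc: worst_case r \<phi> "deriv \<phi>" A b .
    have "\<exists>c. \<forall>t\<ge>0. norm (u t - a) \<le> c * \<nu> t" if sol: "worst_case_solution r \<phi> \<nu>" for \<nu>
    proof -
      note p = wc.solution_properties[OF sol]
      obtain K where K: "K \<ge> 0" "\<And>s t. 0 \<le> s \<Longrightarrow> s \<le> t \<Longrightarrow> exp (K * s) * \<nu> s \<le> exp (K * t) * \<nu> t"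
        using p(4) by blast
      have "\<exists>T A. \<forall>t\<ge>T. norm (u t - a) \<le> A * \<nu> t"
        using alt
      proof
        assume "\<forall>t\<ge>N. u t = a \<and> D t = 0"
        then show ?thesis by (intro exI[of _ N] exI[of _ 0]) auto
      next
        assume *: "\<forall>t\<ge>N. 0 < e t \<and> sqrt (D t) \<le> \<kappa>0 * (deriv \<phi>\<^sub>0 (e t) * dissipation \<mu> t) \<and>
          c / (deriv \<phi>\<^sub>0 (e t))\<^sup>2 \<le> dissipation \<mu> t"
        have "((\<lambda>t. \<phi> (e t)) \<longlongrightarrow> 0) at_top"
          unfolding \<phi>_def using tendsto_mult_right_zero[OF lim0] .
        then have "\<forall>\<^sub>F t in at_top. \<phi> (e t) < \<nu> 0 \<and> N \<le> t"
          using p(2)[of 0] by (intro eventually_conj order_tendstoD eventually_ge_at_top) auto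
        \<comment> \<open>\<nu> may start at a small value, so the comparison begins at a time
          \<open>T\<close> when \<open>\<phi> (e T)\<close> is already below it. The delay is paid
          for later by the factor \<open>exp (K * T)\<close>.\<close>
        then obtain T where T: "\<phi> (e T) < \<nu> 0" "N \<le> T"
          using eventually_happens'[OF trivial_limit_at_top_linorder] by blast
        have cmp: "\<phi> (e (T + t)) \<le> \<nu> t" if "t \<ge> 0" for t
        proof (rule wc.comparison[OF sol, where E = "\<lambda>t. e (T + t)" and E' = "\<lambda>t. - dissipation \<mu> (T + t)"])
          fix t :: real assume t: "t \<ge> 0"
          then have tN: "T + t \<ge> N" "T + t > 0" using T N by auto
          show er: "0 < e (T + t) \<and> e (T + t) < r" using * near tN by blast
          show "((\<lambda>t. e (T + t)) has_real_derivative - dissipation \<mu> (T + t)) (at t)"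
          proof -
            have "((\<lambda>t. T + t) has_real_derivative 1) (at t)" by (auto intro!: derivative_eq_intros)
            then show ?thesis
              using DERIV_chain2[where g = "\<lambda>t. T + t" and Db = 1, OF de[OF tN(2)], of UNIV] by simp
          qed
          have "deriv \<phi> (e (T + t)) = \<kappa> * deriv \<phi>\<^sub>0 (e (T + t))"
            unfolding \<phi>_def using d er by (intro DERIV_imp_deriv DERIV_cmult C1_deriv(1)[of _ r]) auto
          then have "1 / (deriv \<phi> (e (T + t)))\<^sup>2 = (1 / \<kappa>\<^sup>2) / (deriv \<phi>\<^sub>0 (e (T + t)))\<^sup>2"
            by (simp add: power_mult_distrib)
          also have "\<dots> \<le> c / (deriv \<phi>\<^sub>0 (e (T + t)))\<^sup>2" using \<kappa>c by (intro divide_right_mono) auto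
          also have "\<dots> \<le> dissipation \<mu> (T + t)" using * tN by blast
          finally show "- dissipation \<mu> (T + t) \<le> - (1 / (deriv \<phi> (e (T + t)))\<^sup>2)" by simp
        qed (use T that in auto)
        have "norm (u t - a) \<le> (\<kappa>0 * exp (K * T)) * \<nu> t" if t: "t \<ge> T" for t
        proof -
          have er: "0 < e t" "e t < r" using * near t T by (meson order_trans)+
          then have "0 \<le> \<phi>\<^sub>0 (e t)" using d by (simp add: image_subset_iff)
          then have "1 * \<phi>\<^sub>0 (e t) \<le> \<phi> (e t)" unfolding \<phi>_def using \<kappa> by (intro mult_right_mono)
          also have "\<dots> \<le> \<nu> (t - T)" using cmp[of "t - T"] t by simp
          also have "\<dots> \<le> exp (K * T) * \<nu> t"
          proof -
            have "exp (K * (t - T)) * \<nu> (t - T) \<le> exp (K * t) * \<nu> t"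
              using t T N by (intro K) auto
            also have "\<dots> = exp (K * (t - T)) * (exp (K * T) * \<nu> t)"
              by (simp add: algebra_simps flip: exp_add)
            finally show ?thesis by simp
          qed
          finally have "\<kappa>0 * \<phi>\<^sub>0 (e t) \<le> \<kappa>0 * (exp (K * T) * \<nu> t)"
            using \<kappa>0 by (intro mult_left_mono) auto
          then show ?thesis using near[of t] t T by (simp add: mult.assoc)
        qed
        then show ?thesis by blast
      qed
      then obtain T A where late: "\<And>t. t \<ge> T \<Longrightarrow> norm (u t - a) \<le> A * \<nu> t" by blast
      show ?thesis
        by (rule bound_by_solution[OF far late _ _ K(1)]) (use K(2)[of 0] p(2)[of 0] in auto)
    qed
    then have "let \<phi> = (\<lambda>s. \<kappa> * \<phi>\<^sub>0 s) in
      admissible_desingularizing G a r \<phi> \<and> (\<exists>\<nu>. worst_case_solution r \<phi> \<nu>) \<and>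
      (\<forall>\<nu>. worst_case_solution r \<phi> \<nu> \<longrightarrow> (\<exists>c. \<forall>t\<ge>0. norm (u t - a) \<le> c * \<nu> t))"
      using adm\<phi> wc.solution_exists unfolding Let_def \<phi>_def by blast
    with \<kappa> show ?thesis by blast
  qed
  have uniq: "ulim = a" if "(u \<longlongrightarrow> ulim) at_top" for ulim
    by (rule tendsto_unique[OF trivial_limit_at_top_linorder that conv])
  have "a \<in> crit G" using crit by (simp add: crit_def)
  then show ?thesis
    using int1 int2 conv rate adm1 uniq by blast
qed

end
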